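(* Let $\mathcal{A}$ be a properly infinite von Neumann algebra acting on a Hilbert space $H$. Let $T\in\mathcal{A}$ be an $\mathcal{A}$-$B$-Fredholm operator and let $m\in\mathbb{N}$ be the smallest $m$ such that $\operatorname{Im}T^n$ is closed for all $n\geq m$, $P_{\operatorname{Im}T^m}$ is not finite, and $TP_{\operatorname{Im}T^m}\in\mathcal{K}\Phi(P_{\operatorname{Im}T^m}\mathcal{A}P_{\operatorname{Im}T^m})$. Let $F\in\mathcal{A}$ be a finite operator and suppose that $\operatorname{Im}(T+F)^n$ is closed for all $n\geq m$. Then $T+F$ is an $\mathcal{A}$-$B$-Fredholm operator and $\operatorname{index}(T+F)=\operatorname{index}T$.
   Context: For a closed subspace $L$ of $H$, $P_L$ is the orthogonal projection onto $L$. A projection of $\mathcal{A}$ is finite if it is not Murray–von Neumann equivalent in $\mathcal{A}$ to any of its proper subprojections. $S\in\mathcal{A}$ is a finite operator if $P_{\overline{\operatorname{Im}S}}$ is a finite projection of $\mathcal{A}$. For a projection $R\in\mathcal{A}$ and projections $p,q\in R\mathcal{A}R$, an element $a\in R\mathcal{A}R$ is invertible up to $(p,q)$ in $R\mathcal{A}R$ if there is $b\in R\mathcal{A}R$ with $b=(R-p)b(R-q)$, $(R-q)a(R-p)b=R-q$ and $b(R-q)a(R-p)=R-p$. $\mathcal{K}\Phi(R\mathcal{A}R)$ is the set of $a\in R\mathcal{A}R$ that are invertible up to $(p,q)$ in $R\mathcal{A}R$ for some finite projections $p,q\in R\mathcal{A}R$ (finiteness in $R\mathcal{A}R$ and in $\mathcal{A}$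 agree). Such elements are the "$\mathcal{A}$-Fredholm" operators in the corner $R\mathcal{A}R$. $T\in\mathcal{A}$ is an $\mathcal{A}$-$B$-Fredholm operator if there is $n\in\mathbb{N}$ such that $\operatorname{Im}T^k$ is closed for all $k\geq n$, $P_{\operatorname{Im}T^n}$ is not finite, and $TP_{\operatorname{Im}T^n}\in\mathcal{K}\Phi(P_{\operatorname{Im}T^n}\mathcal{A}P_{\operatorname{Im}T^n})$. Index: $I(\mathcal{A})$ is the Grothendieck group of the commutative monoid of Murray–von Neumann classes $[P]$ of finite projections $P\in\mathcal{A}$, with $[P]+[Q]=[P'+Q']$ for $P'\sim P$, $Q'\sim Q$, $P'Q'=0$ (equivalently, of the classes of the representations $S\mapsto ES$ of the commutant $\mathcal{A}'$ for finite projections $E\in\mathcal{A}$). For $a\in\mathcal{K}\Phi(R\mathcal{A}R)$, $\operatorname{index}a=[P_{\ker a\cap R(H)}]-[R-P_{\overline{\operatorname{Im}a}}]\in I(\mathcal{A})$. For an $\mathcal{A}$-$B$-Fredholm operator $T$, $\operatorname{index}T:=\operatorname{index}TP_{\operatorname{Im}T^n}$, where $n$ is the smallest $n$ such that $\operatorname{Im}T^k$ is closed for all $k\ge n$ and $TP_{\operatorname{Im}T^n}\in\mathcal{K}\Phi(P_{\operatorname{Im}T^n}\mathcal{A}P_{\operatorname{Im}T^n})$. *)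

theory Defs
  imports "HOL-Analysis.Analysis" "HOL-Algebra.Group"
begin

section \<open>Complex Hilbert spaces and bounded operators\<close>

text \<open>The norm, metric and topology come from \<^class>\<open>real_inner\<close>; the axiom
  \<open>inner_eq_Re_cinner\<close> says that they are the ones induced by the complex inner product, which is
  linear in its first argument.\<close>

class complex_hilbert_space = real_inner + complete_space +
  fixes scaleC :: "complex \<Rightarrow> 'a \<Rightarrow> 'a"
    and cinner :: "'a \<Rightarrow> 'a \<Rightarrow> complex"
  assumes scaleC_add_right: "scaleC a (x + y) = scaleC a x + scaleC a y"
    and scaleC_add_left: "scaleC (a + b) x = scaleC a x + scaleC b x"
    and scaleC_scaleC: "scaleC a (scaleC b x) = scaleC (a * b) x"
    and scaleR_eq_scaleC: "scaleR r x = scaleC (complex_of_real r) x"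
    and cinner_commute: "cinner x y = cnj (cinner y x)"
    and cinner_add_left: "cinner (x + y) z = cinner x z + cinner y z"
    and cinner_scaleC_left: "cinner (scaleC a x) y = a * cinner x y"
    and inner_eq_Re_cinner: "inner x y = Re (cinner x y)"

instantiation complex :: complex_hilbert_space
begin

definition "scaleC a (x :: complex) = a * x"
definition "cinner x (y :: complex) = x * cnj y"

instance
  by standard
    (simp_all add: scaleC_complex_def cinner_complex_def algebra_simps scaleR_conv_of_real
      inner_complex_def)

end

text \<open>The type \<open>'h \<Rightarrow>\<^sub>L 'h\<close> consists of the bounded real-linear operators.\<close>

definition bounded_ops :: "('h::complex_hilbert_space \<Rightarrow>\<^sub>L 'h) set" where
  "bounded_ops = {A. \<forall>c x. blinfun_apply A (scaleC c x) = scaleC c (blinfun_apply A x)}"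

definition is_adjoint ::
    "('h::complex_hilbert_space \<Rightarrow>\<^sub>L 'h) \<Rightarrow> ('h \<Rightarrow>\<^sub>L 'h) \<Rightarrow> bool" where
  "is_adjoint A B \<longleftrightarrow>
     (\<forall>x y. cinner (blinfun_apply A x) y = cinner x (blinfun_apply B y))"

text \<open>Self-adjointness with respect to \<^const>\<open>cinner\<close> forces complex linearity.\<close>

definition projection :: "('h::complex_hilbert_space \<Rightarrow>\<^sub>L 'h) \<Rightarrow> bool" where
  "projection P \<longleftrightarrow> is_adjoint P P \<and> P o\<^sub>L P = P"

lemma projection_in_bounded_ops:
  assumes "projection P"
  shows "P \<in> bounded_ops"
proof -
  have adj: "cinner (P x) y = cinner x (P y)" for x y
    using assms by (simp add: projection_def is_adjoint_def)
  have "P (scaleC c x) = scaleC c (P x)" for c x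
  proof -
    define d where "d = P (scaleC c x) - scaleC c (P x)"
    have "cinner (P (scaleC c x)) y = cinner (scaleC c (P x)) y" for y
      by (simp add: adj cinner_scaleC_left)
    moreover have "cinner (P (scaleC c x)) y = cinner d y + cinner (scaleC c (P x)) y" for y
      unfolding d_def cinner_add_left[symmetric] by simp
    ultimately have "cinner d d = 0"
      by simp
    then have "inner d d = 0"
      by (simp add: inner_eq_Re_cinner)
    then show ?thesis
      by (simp add: d_def)
  qed
  then show ?thesis
    by (simp add: bounded_ops_def)
qed

text \<open>\<open>proj_onto L\<close> is \<open>P\<^sub>L\<close>; it is meaningful for closed complex subspaces \<open>L\<close> only.\<close>

definition proj_onto :: "'h::complex_hilbert_space set \<Rightarrow> ('h \<Rightarrow>\<^sub>L 'h)" where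
  "proj_onto L = (THE P. projection P \<and> range (blinfun_apply P) = L)"

lemma proj_onto_range:
  assumes "projection P"
  shows "proj_onto (range (blinfun_apply P)) = P"
  unfolding proj_onto_def
proof (rule the_equality)
  show "projection P \<and> range (blinfun_apply P) = range (blinfun_apply P)"
    using assms by simp
next
  fix Q assume Q: "projection Q \<and> range (blinfun_apply Q) = range (blinfun_apply P)"
  have idem: "P (P x) = P x" "Q (Q x) = Q x" for x
    using assms Q by (metis projection_def blinfun_apply_blinfun_compose)+
  have PQ: "P (Q x) = Q x" "Q (P x) = P x" for x
    using Q idem by (metis rangeE rangeI)+
  have adj: "inner (P x) y = inner x (P y)" "inner (Q x) y = inner x (Q y)" for x y
    using assms Q by (simp_all add: projection_def is_adjoint_def inner_eq_Re_cinner)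
  have "inner (Q x) y = inner (P x) y" for x y
    by (metis adj PQ)
  then have "Q x = P x" for x
    by (metis inner_eq_zero_iff inner_diff_left right_minus_eq)
  then show "Q = P"
    by (simp add: blinfun_eqI)
qed

section \<open>Von Neumann algebras and Murray-von Neumann equivalence\<close>

definition commutant ::
    "('h::complex_hilbert_space \<Rightarrow>\<^sub>L 'h) set \<Rightarrow> ('h \<Rightarrow>\<^sub>L 'h) set" where
  "commutant X = {S \<in> bounded_ops. \<forall>A\<in>X. S o\<^sub>L A = A o\<^sub>L S}"

text \<open>Dixmier's definition: a self-adjoint set of operators that equals its bicommutant.
  Being a commutant, such a set is a unital subalgebra of the bounded operators.\<close>

definition von_neumann_algebra :: "('h::complex_hilbert_space \<Rightarrow>\<^sub>L 'h) set \<Rightarrow> bool" where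
  "von_neumann_algebra \<A> \<longleftrightarrow>
     (\<forall>A\<in>\<A>. \<exists>B\<in>\<A>. is_adjoint A B) \<and> commutant (commutant \<A>) = \<A>"

definition mvn_equiv ::
    "('h::complex_hilbert_space \<Rightarrow>\<^sub>L 'h) set \<Rightarrow> ('h \<Rightarrow>\<^sub>L 'h) \<Rightarrow> ('h \<Rightarrow>\<^sub>L 'h) \<Rightarrow> bool" where
  "mvn_equiv \<A> P Q \<longleftrightarrow>
     (\<exists>V\<in>\<A>. \<exists>W\<in>\<A>. is_adjoint V W \<and> W o\<^sub>L V = P \<and> V o\<^sub>L W = Q)"

definition finite_projection ::
    "('h::complex_hilbert_space \<Rightarrow>\<^sub>L 'h) set \<Rightarrow> ('h \<Rightarrow>\<^sub>L 'h) \<Rightarrow> bool" where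
  "finite_projection \<A> P \<longleftrightarrow> P \<in> \<A> \<and> projection P \<and>
     (\<forall>Q\<in>\<A>. projection Q \<and> P o\<^sub>L Q = Q \<and> mvn_equiv \<A> P Q \<longrightarrow> Q = P)"

definition properly_infinite :: "('h::complex_hilbert_space \<Rightarrow>\<^sub>L 'h) set \<Rightarrow> bool" where
  "properly_infinite \<A> \<longleftrightarrow> (\<forall>Z \<in> \<A> \<inter> commutant \<A>. finite_projection \<A> Z \<longrightarrow> Z = 0)"

definition finite_operator ::
    "('h::complex_hilbert_space \<Rightarrow>\<^sub>L 'h) set \<Rightarrow> ('h \<Rightarrow>\<^sub>L 'h) \<Rightarrow> bool" where
  "finite_operator \<A> S \<longleftrightarrow>
     S \<in> \<A> \<and> finite_projection \<A> (proj_onto (closure (range (blinfun_apply S))))"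

section \<open>Fredholm and B-Fredholm operators relative to an algebra\<close>

definition corner ::
    "('h::complex_hilbert_space \<Rightarrow>\<^sub>L 'h) set \<Rightarrow> ('h \<Rightarrow>\<^sub>L 'h) \<Rightarrow> ('h \<Rightarrow>\<^sub>L 'h) set" where
  "corner \<A> R = (\<lambda>A. R o\<^sub>L A o\<^sub>L R) ` \<A>"

definition invertible_up_to ::
    "('h::complex_hilbert_space \<Rightarrow>\<^sub>L 'h) set \<Rightarrow> ('h \<Rightarrow>\<^sub>L 'h) \<Rightarrow>
     ('h \<Rightarrow>\<^sub>L 'h) \<Rightarrow> ('h \<Rightarrow>\<^sub>L 'h) \<Rightarrow> ('h \<Rightarrow>\<^sub>L 'h) \<Rightarrow> bool" where
  "invertible_up_to \<A> R p q a \<longleftrightarrow>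
     (\<exists>b \<in> corner \<A> R.
        b = (R - p) o\<^sub>L b o\<^sub>L (R - q) \<and>
        (R - q) o\<^sub>L a o\<^sub>L (R - p) o\<^sub>L b = R - q \<and>
        b o\<^sub>L (R - q) o\<^sub>L a o\<^sub>L (R - p) = R - p)"

definition fredholm_ops ::
    "('h::complex_hilbert_space \<Rightarrow>\<^sub>L 'h) set \<Rightarrow> ('h \<Rightarrow>\<^sub>L 'h) \<Rightarrow> ('h \<Rightarrow>\<^sub>L 'h) set" where
  "fredholm_ops \<A> R = {a \<in> corner \<A> R.
     \<exists>p \<in> corner \<A> R. \<exists>q \<in> corner \<A> R.
       finite_projection \<A> p \<and> finite_projection \<A> q \<and> invertible_up_to \<A> R p q a}"

definition im_pow :: "('h::complex_hilbert_space \<Rightarrow>\<^sub>L 'h) \<Rightarrow> nat \<Rightarrow> 'h set" where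
  "im_pow T n = range (blinfun_apply T ^^ n)"

definition b_fredholm_at ::
    "('h::complex_hilbert_space \<Rightarrow>\<^sub>L 'h) set \<Rightarrow> ('h \<Rightarrow>\<^sub>L 'h) \<Rightarrow> nat \<Rightarrow> bool" where
  "b_fredholm_at \<A> T n \<longleftrightarrow>
     (\<forall>k\<ge>n. closed (im_pow T k)) \<and>
     \<not> finite_projection \<A> (proj_onto (im_pow T n)) \<and>
     T o\<^sub>L proj_onto (im_pow T n) \<in> fredholm_ops \<A> (proj_onto (im_pow T n))"

definition b_fredholm ::
    "('h::complex_hilbert_space \<Rightarrow>\<^sub>L 'h) set \<Rightarrow> ('h \<Rightarrow>\<^sub>L 'h) \<Rightarrow> bool" where
  "b_fredholm \<A> T \<longleftrightarrow> T \<in> \<A> \<and> (\<exists>n. b_fredholm_at \<A> T n)"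

section \<open>The Grothendieck group of a commutative monoid\<close>

definition groth_rel :: "('a, 'm) monoid_scheme \<Rightarrow> (('a \<times> 'a) \<times> ('a \<times> 'a)) set" where
  "groth_rel M = {((a, b), (c, d)).
     a \<in> carrier M \<and> b \<in> carrier M \<and> c \<in> carrier M \<and> d \<in> carrier M \<and>
     (\<exists>k \<in> carrier M. a \<otimes>\<^bsub>M\<^esub> d \<otimes>\<^bsub>M\<^esub> k = c \<otimes>\<^bsub>M\<^esub> b \<otimes>\<^bsub>M\<^esub> k)}"

definition groth_group :: "('a, 'm) monoid_scheme \<Rightarrow> ('a \<times> 'a) set monoid" where
  "groth_group M =
     \<lparr>carrier = (carrier M \<times> carrier M) // groth_rel M,
      mult = (\<lambda>X Y. \<Union>(a, b)\<in>X. \<Union>(c, d)\<in>Y.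
        groth_rel M `` {(a \<otimes>\<^bsub>M\<^esub> c, b \<otimes>\<^bsub>M\<^esub> d)}),
      one = groth_rel M `` {(\<one>\<^bsub>M\<^esub>, \<one>\<^bsub>M\<^esub>)}\<rparr>"

definition groth_of :: "('a, 'm) monoid_scheme \<Rightarrow> 'a \<Rightarrow> ('a \<times> 'a) set" where
  "groth_of M a = groth_rel M `` {(a, \<one>\<^bsub>M\<^esub>)}"

context comm_monoid
begin

lemma equiv_groth_rel: "equiv (carrier G \<times> carrier G) (groth_rel G)"
proof (rule equivI)
  show "groth_rel G \<subseteq> (carrier G \<times> carrier G) \<times> (carrier G \<times> carrier G)"
    by (auto simp: groth_rel_def)
  show "refl_on (carrier G \<times> carrier G) (groth_rel G)"
    by (auto simp: groth_rel_def refl_on_def)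
  show "sym (groth_rel G)"
    by (auto simp: groth_rel_def sym_def) metis
  show "trans (groth_rel G)"
  proof (rule transI)
    fix x y z assume xy: "(x, y) \<in> groth_rel G" and yz: "(y, z) \<in> groth_rel G"
    obtain a b c d e f where eqs: "x = (a, b)" "y = (c, d)" "z = (e, f)"
      by (metis prod.exhaust)
    from xy yz obtain k l where
      c: "a \<in> carrier G" "b \<in> carrier G" "c \<in> carrier G" "d \<in> carrier G"
         "e \<in> carrier G" "f \<in> carrier G" "k \<in> carrier G" "l \<in> carrier G"
      and k: "a \<otimes> d \<otimes> k = c \<otimes> b \<otimes> k" and l: "c \<otimes> f \<otimes> l = e \<otimes> d \<otimes> l"
      unfolding eqs groth_rel_def by auto
    have "a \<otimes> f \<otimes> (c \<otimes> d \<otimes> k \<otimes> l) = (a \<otimes> d \<otimes> k) \<otimes> (c \<otimes> f \<otimes> l)"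
      using c by (simp add: m_ac)
    also have "\<dots> = (c \<otimes> b \<otimes> k) \<otimes> (e \<otimes> d \<otimes> l)"
      using k l by simp
    also have "\<dots> = e \<otimes> b \<otimes> (c \<otimes> d \<otimes> k \<otimes> l)"
      using c by (simp add: m_ac)
    finally have "\<exists>j\<in>carrier G. a \<otimes> f \<otimes> j = e \<otimes> b \<otimes> j"
      using c by (intro bexI[of _ "c \<otimes> d \<otimes> k \<otimes> l"]) auto
    then show "(x, z) \<in> groth_rel G"
      using c by (auto simp: eqs groth_rel_def)
  qed
qed

lemma groth_rel_cong:
  assumes "((a, b), (a', b')) \<in> groth_rel G" "((c, d), (c', d')) \<in> groth_rel G"
  shows "((a \<otimes> c, b \<otimes> d), (a' \<otimes> c', b' \<otimes> d')) \<in> groth_rel G"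
proof -
  from assms obtain k l where
    c: "a \<in> carrier G" "b \<in> carrier G" "c \<in> carrier G" "d \<in> carrier G"
       "a' \<in> carrier G" "b' \<in> carrier G" "c' \<in> carrier G" "d' \<in> carrier G"
       "k \<in> carrier G" "l \<in> carrier G"
    and k: "a \<otimes> b' \<otimes> k = a' \<otimes> b \<otimes> k" and l: "c \<otimes> d' \<otimes> l = c' \<otimes> d \<otimes> l"
    unfolding groth_rel_def by auto
  have "(a \<otimes> c) \<otimes> (b' \<otimes> d') \<otimes> (k \<otimes> l) = (a \<otimes> b' \<otimes> k) \<otimes> (c \<otimes> d' \<otimes> l)"
    using c by (simp add: m_ac)
  also have "\<dots> = (a' \<otimes> b \<otimes> k) \<otimes> (c' \<otimes> d \<otimes> l)"
    using k l by simp
  also have "\<dots> = (a' \<otimes> c') \<otimes> (b \<otimes> d) \<otimes> (k \<otimes> l)"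
    using c by (simp add: m_ac)
  finally have "\<exists>j\<in>carrier G. (a \<otimes> c) \<otimes> (b' \<otimes> d') \<otimes> j = (a' \<otimes> c') \<otimes> (b \<otimes> d) \<otimes> j"
    using c by (intro bexI[of _ "k \<otimes> l"]) auto
  then show ?thesis
    using c by (auto simp: groth_rel_def)
qed

lemma groth_mult:
  assumes "a \<in> carrier G" "b \<in> carrier G" "c \<in> carrier G" "d \<in> carrier G"
  shows "groth_rel G `` {(a, b)} \<otimes>\<^bsub>groth_group G\<^esub> groth_rel G `` {(c, d)}
           = groth_rel G `` {(a \<otimes> c, b \<otimes> d)}"
proof -
  let ?X = "groth_rel G `` {(a, b)}" and ?Y = "groth_rel G `` {(c, d)}"
  let ?f = "\<lambda>x y. groth_rel G `` {(fst x \<otimes> fst y, snd x \<otimes> snd y)}"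
  have const: "?f x y = groth_rel G `` {(a \<otimes> c, b \<otimes> d)}" if "x \<in> ?X" "y \<in> ?Y" for x y
  proof -
    have "((a, b), (fst x, snd x)) \<in> groth_rel G" "((c, d), (fst y, snd y)) \<in> groth_rel G"
      using that by auto
    then show ?thesis
      using equiv_class_eq[OF equiv_groth_rel groth_rel_cong] by metis
  qed
  have "(a, b) \<in> ?X"
    by (rule equiv_class_self[OF equiv_groth_rel]) (use assms in simp)
  moreover have "(c, d) \<in> ?Y"
    by (rule equiv_class_self[OF equiv_groth_rel]) (use assms in simp)
  ultimately have "(\<Union>x\<in>?X. \<Union>y\<in>?Y. ?f x y) = groth_rel G `` {(a \<otimes> c, b \<otimes> d)}"
    using const by (intro UN_constant_eq) auto
  then show ?thesis
    by (simp add: groth_group_def case_prod_unfold)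
qed

lemma comm_group_groth_group: "comm_group (groth_group G)"
proof -
  have car: "X \<in> carrier (groth_group G) \<longleftrightarrow>
      (\<exists>a\<in>carrier G. \<exists>b\<in>carrier G. X = groth_rel G `` {(a, b)})" for X
    by (auto simp: groth_group_def quotient_def)
  have one: "\<one>\<^bsub>groth_group G\<^esub> = groth_rel G `` {(\<one>, \<one>)}"
    by (simp add: groth_group_def)
  have inv: "groth_rel G `` {(b \<otimes> a, a \<otimes> b)} = groth_rel G `` {(\<one>, \<one>)}"
    if "a \<in> carrier G" "b \<in> carrier G" for a b
    using that
    by (intro equiv_class_eq[OF equiv_groth_rel]) (auto simp: groth_rel_def m_comm intro!: bexI[of _ \<one>])
  show ?thesis
  proof (rule comm_groupI)
    fix X assume "X \<in> carrier (groth_group G)"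
    then obtain a b where ab: "a \<in> carrier G" "b \<in> carrier G" "X = groth_rel G `` {(a, b)}"
      unfolding car by blast
    then show "\<exists>Y\<in>carrier (groth_group G). Y \<otimes>\<^bsub>groth_group G\<^esub> X = \<one>\<^bsub>groth_group G\<^esub>"
      by (intro bexI[of _ "groth_rel G `` {(b, a)}"]) (auto simp: car groth_mult one inv)
  qed (auto simp: car one groth_mult m_ac intro!: bexI)
qed

end

section \<open>The index\<close>

definition mvn_class ::
    "('h::complex_hilbert_space \<Rightarrow>\<^sub>L 'h) set \<Rightarrow> ('h \<Rightarrow>\<^sub>L 'h) \<Rightarrow> ('h \<Rightarrow>\<^sub>L 'h) set" where
  "mvn_class \<A> P = {Q. finite_projection \<A> Q \<and> mvn_equiv \<A> P Q}"

text \<open>In the sum of two classes, all the classes \<open>[P + Q]\<close> in the union coincide; in a properly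
  infinite algebra at least one pair of orthogonal representatives exists.\<close>

definition class_monoid ::
    "('h::complex_hilbert_space \<Rightarrow>\<^sub>L 'h) set \<Rightarrow> ('h \<Rightarrow>\<^sub>L 'h) set monoid" where
  "class_monoid \<A> =
     \<lparr>carrier = mvn_class \<A> ` {P. finite_projection \<A> P},
      mult = (\<lambda>X Y. \<Union>{mvn_class \<A> (P + Q) | P Q. P \<in> X \<and> Q \<in> Y \<and> P o\<^sub>L Q = 0}),
      one = mvn_class \<A> 0\<rparr>"

definition index_group ::
    "('h::complex_hilbert_space \<Rightarrow>\<^sub>L 'h) set \<Rightarrow>
     (('h \<Rightarrow>\<^sub>L 'h) set \<times> ('h \<Rightarrow>\<^sub>L 'h) set) set monoid" where
  "index_group \<A> = groth_group (class_monoid \<A>)"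

definition index_class ::
    "('h::complex_hilbert_space \<Rightarrow>\<^sub>L 'h) set \<Rightarrow> ('h \<Rightarrow>\<^sub>L 'h) \<Rightarrow>
     (('h \<Rightarrow>\<^sub>L 'h) set \<times> ('h \<Rightarrow>\<^sub>L 'h) set) set" where
  "index_class \<A> P = groth_of (class_monoid \<A>) (mvn_class \<A> P)"

text \<open>The index in the corner of \<open>\<A>\<close> at \<open>R\<close>; the group is written multiplicatively.\<close>

definition fredholm_index ::
    "('h::complex_hilbert_space \<Rightarrow>\<^sub>L 'h) set \<Rightarrow> ('h \<Rightarrow>\<^sub>L 'h) \<Rightarrow> ('h \<Rightarrow>\<^sub>L 'h) \<Rightarrow>
     (('h \<Rightarrow>\<^sub>L 'h) set \<times> ('h \<Rightarrow>\<^sub>L 'h) set) set" where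
  "fredholm_index \<A> R a =
     index_class \<A> (proj_onto ({x. blinfun_apply a x = 0} \<inter> range (blinfun_apply R)))
     \<otimes>\<^bsub>index_group \<A>\<^esub>
     inv\<^bsub>index_group \<A>\<^esub>
       index_class \<A> (R - proj_onto (closure (range (blinfun_apply a))))"

definition b_fredholm_index ::
    "('h::complex_hilbert_space \<Rightarrow>\<^sub>L 'h) set \<Rightarrow> ('h \<Rightarrow>\<^sub>L 'h) \<Rightarrow>
     (('h \<Rightarrow>\<^sub>L 'h) set \<times> ('h \<Rightarrow>\<^sub>L 'h) set) set" where
  "b_fredholm_index \<A> T =
     (let n = (LEAST n. (\<forall>k\<ge>n. closed (im_pow T k)) \<and>
                 T o\<^sub>L proj_onto (im_pow T n) \<in> fredholm_ops \<A> (proj_onto (im_pow T n)));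
          R = proj_onto (im_pow T n)
      in fredholm_index \<A> R (T o\<^sub>L R))"

end

theory Submission
  imports Defs
begin

text \<open>Projections are replaced by their ranges. Put \<open>T' = T + F\<close>, and let \<open>R\<close>, \<open>R'\<close> be the ranges of
  \<open>T\<^sup>m\<close>, \<open>T'\<^sup>m\<close>. As \<open>T'\<^sup>m - T\<^sup>m\<close> is a finite operator, \<open>X = R \<inter> R' \<inter> ker F\<close> has finite
  codimension in the join \<open>U\<close> of \<open>R\<close> and \<open>R'\<close>, and \<open>T\<close> and \<open>T'\<close> agree on \<open>X\<close>. Since \<open>T R\<close> is
  closed, the parallelogram law gives
  \<open>index (T on R) = [X \<inter> ker T] + [U - X] - [U - closure (T X)]\<close>, and the same formula holds for
  \<open>T'\<close> on \<open>R'\<close>. The choice \<open>R = U\<close>, \<open>X = R' = T R\<close> shows that the index does not change from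
  \<open>T\<^sup>n\<close> to \<open>T\<^sup>n\<^sup>+\<^sup>1\<close>. Finiteness of the sum of two finite projections comes from the comparison
  theorem; together with proper infiniteness it also yields orthogonal copies of finite projections,
  which are needed to add their classes.\<close>

section \<open>Closed subspaces of a real Hilbert space\<close>

text \<open>\<open>T\<close> need not map the range of \<open>T + F\<close> into itself, nor
  conversely, and in general neither range contains the other. The comparison therefore passes
  through a smaller space \<open>X\<close> and a larger space \<open>U\<close>, and the index
  formula has to make sense for an \<open>X\<close> that is not invariant and whose image is not
  closed. Finite subspaces have no numerical dimension; the available rules are invariance under
  equivalence and additivity over orthogonal sums, and the index identities are computed in an
  arbitrary commutative group obeying these two rules. Closedness of the range of the power
  \<open>m + 1\<close> says that the restriction of \<open>T\<close> to \<open>R\<close> has closed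
  range; for such a restriction, invertibility up to finite projections amounts to a finite kernel
  and a finite cokernel. The exponent that defines the index is a minimum over conditions that do
  not mention finiteness of the range. It may thus be smaller than \<open>m\<close>, and differ for
  \<open>T\<close> and \<open>T + F\<close>; independence of the index from the exponent reconciles
  these choices.\<close>

lemma orthogonal_comp_iff: "x \<in> W\<^sup>\<bottom> \<longleftrightarrow> (\<forall>y\<in>W. inner x y = 0)"
  unfolding orthogonal_comp_def orthogonal_def mem_Collect_eq
  by (subst inner_commute) (rule refl)

lemma orthogonal_compI: "(\<And>y. y \<in> W \<Longrightarrow> inner x y = 0) \<Longrightarrow> x \<in> W\<^sup>\<bottom>"
  by (simp add: orthogonal_comp_iff)

lemma orthogonal_compD: "x \<in> W\<^sup>\<bottom> \<Longrightarrow> y \<in> W \<Longrightarrow> inner x y = 0"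
  by (simp add: orthogonal_comp_iff)

lemma orthogonal_compD': "x \<in> W\<^sup>\<bottom> \<Longrightarrow> y \<in> W \<Longrightarrow> inner y x = 0"
  using orthogonal_compD[of x W y] by (simp add: inner_commute)

lemma orthogonal_comp_swap: "A \<subseteq> B\<^sup>\<bottom> \<Longrightarrow> B \<subseteq> A\<^sup>\<bottom>"
  by (intro subsetI orthogonal_compI) (rule orthogonal_compD', auto)

lemma closed_orthogonal_comp: "closed (W\<^sup>\<bottom>)"
proof -
  have "W\<^sup>\<bottom> = (\<Inter>y\<in>W. {x. inner x y = 0})"
    by (auto simp: orthogonal_comp_iff)
  then show ?thesis
    by (auto intro!: closed_INT closed_Collect_eq continuous_intros)
qed

lemma subspace_closure:
  fixes S :: "'a::real_normed_vector set"
  assumes "subspace S"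
  shows "subspace (closure S)"
  unfolding subspace_def
proof (intro conjI ballI allI)
  show "0 \<in> closure S"
    using assms closure_subset subspace_0 by blast
  show "x + y \<in> closure S" if "x \<in> closure S" "y \<in> closure S" for x y
  proof -
    from that obtain a b where "\<forall>n. a n \<in> S" "a \<longlonglongrightarrow> x" "\<forall>n. b n \<in> S" "b \<longlonglongrightarrow> y"
      unfolding closure_sequential by fast
    then show ?thesis
      unfolding closure_sequential using assms
      by (intro exI[of _ "\<lambda>n. a n + b n"]) (auto intro: tendsto_add subspace_add)
  qed
  show "c *\<^sub>R x \<in> closure S" if "x \<in> closure S" for c x
  proof -
    from that obtain a where "\<forall>n. a n \<in> S" "a \<longlonglongrightarrow> x"
      unfolding closure_sequential by fast
    then show ?thesis
      unfolding closure_sequential using assms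
      by (intro exI[of _ "\<lambda>n. c *\<^sub>R a n"]) (auto intro: tendsto_scaleR subspace_scale)
  qed
qed

lemma parallelogram_law:
  fixes u v :: "'a::real_inner"
  shows "(norm (u + v))\<^sup>2 + (norm (u - v))\<^sup>2 = 2 * (norm u)\<^sup>2 + 2 * (norm v)\<^sup>2"
  unfolding power2_norm_eq_inner
  by (simp add: inner_add_left inner_add_right inner_diff_left inner_diff_right)

text \<open>A minimising sequence is Cauchy by the parallelogram law, because midpoints of its
  members stay in \<open>L\<close> and cannot come closer to \<open>x\<close> than the infimum
  \<open>d\<close>.\<close>

lemma closest_point_in_closed_subspace:
  fixes L :: "'a::{real_inner,banach} set"
  assumes L: "closed L" "subspace L"
  obtains y where "y \<in> L" "\<And>z. z \<in> L \<Longrightarrow> norm (x - y) \<le> norm (x - z)"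
proof -
  have ne: "L \<noteq> {}"
    using L subspace_0 by blast
  define d where "d = infdist x L"
  have d0: "d \<ge> 0"
    by (simp add: d_def infdist_nonneg)
  have dle: "d \<le> norm (x - z)" if "z \<in> L" for z
    using infdist_le[OF that, of x] by (simp add: d_def dist_norm)
  have "\<exists>y\<in>L. norm (x - y) < d + 1 / real (Suc n)" for n
  proof -
    have "d < d + 1 / real (Suc n)" by simp
    then show ?thesis
      unfolding d_def infdist_notempty[OF ne]
      by (subst (asm) cINF_less_iff)
        (use ne in \<open>auto simp: dist_norm intro!: bdd_belowI[of _ 0]\<close>)
  qed
  then obtain y where y: "\<And>n. y n \<in> L" "\<And>n. norm (x - y n) < d + 1 / real (Suc n)"
    by metis
  have lim: "(\<lambda>n. norm (x - y n)) \<longlonglongrightarrow> d"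
  proof (rule tendsto_sandwich)
    show "(\<lambda>n. d) \<longlonglongrightarrow> d" by simp
    have "(\<lambda>n. d + 1 / real (Suc n)) \<longlonglongrightarrow> d + 0"
      by (intro tendsto_intros LIMSEQ_Suc[OF lim_1_over_n])
    then show "(\<lambda>n. d + 1 / real (Suc n)) \<longlonglongrightarrow> d" by simp
    show "eventually (\<lambda>n. d \<le> norm (x - y n)) sequentially"
      using y dle by simp
    show "eventually (\<lambda>n. norm (x - y n) \<le> d + 1 / real (Suc n)) sequentially"
      using y by (intro always_eventually allI less_imp_le)
  qed
  have par: "(norm (y m - y n))\<^sup>2 \<le> 2 * (norm (x - y m))\<^sup>2 + 2 * (norm (x - y n))\<^sup>2 - 4 * d\<^sup>2" for m n
  proof -
    have "(1/2) *\<^sub>R (y m + y n) \<in> L"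
      using L y by (intro subspace_scale subspace_add) auto
    then have "d \<le> norm (x - (1/2) *\<^sub>R (y m + y n))"
      by (rule dle)
    then have "2 * d \<le> norm (2 *\<^sub>R (x - (1/2) *\<^sub>R (y m + y n)))"
      by (simp only: norm_scaleR abs_numeral mult_left_mono)
    also have "2 *\<^sub>R (x - (1/2) *\<^sub>R (y m + y n)) = (x - y m) + (x - y n)"
      by (simp add: algebra_simps scaleR_2)
    finally have "(2 * d)\<^sup>2 \<le> (norm ((x - y m) + (x - y n)))\<^sup>2"
      using d0 by (intro power_mono) auto
    then show ?thesis
      using parallelogram_law[of "x - y m" "x - y n"]
      by (simp add: power_mult_distrib norm_minus_commute)
  qed
  have "Cauchy y"
  proof (rule CauchyI)
    fix e :: real assume e: "e > 0"
    have "(\<lambda>n. (norm (x - y n))\<^sup>2) \<longlonglongrightarrow> d\<^sup>2"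
      using lim by (intro tendsto_intros)
    then have "eventually (\<lambda>n. (norm (x - y n))\<^sup>2 < d\<^sup>2 + e\<^sup>2 / 4) sequentially"
      by (rule order_tendstoD) (use e in auto)
    then obtain M where M: "\<And>n. n \<ge> M \<Longrightarrow> (norm (x - y n))\<^sup>2 < d\<^sup>2 + e\<^sup>2 / 4"
      by (auto simp: eventually_sequentially)
    show "\<exists>M. \<forall>m\<ge>M. \<forall>n\<ge>M. norm (y m - y n) < e"
    proof (intro exI allI impI)
      fix m n assume "m \<ge> M" "n \<ge> M"
      then have "(norm (y m - y n))\<^sup>2 < e\<^sup>2"
        using par[of m n] M[of m] M[of n] by simp
      then show "norm (y m - y n) < e"
        using e by (simp add: power2_less_imp_less)
    qed
  qed
  then obtain l where l: "y \<longlonglongrightarrow> l"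
    using Cauchy_convergent_iff convergent_def by blast
  have "l \<in> L"
    using L(1) y(1) l closed_sequentially by blast
  moreover have "norm (x - l) = d"
    using lim l by (intro LIMSEQ_unique[OF _ lim]) (auto intro!: tendsto_intros)
  ultimately show ?thesis
    using dle that by blast
qed

text \<open>The closest point works, since moving it along any \<open>z\<close> in \<open>L\<close>
  cannot shorten the distance to \<open>x\<close>.\<close>

lemma orthogonal_decomposition_exists:
  fixes L :: "'a::{real_inner,banach} set"
  assumes L: "closed L" "subspace L"
  shows "\<exists>y. y \<in> L \<and> x - y \<in> L\<^sup>\<bottom>"
proof -
  obtain y where y: "y \<in> L" and min: "\<And>z. z \<in> L \<Longrightarrow> norm (x - y) \<le> norm (x - z)"
    using closest_point_in_closed_subspace[OF L] by metis
  have "inner (x - y) z = 0" if z: "z \<in> L" for z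
  proof (cases "z = 0")
    case False
    \<comment> \<open>This \<open>t\<close> minimises the norm of
      \<open>(x - y) - t *\<^sub>R z\<close>.\<close>
    define t where "t = inner (x - y) z / inner z z"
    have "y + t *\<^sub>R z \<in> L"
      using L y z by (intro subspace_add subspace_scale) auto
    then have "norm (x - y) \<le> norm ((x - y) - t *\<^sub>R z)"
      using min by (simp add: algebra_simps)
    then have "(norm (x - y))\<^sup>2 \<le> (norm ((x - y) - t *\<^sub>R z))\<^sup>2"
      by (rule power_mono) simp
    also have "\<dots> = (norm (x - y))\<^sup>2 - 2 * t * inner (x - y) z + t\<^sup>2 * inner z z"
      unfolding power2_norm_eq_inner
      by (simp add: inner_diff_left inner_diff_right inner_commute algebra_simps power2_eq_square)
    also have "\<dots> = (norm (x - y))\<^sup>2 - (inner (x - y) z)\<^sup>2 / inner z z"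
      using False by (simp add: t_def power2_eq_square divide_simps)
    finally have "(inner (x - y) z)\<^sup>2 / inner z z \<le> 0" by simp
    moreover have "inner z z > 0" using False by simp
    ultimately show ?thesis
      by (simp add: divide_le_0_iff)
  qed simp
  with y show ?thesis
    by (auto simp: orthogonal_comp_iff)
qed

lemma orthogonal_decomposition_unique:
  assumes "subspace L" "y \<in> L" "x - y \<in> L\<^sup>\<bottom>" "z \<in> L" "x - z \<in> L\<^sup>\<bottom>"
  shows "y = z"
proof -
  have "y - z \<in> L"
    using assms by (simp add: subspace_diff)
  moreover have "y - z \<in> L\<^sup>\<bottom>"
    using subspace_diff[OF subspace_orthogonal_comp assms(5,3)] by simp
  ultimately have "inner (y - z) (y - z) = 0"
    by (rule orthogonal_compD[rotated])
  then show ?thesis by simp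
qed

lemma norm_le_if_orthogonal_decomposition:
  assumes "y \<in> L" "x - y \<in> L\<^sup>\<bottom>"
  shows "norm y \<le> norm x"
proof -
  have "inner (x - y) y = 0"
    by (rule orthogonal_compD[OF assms(2,1)])
  then have "inner x y = (norm y)\<^sup>2"
    by (simp add: inner_diff_left power2_norm_eq_inner)
  then have "norm y * norm y \<le> norm x * norm y"
    using norm_cauchy_schwarz[of x y] by (simp add: power2_eq_square)
  then show ?thesis
    by (cases "y = 0") auto
qed

text \<open>\<open>oproj L\<close> is the orthogonal projection onto \<open>L\<close>, meaningful for closed real
  subspaces \<open>L\<close>; unlike \<^const>\<open>proj_onto\<close> it makes sense in a real Hilbert space.\<close>

definition oproj :: "'a::{real_inner,banach} set \<Rightarrow> ('a \<Rightarrow>\<^sub>L 'a)" where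
  "oproj L = Blinfun (\<lambda>x. SOME y. y \<in> L \<and> x - y \<in> L\<^sup>\<bottom>)"

context
  fixes L :: "'a::{real_inner,banach} set"
  assumes L: "closed L" "subspace L"
begin

private lemma some_eq:
  assumes "y \<in> L" "x - y \<in> L\<^sup>\<bottom>"
  shows "(SOME y. y \<in> L \<and> x - y \<in> L\<^sup>\<bottom>) = y"
  using assms orthogonal_decomposition_unique[OF L(2)] by (intro some_equality) blast+

lemma oproj_apply: "blinfun_apply (oproj L) = (\<lambda>x. SOME y. y \<in> L \<and> x - y \<in> L\<^sup>\<bottom>)"
  unfolding oproj_def
proof (rule bounded_linear_Blinfun_apply, rule bounded_linear_intro[where K = 1])
  let ?p = "\<lambda>x. SOME y. y \<in> L \<and> x - y \<in> L\<^sup>\<bottom>"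
  have p: "?p x \<in> L \<and> x - ?p x \<in> L\<^sup>\<bottom>" for x
    by (rule someI_ex) (rule orthogonal_decomposition_exists[OF L])
  show "?p (x + y) = ?p x + ?p y" for x y
  proof (rule some_eq)
    show "?p x + ?p y \<in> L"
      using p L(2) by (simp add: subspace_add)
    show "x + y - (?p x + ?p y) \<in> L\<^sup>\<bottom>"
      using subspace_add[OF subspace_orthogonal_comp, of "x - ?p x" L "y - ?p y"] p
      by (simp add: algebra_simps)
  qed
  show "?p (r *\<^sub>R x) = r *\<^sub>R ?p x" for r x
  proof (rule some_eq)
    show "r *\<^sub>R ?p x \<in> L"
      using p L(2) by (simp add: subspace_scale)
    show "r *\<^sub>R x - r *\<^sub>R ?p x \<in> L\<^sup>\<bottom>"
      using subspace_scale[OF subspace_orthogonal_comp, of "x - ?p x" L r] p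
      by (simp add: algebra_simps)
  qed
  show "norm (?p x) \<le> norm x * 1" for x
    using p[of x] norm_le_if_orthogonal_decomposition by auto
qed

lemma oproj_in: "oproj L x \<in> L"
  and oproj_diff_in: "x - oproj L x \<in> L\<^sup>\<bottom>"
  using someI_ex[OF orthogonal_decomposition_exists[OF L, of x]] by (auto simp: oproj_apply)

lemma oproj_eqI: "y \<in> L \<Longrightarrow> x - y \<in> L\<^sup>\<bottom> \<Longrightarrow> oproj L x = y"
  by (simp add: oproj_apply some_eq)

lemma oproj_ident: "x \<in> L \<Longrightarrow> oproj L x = x"
  by (rule oproj_eqI) (auto simp: orthogonal_comp_iff)

lemma oproj_zero: "x \<in> L\<^sup>\<bottom> \<Longrightarrow> oproj L x = 0"
  by (rule oproj_eqI) (simp_all add: L subspace_0)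

lemma oproj_zero_iff: "oproj L x = 0 \<longleftrightarrow> x \<in> L\<^sup>\<bottom>"
proof
  assume "oproj L x = 0"
  then show "x \<in> L\<^sup>\<bottom>"
    using oproj_diff_in[of x] by simp
qed (rule oproj_zero)

lemma range_oproj: "range (oproj L) = L"
proof
  show "range (oproj L) \<subseteq> L"
    using oproj_in by auto
  show "L \<subseteq> range (oproj L)"
    using oproj_ident rangeI[of "blinfun_apply (oproj L)"] by (metis subsetI)
qed

lemma oproj_selfadjoint: "inner (oproj L x) y = inner x (oproj L y)"
proof -
  have "inner (oproj L x) (y - oproj L y) = 0" "inner (x - oproj L x) (oproj L y) = 0"
    by (rule orthogonal_compD'[OF oproj_diff_in oproj_in] orthogonal_compD[OF oproj_diff_in oproj_in])+
  then show ?thesis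
    by (simp add: inner_diff_left inner_diff_right)
qed

lemma norm_oproj_le: "norm (oproj L x) \<le> norm x"
  by (rule norm_le_if_orthogonal_decomposition[OF oproj_in oproj_diff_in])

lemma orthogonal_comp_comp: "L\<^sup>\<bottom>\<^sup>\<bottom> = L"
proof
  show "L\<^sup>\<bottom>\<^sup>\<bottom> \<subseteq> L"
  proof
    fix x assume "x \<in> L\<^sup>\<bottom>\<^sup>\<bottom>"
    moreover have "oproj L x \<in> L\<^sup>\<bottom>\<^sup>\<bottom>"
      using orthogonal_comp_subset oproj_in by blast
    ultimately have "x - oproj L x \<in> L\<^sup>\<bottom>\<^sup>\<bottom>"
      by (rule subspace_diff[OF subspace_orthogonal_comp])
    then have "inner (x - oproj L x) (x - oproj L x) = 0"
      using oproj_diff_in by (rule orthogonal_compD)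
    then show "x \<in> L"
      using oproj_in[of x] by simp
  qed
qed (rule orthogonal_comp_subset)

end

lemma oproj_orthogonal_comp:
  fixes L :: "'a::{real_inner,banach} set"
  assumes L: "closed L" "subspace L"
  shows "oproj (L\<^sup>\<bottom>) x = x - oproj L x"
proof (rule oproj_eqI[OF closed_orthogonal_comp subspace_orthogonal_comp oproj_diff_in[OF L]])
  show "x - (x - oproj L x) \<in> L\<^sup>\<bottom>\<^sup>\<bottom>"
    using oproj_in[OF L, of x] by (simp add: orthogonal_comp_comp[OF L])
qed

text \<open>Reduces later equalities of closed subspaces to density statements: subtracting from a
  vector of \<open>M\<close> its projection onto \<open>L\<close> leaves a vector that must
  vanish.\<close>

lemma closed_subspace_eqI:
  fixes L :: "'a::{real_inner,banach} set"
  assumes "closed L" "subspace L" "subspace M" "L \<subseteq> M" "\<And>x. x \<in> M \<Longrightarrow> x \<in> L\<^sup>\<bottom> \<Longrightarrow> x = 0"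
  shows "L = M"
proof
  show "M \<subseteq> L"
  proof
    fix x assume "x \<in> M"
    then have "x - oproj L x \<in> M"
      using assms oproj_in[OF assms(1,2)] by (intro subspace_diff) auto
    then have "x - oproj L x = 0"
      using oproj_diff_in[OF assms(1,2)] by (intro assms(5))
    then show "x \<in> L"
      using oproj_in[OF assms(1,2), of x] by simp
  qed
qed (rule assms)

lemma orthogonal_comp_closure: "(closure S)\<^sup>\<bottom> = S\<^sup>\<bottom>"
proof
  show "(closure S)\<^sup>\<bottom> \<subseteq> S\<^sup>\<bottom>"
    by (intro orthogonal_comp_anti_mono closure_subset)
  show "S\<^sup>\<bottom> \<subseteq> (closure S)\<^sup>\<bottom>"
  proof
    fix x assume x: "x \<in> S\<^sup>\<bottom>"
    have "closure S \<subseteq> {y. inner x y = 0}"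
      by (rule closure_minimal)
        (use x in \<open>auto simp: orthogonal_comp_iff intro!: closed_Collect_eq continuous_intros\<close>)
    then show "x \<in> (closure S)\<^sup>\<bottom>"
      by (auto simp: orthogonal_comp_iff)
  qed
qed

text \<open>Invariance under the adjoint \<open>D\<close> makes \<open>C\<close> preserve the
  complement of \<open>L\<close> as well, so \<open>C\<close> respects the orthogonal decomposition
  of \<open>x\<close>.\<close>

lemma oproj_commute:
  fixes C D :: "'a::{real_inner,banach} \<Rightarrow>\<^sub>L 'a"
  assumes L: "closed L" "subspace L"
    and adj: "\<And>x y. inner (C x) y = inner x (D y)"
    and inv: "\<And>x. x \<in> L \<Longrightarrow> C x \<in> L" "\<And>x. x \<in> L \<Longrightarrow> D x \<in> L"
  shows "C (oproj L x) = oproj L (C x)"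
proof (rule sym, rule oproj_eqI[OF L])
  show "C (oproj L x) \<in> L"
    using inv oproj_in[OF L] by blast
  show "C x - C (oproj L x) \<in> L\<^sup>\<bottom>"
  proof (rule orthogonal_compI)
    fix y assume "y \<in> L"
    then have "inner (x - oproj L x) (D y) = 0"
      using inv by (intro orthogonal_compD[OF oproj_diff_in[OF L]])
    then show "inner (C x - C (oproj L x)) y = 0"
      by (simp add: adj inner_diff_left)
  qed
qed

section \<open>Riesz representation and adjoints\<close>

lemma riesz_representation:
  fixes f :: "'a::{real_inner,banach} \<Rightarrow> real"
  assumes f: "bounded_linear f"
  shows "\<exists>z. \<forall>x. f x = inner x z"
proof (cases "\<forall>x. f x = 0")
  case True
  then show ?thesis by (intro exI[of _ 0]) simp
next
  case False
  then obtain w where w: "f w \<noteq> 0" by blast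
  interpret f: bounded_linear f by (rule f)
  define K where "K = {x. f x = 0}"
  have K: "closed K" "subspace K"
    unfolding K_def subspace_def
    by (auto intro!: closed_Collect_eq continuous_intros f.continuous_on simp: f.add f.scaleR)
  \<comment> \<open>The complement of the kernel of a nonzero functional is a line; \<open>u\<close>
    spans it, and subtracting a suitable multiple of \<open>u\<close> moves any \<open>x\<close>
    into \<open>K\<close>.\<close>
  define u where "u = w - oproj K w"
  have u: "u \<in> K\<^sup>\<bottom>"
    unfolding u_def by (rule oproj_diff_in[OF K])
  have "f (oproj K w) = 0"
    using oproj_in[OF K, of w] unfolding K_def by simp
  then have "f u = f w"
    by (simp add: u_def f.diff)
  then have fu: "f u \<noteq> 0" "u \<noteq> 0"
    using w by (auto simp: f.zero)
  have "f x = inner x ((f u / inner u u) *\<^sub>R u)" for x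
  proof -
    have "x - (f x / f u) *\<^sub>R u \<in> K"
      using fu by (simp add: K_def f.diff f.scaleR)
    then have "inner (x - (f x / f u) *\<^sub>R u) u = 0"
      by (rule orthogonal_compD'[OF u])
    then show ?thesis
      using fu by (simp add: inner_diff_left field_simps)
  qed
  then show ?thesis by blast
qed

lemma inner_eq_all_iff: "(\<forall>x. inner x y = inner x z) \<longleftrightarrow> y = z"
proof
  assume "\<forall>x. inner x y = inner x z"
  then have "inner (y - z) (y - z) = 0"
    by (simp add: inner_diff_right)
  then show "y = z" by simp
qed simp

lemma adjoint_exists:
  fixes A :: "'a::{real_inner,banach} \<Rightarrow>\<^sub>L 'a"
  shows "\<exists>B :: 'a \<Rightarrow>\<^sub>L 'a. \<forall>x y. inner (A x) y = inner x (B y)"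
proof -
  have "\<exists>z. \<forall>x. inner (A x) y = inner x z" for y
    by (rule riesz_representation)
      (intro bounded_linear_inner_left_comp blinfun.bounded_linear_right)
  then obtain p where p: "\<And>x y. inner (A x) y = inner x (p y)"
    by metis
  have "bounded_linear p"
  proof (rule bounded_linear_intro[where K = "norm A"])
    have "inner u (p (x + y)) = inner u (p x + p y)" for u x y
      by (simp only: p[symmetric] inner_add_right)
    then show "p (x + y) = p x + p y" for x y
      using inner_eq_all_iff by blast
    have "inner u (p (r *\<^sub>R x)) = inner u (r *\<^sub>R p x)" for u r x
      by (simp only: p[symmetric] inner_scaleR_right)
    then show "p (r *\<^sub>R x) = r *\<^sub>R p x" for r x
      using inner_eq_all_iff by blast
    show "norm (p y) \<le> norm y * norm A" for y
    proof -
      \<comment> \<open>The defining identity of \<open>p\<close> is tested at \<open>p y\<close>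
        itself.\<close>
      have "norm (p y) * norm (p y) = inner (A (p y)) y"
        by (simp only: p power2_eq_square[symmetric] power2_norm_eq_inner)
      also have "\<dots> \<le> norm (A (p y)) * norm y"
        by (rule norm_cauchy_schwarz)
      also have "\<dots> \<le> (norm A * norm (p y)) * norm y"
        by (intro mult_right_mono norm_blinfun norm_ge_zero)
      finally show ?thesis
        by (cases "p y = 0") (auto simp: algebra_simps)
    qed
  qed
  then show ?thesis
    using p by (intro exI[of _ "Blinfun p"]) (simp add: bounded_linear_Blinfun_apply)
qed

text \<open>The adjoint is taken for the real inner product; \<open>adj_eq_if_is_adjoint\<close>
  shows that it agrees with the complex adjoint wherever that exists.\<close>

definition adj :: "('a::{real_inner,banach} \<Rightarrow>\<^sub>L 'a) \<Rightarrow> ('a \<Rightarrow>\<^sub>L 'a)" where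
  "adj A = (SOME B. \<forall>x y. inner (blinfun_apply A x) y = inner x (blinfun_apply B y))"

lemma inner_adj: "inner (blinfun_apply A x) y = inner x (adj A y)"
  using someI_ex[OF adjoint_exists[of A]] unfolding adj_def by blast

lemma inner_adj': "inner (adj A x) y = inner x (blinfun_apply A y)"
  by (metis inner_adj inner_commute)

lemma adj_eqI: "(\<And>x y. inner (blinfun_apply A x) y = inner x (blinfun_apply B y)) \<Longrightarrow> adj A = B"
proof (rule blinfun_eqI)
  fix y
  assume eq: "\<And>x y. inner (blinfun_apply A x) y = inner x (blinfun_apply B y)"
  have "\<forall>x. inner x (adj A y) = inner x (B y)"
    by (intro allI) (rule trans[OF inner_adj[symmetric] eq])
  then show "adj A y = B y"
    by (simp only: inner_eq_all_iff)
qed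

lemma adj_adj [simp]: "adj (adj A) = A"
  by (rule adj_eqI) (simp add: inner_adj')

lemma adj_compose: "adj (A o\<^sub>L B) = adj B o\<^sub>L adj A"
  by (rule adj_eqI) (simp add: inner_adj)

lemma adj_oproj: "closed L \<Longrightarrow> subspace L \<Longrightarrow> adj (oproj L) = oproj L"
  by (rule adj_eqI) (simp add: oproj_selfadjoint)

lemma inner_preserved_of_norm_preserved:
  fixes f :: "'a::real_inner \<Rightarrow> 'b::real_inner"
  assumes "norm a = norm a'" "norm b = norm b'" "norm (a + b) = norm (a' + b')"
  shows "inner a b = inner a' b'"
proof -
  have "(norm (a + b))\<^sup>2 = (norm a)\<^sup>2 + (norm b)\<^sup>2 + 2 * inner a b"
    "(norm (a' + b'))\<^sup>2 = (norm a')\<^sup>2 + (norm b')\<^sup>2 + 2 * inner a' b'"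
    by (simp_all add: power2_norm_eq_inner inner_add_left inner_add_right
        inner_commute[of b a] inner_commute[of b' a'])
  then show ?thesis
    using assms by simp
qed

lemma blinfun_compose_eq_iff:
  "A o\<^sub>L B = C o\<^sub>L D \<longleftrightarrow> (\<forall>x. blinfun_apply A (B x) = C (D x))"
proof
  assume "A o\<^sub>L B = C o\<^sub>L D"
  then have "blinfun_apply (A o\<^sub>L B) = blinfun_apply (C o\<^sub>L D)"
    by simp
  then show "\<forall>x. A (B x) = C (D x)"
    by (simp add: fun_eq_iff)
qed (simp add: blinfun_eqI)

text \<open>The bounds \<open>a n\<close> decrease to a limit, so the increments of \<open>f\<close>
  are dominated by a convergent telescoping sum. Serves both the gliding hump and the square root
  iteration.\<close>

lemma telescoping_limit_exists:
  fixes f :: "nat \<Rightarrow> 'a::banach" and a :: "nat \<Rightarrow> real"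
  assumes step: "\<And>n. norm (f (Suc n) - f n) \<le> a n - a (Suc n)" and a: "\<And>n. 0 \<le> a n"
  obtains l where "f \<longlonglongrightarrow> l" "\<And>n. norm (l - f n) \<le> a n"
proof -
  have tel: "norm (f (n + k) - f n) \<le> a n - a (n + k)" for n k
  proof (induction k)
    case (Suc k)
    have "norm (f (n + Suc k) - f n) \<le> norm (f (Suc (n + k)) - f (n + k)) + norm (f (n + k) - f n)"
      using norm_triangle_ineq[of "f (Suc (n + k)) - f (n + k)" "f (n + k) - f n"] by simp
    then show ?case
      using step[of "n + k"] Suc by simp
  qed simp
  have "decseq a"
    using order_trans[OF norm_ge_zero step] by (intro decseq_SucI) simp
  then obtain b where b: "a \<longlonglongrightarrow> b"
    using a decseq_convergent[of a 0] by metis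
  then have ca: "Cauchy a"
    by (rule LIMSEQ_imp_Cauchy)
  have "Cauchy f"
  proof (rule CauchyI')
    fix e :: real assume "e > 0"
    then obtain M where M: "\<And>m n. m \<ge> M \<Longrightarrow> n \<ge> M \<Longrightarrow> norm (a m - a n) < e"
      using CauchyD[OF ca] by metis
    show "\<exists>M. \<forall>m\<ge>M. \<forall>n>m. dist (f m) (f n) < e"
    proof (intro exI allI impI)
      fix m n assume "m \<ge> M" "m < n"
      then have "norm (a m - a n) < e" by (intro M) auto
      with tel[of m "n - m"] \<open>m < n\<close> show "dist (f m) (f n) < e"
        by (simp add: dist_norm norm_minus_commute)
    qed
  qed
  then obtain l where l: "f \<longlonglongrightarrow> l"
    using Cauchy_convergent_iff convergent_def by blast
  moreover have "norm (l - f n) \<le> a n" for n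
  proof (rule LIMSEQ_le_const2)
    show "(\<lambda>k. norm (f (k + n) - f n)) \<longlonglongrightarrow> norm (l - f n)"
      using LIMSEQ_ignore_initial_segment[OF l] by (intro tendsto_intros)
    show "\<exists>N. \<forall>k\<ge>N. norm (f (k + n) - f n) \<le> a n"
      using tel[of n] a by (metis add.commute diff_ge_0_iff_ge diff_add_cancel le_add_same_cancel1 order_trans diff_left_mono diff_zero)
  qed
  ultimately show ?thesis
    using that by blast
qed

text \<open>The gliding hump argument of Sokal's proof of the uniform boundedness principle.\<close>

lemma weakly_bounded_imp_bounded:
  fixes Z :: "'a::{real_inner,banach} set"
  assumes wb: "\<And>y. \<exists>M. \<forall>z\<in>Z. \<bar>inner y z\<bar> \<le> M"
  shows "\<exists>M. \<forall>z\<in>Z. norm z \<le> M"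
proof (rule ccontr)
  assume "\<not> ?thesis"
  then have "\<forall>n. \<exists>z\<in>Z. norm z > 4 ^ n"
    by (meson not_le)
  then obtain z where z: "\<And>n. z n \<in> Z" "\<And>n::nat. norm (z n) > 4 ^ n"
    by metis
  have z0: "norm (z n) > 0" for n
    using z(2)[of n] by (meson less_trans zero_less_numeral zero_less_power)
  define u where "u = (\<lambda>n. (1 / norm (z n)) *\<^sub>R z n)"
  have u: "norm (u n) = 1" "inner (u n) (z n) = norm (z n)" for n
    using z0[of n] by (auto simp: u_def dot_square_norm power2_eq_square)
  \<comment> \<open>The sign makes each step add to the absolute value of the product with
    \<open>z n\<close>. The ratio 1/3 makes the steps summable, and the growth of
    \<open>norm (z n)\<close> beyond \<open>4 ^ n\<close> still outweighs it.\<close>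
  define x where "x = rec_nat 0
    (\<lambda>n w. w + ((if inner w (z n) \<ge> 0 then 1 else - 1) * (1/3) ^ n) *\<^sub>R u n)"
  have xS: "x (Suc n) = x n + ((if inner (x n) (z n) \<ge> 0 then 1 else - 1) * (1/3) ^ n) *\<^sub>R u n" for n
    by (simp add: x_def)
  obtain l where l: "\<And>n. norm (l - x n) \<le> 3/2 * (1/3) ^ n"
  \<comment> \<open>\<open>3/2 * (1/3) ^ n\<close> is the sum of all step lengths from
    \<open>n\<close> on.\<close>
  proof (rule telescoping_limit_exists[of x "\<lambda>n. 3/2 * (1/3) ^ n"])
    show "norm (x (Suc n) - x n) \<le> 3/2 * (1/3) ^ n - 3/2 * (1/3) ^ Suc n" for n
      by (simp add: xS u)
  qed auto
  obtain M where M: "\<And>n. \<bar>inner l (z n)\<bar> \<le> M"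
    using wb[of l] z(1) by blast
  \<comment> \<open>Step \<open>n\<close> contributes \<open>(1/3) ^ n * norm (z n)\<close>, and all
    later steps together can cancel at most half of it.\<close>
  have bound: "(1/2) * (4/3) ^ n \<le> M" for n :: nat
  proof -
    have "inner (x (Suc n)) (z n)
        = inner (x n) (z n) + (if inner (x n) (z n) \<ge> 0 then 1 else - 1) * (1/3) ^ n * norm (z n)"
      by (simp add: xS inner_add_left u)
    moreover have "t \<le> \<bar>p + (if p \<ge> 0 then 1 else - 1) * t\<bar>" if "t \<ge> 0" for p t :: real
      using that by auto
    ultimately have "(1/3) ^ n * norm (z n) \<le> \<bar>inner (x (Suc n)) (z n)\<bar>"
      by (simp add: mult.assoc)
    also have "inner (x (Suc n)) (z n) = inner l (z n) - inner (l - x (Suc n)) (z n)"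
      by (simp add: inner_diff_left)
    also have "\<bar>\<dots>\<bar> \<le> M + norm (l - x (Suc n)) * norm (z n)"
      using M[of n] Cauchy_Schwarz_ineq2[of "l - x (Suc n)" "z n"] by linarith
    also have "\<dots> \<le> M + (3/2 * (1/3) ^ Suc n) * norm (z n)"
      by (intro add_left_mono mult_right_mono l) simp
    finally have "(1/2) * ((1/3) ^ n * norm (z n)) \<le> M"
      by simp
    moreover have "(1/3) ^ n * 4 ^ n \<le> (1/3) ^ n * norm (z n)"
      using z(2)[of n] by (intro mult_left_mono) auto
    moreover have "(1/3) ^ n * 4 ^ n = (4/3 :: real) ^ n"
      by (simp flip: power_mult_distrib)
    ultimately show ?thesis by linarith
  qed
  obtain n where "2 * M < (4/3) ^ n"
    using real_arch_pow[of "4/3" "2 * M"] by auto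
  with bound[of n] show False
    by simp
qed

text \<open>A fixed point \<open>Y\<close> satisfies \<open>2 Y = X + Y Y\<close>, so
  \<open>id - Y\<close> squares to \<open>id - X\<close>. All iterates are polynomials in
  \<open>X\<close>, hence whatever commutes with \<open>X\<close> commutes with the limit.\<close>

primrec sqrt_iter :: "('a::banach \<Rightarrow>\<^sub>L 'a) \<Rightarrow> nat \<Rightarrow> ('a \<Rightarrow>\<^sub>L 'a)" where
  "sqrt_iter X 0 = 0"
| "sqrt_iter X (Suc n) = (1/2) *\<^sub>R (X + (sqrt_iter X n o\<^sub>L sqrt_iter X n))"

text \<open>The scalar iteration dominates the operator iteration, hence convergence in norm.\<close>

lemma sqrt_iter_convergent:
  fixes X :: "'a::banach \<Rightarrow>\<^sub>L 'a"
  assumes X: "norm X \<le> 1"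
  shows "\<exists>Y. sqrt_iter X \<longlonglongrightarrow> Y"
proof -
  \<comment> \<open>The same iteration with the number 1 in place of \<open>X\<close>; it stays
    between 0 and 1, and \<open>1 - y n\<close> serves as the telescoping bound.\<close>
  define y :: "nat \<Rightarrow> real" where "y = rec_nat 0 (\<lambda>_ t. (1 + t\<^sup>2) / 2)"
  have y [simp]: "y 0 = 0" "y (Suc n) = (1 + (y n)\<^sup>2) / 2" for n
    by (simp_all add: y_def)
  have y01: "0 \<le> y n \<and> y n \<le> 1" for n
  proof (induction n)
    case (Suc n)
    then show ?case
      using power_le_one[of "y n" 2] by simp
  qed simp
  have nY: "norm (sqrt_iter X n) \<le> y n" for n
  proof (induction n)
    case (Suc n)
    have "norm (X + (sqrt_iter X n o\<^sub>L sqrt_iter X n))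
        \<le> norm X + norm (sqrt_iter X n) * norm (sqrt_iter X n)"
      using norm_triangle_ineq[of X "sqrt_iter X n o\<^sub>L sqrt_iter X n"]
        norm_blinfun_compose[of "sqrt_iter X n" "sqrt_iter X n"] by linarith
    also have "\<dots> \<le> 1 + y n * y n"
      by (intro add_mono X mult_mono Suc) (use y01 in auto)
    finally show ?case
      by (simp add: power2_eq_square)
  qed simp
  have step: "norm (sqrt_iter X (Suc n) - sqrt_iter X n) \<le> (1 - y n) - (1 - y (Suc n))" for n
  proof (induction n)
    case 0
    show ?case
      using X by simp
  next
    case (Suc n)
    let ?U = "sqrt_iter X (Suc n)" and ?V = "sqrt_iter X n"
    have "sqrt_iter X (Suc (Suc n)) - ?U = (1/2) *\<^sub>R ((?U o\<^sub>L ?U) - (?V o\<^sub>L ?V))"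
      by (simp only: sqrt_iter.simps(2)[of X "Suc n"] scaleR_diff_right[symmetric]
          sqrt_iter.simps(2)[of X n, THEN arg_cong2[of _ _ _ _ "(-)", OF refl]]) simp
    also have "(?U o\<^sub>L ?U) - (?V o\<^sub>L ?V) = ((?U - ?V) o\<^sub>L ?U) + (?V o\<^sub>L (?U - ?V))"
      by (rule blinfun_eqI) (simp add: blinfun.diff_left blinfun.add_left blinfun.diff_right)
    finally have "norm (sqrt_iter X (Suc (Suc n)) - ?U)
        = 1/2 * norm (((?U - ?V) o\<^sub>L ?U) + (?V o\<^sub>L (?U - ?V)))"
      by simp
    also have "\<dots> \<le> 1/2 * (norm (?U - ?V) * norm ?U + norm ?V * norm (?U - ?V))"
      using norm_triangle_ineq[of "(?U - ?V) o\<^sub>L ?U" "?V o\<^sub>L (?U - ?V)"]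
        norm_blinfun_compose[of "?U - ?V" ?U] norm_blinfun_compose[of ?V "?U - ?V"] by simp
    also have "\<dots> \<le> 1/2 * ((y (Suc n) - y n) * y (Suc n) + y n * (y (Suc n) - y n))"
      using Suc nY[of "Suc n"] nY[of n] y01[of "Suc n"] y01[of n] order_trans[OF norm_ge_zero Suc]
      by (intro mult_left_mono add_mono mult_mono) (auto simp del: sqrt_iter.simps y)
    also have "\<dots> = (1 - y (Suc n)) - (1 - y (Suc (Suc n)))"
      unfolding y(2)[of "Suc n"] y(2)[of n, THEN arg_cong[of _ _ "\<lambda>t. t / 2"]]
      by (simp add: power2_eq_square field_simps)
    finally show ?case .
  qed
  show ?thesis
    by (rule telescoping_limit_exists[of "sqrt_iter X" "\<lambda>n. 1 - y n"]) (use step y01 in auto)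
qed

lemma adj_add: "adj (A + B) = adj A + adj B"
  by (rule adj_eqI) (simp add: blinfun.add_left inner_add_left inner_add_right inner_adj)

lemma adj_scaleR: "adj (r *\<^sub>R A) = r *\<^sub>R adj A"
  by (rule adj_eqI) (simp add: blinfun.scaleR_left inner_adj)

lemma adj_id: "adj id_blinfun = id_blinfun"
  by (rule adj_eqI) simp

lemma adj_diff: "adj (A - B) = adj A - adj B"
  by (rule adj_eqI) (simp add: blinfun.diff_left inner_diff_left inner_diff_right inner_adj)

lemma adj_zero: "adj 0 = 0"
  by (rule adj_eqI) simp

lemma norm_adj_le: "norm (adj A) \<le> norm A"
proof (rule norm_blinfun_bound)
  fix x
  have "norm (adj A x) * norm (adj A x) = inner (A (adj A x)) x"
    by (simp add: inner_adj dot_square_norm power2_eq_square)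
  also have "\<dots> \<le> norm (A (adj A x)) * norm x"
    by (rule norm_cauchy_schwarz)
  also have "\<dots> \<le> (norm A * norm (adj A x)) * norm x"
    by (intro mult_right_mono norm_blinfun norm_ge_zero)
  finally show "norm (adj A x) \<le> norm A * norm x"
    by (cases "adj A x = 0") (auto simp: algebra_simps)
qed simp

text \<open>\<open>B\<close> is a square root of \<open>adj A o\<^sub>L A\<close>, which is scaled
  so that the iteration above applies. The commutation property passes from the iterates to their
  limit; it later makes the graphs of polar decompositions invariant under the commutant.\<close>

lemma abs_operator_exists:
  fixes A :: "'a::{real_inner,banach} \<Rightarrow>\<^sub>L 'a"
  obtains B where "adj B = B" "\<And>x. norm (blinfun_apply B x) = norm (A x)"
    "\<And>C. C o\<^sub>L (adj A o\<^sub>L A) = (adj A o\<^sub>L A) o\<^sub>L C \<Longrightarrow> C o\<^sub>L B = B o\<^sub>L C"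
proof -
  define K where "K = adj A o\<^sub>L A"
  \<comment> \<open>An upper bound for the norm of \<open>K\<close>, which gives
    \<open>norm X \<le> 1\<close>; the added 1 keeps it positive when \<open>A\<close> is
    zero.\<close>
  define c where "c = (norm A)\<^sup>2 + 1"
  have c: "c > 0" "(norm A)\<^sup>2 \<le> c"
    by (auto simp: c_def add_nonneg_pos)
  define X where "X = id_blinfun - (1/c) *\<^sub>R K"
  have adjK: "adj K = K"
    by (simp add: K_def adj_compose)
  have "norm X \<le> 1"
  proof (rule norm_blinfun_bound)
    fix x
    have Kx: "inner x (K x) = (norm (A x))\<^sup>2"
      by (simp add: K_def power2_norm_eq_inner flip: inner_adj)
    have "norm (K x) \<le> norm (adj A) * norm (A x)"
      unfolding K_def by (simp add: norm_blinfun)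
    also have "\<dots> \<le> norm A * norm (A x)"
      by (intro mult_right_mono norm_adj_le) simp
    finally have "(norm (K x))\<^sup>2 \<le> (norm A)\<^sup>2 * (norm (A x))\<^sup>2"
      by (metis norm_ge_zero power_mono power_mult_distrib)
    also have "\<dots> \<le> c * (norm (A x))\<^sup>2"
      by (intro mult_right_mono c) simp
    finally have "(norm (K x))\<^sup>2 \<le> c * (norm (A x))\<^sup>2" .
    then have "(norm (K x))\<^sup>2 / c\<^sup>2 \<le> (norm (A x))\<^sup>2 / c"
      using c by (simp add: power2_eq_square field_simps)
    moreover have "(norm (X x))\<^sup>2 = (norm x)\<^sup>2 - (2/c) * (norm (A x))\<^sup>2 + (norm (K x))\<^sup>2 / c\<^sup>2"
      unfolding power2_norm_eq_inner Kx[unfolded power2_norm_eq_inner, symmetric] X_def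
      by (simp add: blinfun.diff_left blinfun.scaleR_left inner_diff_left inner_diff_right
          inner_commute power2_eq_square)
    moreover have "(norm (A x))\<^sup>2 / c \<ge> 0"
      using c by simp
    ultimately have "(norm (X x))\<^sup>2 \<le> (norm x)\<^sup>2"
      by simp
    then show "norm (X x) \<le> 1 * norm x"
      by (simp add: power2_le_iff_abs_le)
  qed simp
  then obtain Y where Y: "sqrt_iter X \<longlonglongrightarrow> Y"
    using sqrt_iter_convergent by blast
  have comp: "(\<lambda>n. sqrt_iter X n o\<^sub>L sqrt_iter X n) \<longlonglongrightarrow> (Y o\<^sub>L Y)"
    by (intro bounded_bilinear.tendsto[OF bounded_bilinear_blinfun_compose] Y)
  have "(\<lambda>n. sqrt_iter X (Suc n)) \<longlonglongrightarrow> (1/2) *\<^sub>R (X + (Y o\<^sub>L Y))"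
    by (simp only: sqrt_iter.simps) (intro tendsto_intros comp)
  then have Yeq: "Y = (1/2) *\<^sub>R (X + (Y o\<^sub>L Y))"
    using LIMSEQ_unique[OF LIMSEQ_Suc[OF Y]] by blast
  have adjY: "adj Y = Y"
  proof -
    have "adj (sqrt_iter X n) = sqrt_iter X n" for n
      by (induction n)
        (simp_all add: adj_zero adj_scaleR adj_add adj_compose X_def adj_diff adj_id adjK)
    then have "inner (sqrt_iter X n x) y = inner x (sqrt_iter X n y)" for n x y
      by (metis inner_adj)
    then have "inner (Y x) y = inner x (Y y)" for x y
    proof -
      have "(\<lambda>n. inner (sqrt_iter X n x) y) \<longlonglongrightarrow> inner (Y x) y"
        "(\<lambda>n. inner x (sqrt_iter X n y)) \<longlonglongrightarrow> inner x (Y y)"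
        by (intro tendsto_intros blinfun.tendsto Y)+
      with \<open>\<And>n x y. inner (sqrt_iter X n x) y = inner x (sqrt_iter X n y)\<close> show ?thesis
        using LIMSEQ_unique by auto
    qed
    then show ?thesis
      by (intro adj_eqI)
  qed
  have comm: "C o\<^sub>L Y = Y o\<^sub>L C" if "C o\<^sub>L K = K o\<^sub>L C" for C
  proof -
    have CX: "C o\<^sub>L X = X o\<^sub>L C"
      using that by (simp add: blinfun_compose_eq_iff X_def blinfun.diff_left blinfun.diff_right
          blinfun.scaleR_left blinfun.scaleR_right)
    have "C o\<^sub>L sqrt_iter X n = sqrt_iter X n o\<^sub>L C" for n
    proof (induction n)
      case (Suc n)
      have "C (sqrt_iter X n (sqrt_iter X n x)) = sqrt_iter X n (sqrt_iter X n (C x))" for x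
        using Suc by (simp add: blinfun_compose_eq_iff)
      moreover have "C (X x) = X (C x)" for x
        using CX by (simp add: blinfun_compose_eq_iff)
      ultimately show ?case
        by (simp add: blinfun_compose_eq_iff blinfun.add_left blinfun.add_right blinfun.scaleR_left blinfun.scaleR_right)
    qed simp
    moreover have "(\<lambda>n. C o\<^sub>L sqrt_iter X n) \<longlonglongrightarrow> (C o\<^sub>L Y)" "(\<lambda>n. sqrt_iter X n o\<^sub>L C) \<longlonglongrightarrow> (Y o\<^sub>L C)"
      by (intro bounded_bilinear.tendsto[OF bounded_bilinear_blinfun_compose] Y tendsto_const)+
    ultimately show ?thesis
      using LIMSEQ_unique by auto
  qed
  \<comment> \<open>\<open>id_blinfun - Y\<close> squares to \<open>id_blinfun - X\<close>, which is
    \<open>K\<close> divided by \<open>c\<close>; the factor \<open>sqrt c\<close> undoes this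
    scaling.\<close>
  define B where "B = sqrt c *\<^sub>R (id_blinfun - Y)"
  have B2: "B (B x) = K x" for x
  proof -
    have "Y x = (1/2) *\<^sub>R (X x + Y (Y x))"
      by (subst Yeq) (simp add: blinfun.add_left blinfun.scaleR_left)
    then have "2 *\<^sub>R Y x = 2 *\<^sub>R ((1/2) *\<^sub>R (X x + Y (Y x)))"
      by (rule arg_cong)
    then have "2 *\<^sub>R Y x = X x + Y (Y x)"
      by simp
    moreover have "B (B x) = c *\<^sub>R (x - 2 *\<^sub>R Y x + Y (Y x))"
      unfolding B_def
      using c by (simp add: blinfun.diff_left blinfun.scaleR_left blinfun.scaleR_right
          blinfun.diff_right scaleR_2 algebra_simps)
    ultimately show ?thesis
      using c by (simp add: X_def blinfun.diff_left blinfun.scaleR_left)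
  qed
  show ?thesis
  proof
    show adjB: "adj B = B"
      by (simp add: B_def adj_scaleR adj_diff adj_id adjY)
    show "norm (B x) = norm (A x)" for x
    proof -
      have "inner (B x) (B x) = inner x (K x)"
        by (simp add: inner_adj adjB B2)
      also have "\<dots> = inner (A x) (A x)"
        by (simp add: K_def inner_adj)
      finally show ?thesis
        by (simp add: norm_eq_sqrt_inner)
    qed
    show "C o\<^sub>L B = B o\<^sub>L C" if "C o\<^sub>L (adj A o\<^sub>L A) = (adj A o\<^sub>L A) o\<^sub>L C" for C
    proof -
      have "C (Y x) = Y (C x)" for x
        using comm[of C] that by (simp add: blinfun_compose_eq_iff K_def)
      then show ?thesis
        by (simp add: blinfun_compose_eq_iff B_def blinfun.diff_left blinfun.scaleR_left blinfun.scaleR_right blinfun.diff_right)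
    qed
  qed
qed

text \<open>The open mapping theorem in Hilbert space. The absolute value of \<open>S\<close> on \<open>D\<close> is a
  symmetric bijection of \<open>D\<close>, so its inverse is bounded by the Hellinger--Toeplitz argument.\<close>

lemma bounded_below_if_closed_range:
  fixes S :: "'a::{real_inner,banach} \<Rightarrow>\<^sub>L 'a"
  assumes D: "closed D" "subspace D"
    and inj: "\<And>x. x \<in> D \<Longrightarrow> S x = 0 \<Longrightarrow> x = 0"
    and cl: "closed (blinfun_apply S ` D)"
  obtains M where "\<And>x. x \<in> D \<Longrightarrow> norm x \<le> M * norm (S x)" "M \<ge> 0"
proof -
  obtain B where B: "adj B = B" and nB: "\<And>x. norm (blinfun_apply B x) = norm (S (oproj D x))"
    using abs_operator_exists[of "S o\<^sub>L oproj D"] by (metis blinfun_apply_blinfun_compose)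
  have sym: "inner (B x) y = inner x (B y)" for x y
    by (simp add: inner_adj B)
  have ker: "x \<in> D\<^sup>\<bottom>" if "B x = 0" for x
    using that nB[of x] inj[of "oproj D x"] D by (simp add: oproj_in oproj_zero_iff)
  have ran: "B x \<in> D" for x
  proof -
    have "B x \<in> D\<^sup>\<bottom>\<^sup>\<bottom>"
    proof (rule orthogonal_compI)
      fix y assume "y \<in> D\<^sup>\<bottom>"
      then have "B y = 0"
        using nB[of y] D by (simp add: oproj_zero blinfun.zero_right)
      then show "inner (B x) y = 0"
        by (simp add: sym)
    qed
    then show ?thesis
      using D by (simp add: orthogonal_comp_comp)
  qed
  \<comment> \<open>\<open>B\<close> and \<open>S o\<^sub>L oproj D\<close> produce equal distances,
    so a convergent sequence in the range of \<open>B\<close> gives a Cauchy sequence in the closed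
    image of \<open>D\<close>; its limit \<open>S d\<close> yields the limit
    \<open>B d\<close>.\<close>
  have clB: "closed (range B)"
    unfolding closed_sequential_limits
  proof (intro allI impI)
    fix g l assume g: "(\<forall>n. g n \<in> range B) \<and> g \<longlonglongrightarrow> l"
    then obtain x where x: "\<And>n. g n = B (x n)"
      unfolding image_iff by metis
    define h where "h = (\<lambda>n. S (oproj D (x n)))"
    have dist_h: "dist (h m) (S (oproj D y)) = dist (g m) (B y)" for m y
      using nB[of "x m - y"] by (simp add: h_def x dist_norm blinfun.diff_right)
    have "Cauchy h"
      using LIMSEQ_imp_Cauchy[of g l] g dist_h[of _ "x _"]
      unfolding Cauchy_def x by (simp add: h_def)
    moreover have "h n \<in> S ` D" for n
      using D by (auto simp: h_def oproj_in)
    ultimately obtain d where d: "d \<in> D" "h \<longlonglongrightarrow> S d"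
      using cl unfolding complete_eq_closed[symmetric] complete_def by blast
    then have "(\<lambda>n. dist (h n) (S (oproj D d))) \<longlonglongrightarrow> 0"
      using D by (simp add: oproj_ident flip: tendsto_dist_iff)
    then have "g \<longlonglongrightarrow> B d"
      unfolding dist_h by (simp flip: tendsto_dist_iff)
    then show "l \<in> range B"
      using g LIMSEQ_unique by blast
  qed
  have rangeB: "range B = D"
  proof (rule closed_subspace_eqI)
    show "subspace (range B)"
      by (intro linear_subspace_image subspace_UNIV bounded_linear.linear blinfun.bounded_linear_right)
    show "x = 0" if "x \<in> D" "x \<in> (range B)\<^sup>\<bottom>" for x
    proof -
      have "inner x (B (B x)) = 0"
        using that by (auto simp: orthogonal_comp_iff)
      then have "inner (B x) (B x) = 0"
        by (simp only: sym)
      then have "B x = 0"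
        by simp
      then have "x \<in> D\<^sup>\<bottom>"
        by (rule ker)
      then have "inner x x = 0"
        using that(1) by (rule orthogonal_compD)
      then show ?thesis by simp
    qed
  qed (use clB ran D in auto)
  \<comment> \<open>Writing the projection of \<open>y\<close> onto \<open>D\<close> as
    \<open>B w\<close> turns the product of \<open>y\<close> and \<open>z\<close> into that of
    \<open>w\<close> and \<open>B z\<close>, where \<open>norm (B z)\<close> equals
    \<open>norm (S z)\<close>. So \<open>Z\<close> is weakly bounded.\<close>
  define Z where "Z = {x \<in> D. norm (S x) \<le> 1}"
  have "\<exists>M. \<forall>z\<in>Z. \<bar>inner y z\<bar> \<le> M" for y
  proof -
    obtain w where w: "oproj D y = B w"
      using rangeB D by (metis imageE oproj_in)
    have "\<bar>inner y z\<bar> \<le> norm w" if "z \<in> Z" for z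
    proof -
      have z: "z \<in> D" "norm (S z) \<le> 1"
        using that by (auto simp: Z_def)
      have "inner y z = inner (oproj D y) z"
        using D z by (simp add: oproj_selfadjoint oproj_ident)
      also have "\<dots> = inner w (B z)"
        by (simp add: w sym)
      finally have "\<bar>inner y z\<bar> \<le> norm w * norm (B z)"
        by (simp add: Cauchy_Schwarz_ineq2)
      also have "\<dots> \<le> norm w * 1"
        using z D by (intro mult_left_mono) (auto simp: nB oproj_ident)
      finally show ?thesis by simp
    qed
    then show ?thesis by blast
  qed
  then have "\<exists>M. \<forall>z\<in>Z. norm z \<le> M"
    by (rule weakly_bounded_imp_bounded)
  then obtain M where M: "\<And>z. z \<in> Z \<Longrightarrow> norm z \<le> M"
    by blast
  have "norm x \<le> M * norm (S x)" if x: "x \<in> D" for x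
  proof (cases "x = 0")
    case False
    then have pos: "norm (S x) > 0"
      using inj x by auto
    have "(1 / norm (S x)) *\<^sub>R x \<in> Z"
      using x D pos by (auto simp: Z_def subspace_scale blinfun.scaleR_right)
    from M[OF this] pos show ?thesis
      by (simp add: field_simps)
  qed simp
  moreover have "M \<ge> 0"
    using M[of 0] D by (auto simp: Z_def subspace_0 blinfun.zero_right)
  ultimately show ?thesis
    using that by blast
qed

section \<open>Equivalence of affiliated subspaces\<close>

lemma closed_blinfun_preimage: "closed L \<Longrightarrow> closed {x. blinfun_apply S x \<in> L}"
  using closed_vimage[of L "blinfun_apply S"] by (simp add: vimage_def continuous_intros)

lemma subspace_blinfun_preimage: "subspace L \<Longrightarrow> subspace {x. blinfun_apply S x \<in> L}"
  by (auto simp: subspace_def blinfun.zero_right blinfun.add_right blinfun.scaleR_right)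

text \<open>A complex von Neumann algebra is also a real one, because its real commutant contains the
  multiplication by the imaginary unit; this allows all the geometry to be done with the real inner
  product. Projections of the algebra are replaced by their ranges.\<close>

locale real_vna =
  fixes \<A> :: "('h::{real_inner,banach} \<Rightarrow>\<^sub>L 'h) set"
  assumes adj_in: "S \<in> \<A> \<Longrightarrow> adj S \<in> \<A>"
    and bicommutant: "(\<And>C. (\<And>R. R \<in> \<A> \<Longrightarrow> C o\<^sub>L R = R o\<^sub>L C) \<Longrightarrow> S o\<^sub>L C = C o\<^sub>L S) \<Longrightarrow> S \<in> \<A>"
begin

definition real_commutant :: "('h \<Rightarrow>\<^sub>L 'h) set" where
  "real_commutant = {C. \<forall>R\<in>\<A>. C o\<^sub>L R = R o\<^sub>L C}"

lemma commutantD: "C \<in> real_commutant \<Longrightarrow> S \<in> \<A> \<Longrightarrow> blinfun_apply C (blinfun_apply S x) = S (C x)"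
  by (auto simp: real_commutant_def blinfun_compose_eq_iff)

lemma algebraI:
  assumes "\<And>C x. C \<in> real_commutant \<Longrightarrow> blinfun_apply S (blinfun_apply C x) = C (S x)"
  shows "S \<in> \<A>"
  using assms by (intro bicommutant) (simp add: real_commutant_def blinfun_compose_eq_iff)

lemma adj_commutant: "C \<in> real_commutant \<Longrightarrow> adj C \<in> real_commutant"
  using adj_in unfolding real_commutant_def by simp (metis adj_adj adj_compose)

lemma id_in: "id_blinfun \<in> \<A>"
  by (rule algebraI) simp

lemma
  assumes S: "S \<in> \<A>" and R: "R \<in> \<A>"
  shows compose_in: "S o\<^sub>L R \<in> \<A>" and add_in: "S + R \<in> \<A>" and diff_in: "S - R \<in> \<A>"
  by (rule algebraI, simp add: commutantD[OF _ S] commutantD[OF _ R] blinfun.add_left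
      blinfun.add_right blinfun.diff_left blinfun.diff_right)+

text \<open>These are the ranges of the projections in \<open>\<A>\<close>: the commutant is closed
  under \<open>adj\<close>, so an invariant closed subspace reduces it
  (\<open>oproj_in_algebra\<close>). The converse is \<open>affiliated_range\<close>.\<close>

definition affiliated :: "'h set \<Rightarrow> bool" where
  "affiliated L \<longleftrightarrow> closed L \<and> subspace L \<and> (\<forall>C\<in>real_commutant. \<forall>x\<in>L. blinfun_apply C x \<in> L)"

lemma affiliatedD: "affiliated L \<Longrightarrow> closed L" "affiliated L \<Longrightarrow> subspace L"
  "affiliated L \<Longrightarrow> C \<in> real_commutant \<Longrightarrow> x \<in> L \<Longrightarrow> blinfun_apply C x \<in> L"
  by (auto simp: affiliated_def)

lemma
  assumes "affiliated L"
  shows aff_oproj_in: "oproj L x \<in> L"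
    and aff_oproj_diff_in: "x - oproj L x \<in> L\<^sup>\<bottom>"
    and aff_oproj_ident: "x \<in> L \<Longrightarrow> oproj L x = x"
    and aff_oproj_zero: "x \<in> L\<^sup>\<bottom> \<Longrightarrow> oproj L x = 0"
    and aff_comp_comp: "L\<^sup>\<bottom>\<^sup>\<bottom> = L"
    and aff_oproj_comp: "oproj (L\<^sup>\<bottom>) x = x - oproj L x"
    and aff_oproj_selfadjoint: "inner (oproj L x) y = inner x (oproj L y)"
  using affiliatedD(1,2)[OF assms]
  by (simp_all add: oproj_in oproj_diff_in oproj_ident oproj_zero orthogonal_comp_comp
      oproj_orthogonal_comp oproj_selfadjoint)

lemma affiliated_comp: "affiliated L \<Longrightarrow> affiliated (L\<^sup>\<bottom>)"
proof -
  assume L: "affiliated L"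
  have "blinfun_apply C x \<in> L\<^sup>\<bottom>" if C: "C \<in> real_commutant" and x: "x \<in> L\<^sup>\<bottom>" for C x
  proof (rule orthogonal_compI)
    fix y assume "y \<in> L"
    then have "adj C y \<in> L"
      using L C adj_commutant affiliatedD(3) by blast
    then show "inner (C x) y = 0"
      using orthogonal_compD[OF x] by (simp add: inner_adj)
  qed
  then show ?thesis
    by (simp add: affiliated_def closed_orthogonal_comp subspace_orthogonal_comp)
qed

lemma affiliated_Int: "affiliated L \<Longrightarrow> affiliated M \<Longrightarrow> affiliated (L \<inter> M)"
  by (auto simp: affiliated_def closed_Int subspace_inter)

lemma affiliated_UNIV: "affiliated UNIV" and affiliated_0: "affiliated {0}"
  by (auto simp: affiliated_def subspace_UNIV blinfun.zero_right subspace_single_0)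

lemma affiliated_kernel: "S \<in> \<A> \<Longrightarrow> affiliated {x. blinfun_apply S x = 0}"
  by (auto simp: affiliated_def subspace_def blinfun.zero_right blinfun.add_right
      blinfun.scaleR_right simp flip: commutantD intro!: closed_Collect_eq continuous_intros)

lemma affiliated_closure:
  assumes "subspace L" "\<And>C x. C \<in> real_commutant \<Longrightarrow> x \<in> L \<Longrightarrow> blinfun_apply C x \<in> L"
  shows "affiliated (closure L)"
  unfolding affiliated_def
proof (intro conjI ballI)
  fix C x assume C: "C \<in> real_commutant" and x: "x \<in> closure L"
  have "blinfun_apply C ` closure L \<subseteq> closure L"
    by (rule image_closure_subset)
      (use assms(2)[OF C] closure_subset in \<open>auto intro!: continuous_intros\<close>)
  with x show "C x \<in> closure L" by blast
qed (use assms in \<open>auto simp: subspace_closure\<close>)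

lemma subspace_blinfun_image: "subspace L \<Longrightarrow> subspace (blinfun_apply S ` L)"
  by (intro linear_subspace_image bounded_linear.linear blinfun.bounded_linear_right)

lemma affiliated_closure_image:
  assumes "S \<in> \<A>" "affiliated L"
  shows "affiliated (closure (blinfun_apply S ` L))"
  using affiliatedD[OF assms(2)]
  by (intro affiliated_closure) (auto simp: subspace_blinfun_image commutantD[OF _ assms(1)])

lemma affiliated_image:
  assumes "S \<in> \<A>" "affiliated L" "closed (blinfun_apply S ` L)"
  shows "affiliated (blinfun_apply S ` L)"
  using affiliated_closure_image[OF assms(1,2)] assms(3) by simp

lemma oproj_in_algebra: "affiliated L \<Longrightarrow> oproj L \<in> \<A>"
  by (rule algebraI, rule oproj_commute[symmetric])
    (auto simp: affiliatedD inner_adj adj_commutant)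

text \<open>The graph of a partial isometry in \<open>\<A>\<close>, restricted to its initial space.\<close>

definition iso_graph :: "('h \<times> 'h) set \<Rightarrow> bool" where
  "iso_graph G \<longleftrightarrow> closed G \<and> subspace G \<and> (\<forall>z\<in>G. norm (fst z) = norm (snd z)) \<and>
     (\<forall>C\<in>real_commutant. \<forall>z\<in>G. (blinfun_apply C (fst z), blinfun_apply C (snd z)) \<in> G)"

text \<open>Murray-von Neumann equivalence of the projections onto \<open>L\<close> and
  \<open>M\<close>, see \<open>mvn_equiv_oproj_iff\<close>. \<open>V\<close> is constrained on
  \<open>L\<close> alone; the partial isometry is \<open>V o\<^sub>L oproj L\<close>.\<close>

definition eqv :: "'h set \<Rightarrow> 'h set \<Rightarrow> bool" (infix "\<simeq>" 50) where
  "L \<simeq> M \<longleftrightarrow> affiliated L \<and> affiliated M \<and>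
     (\<exists>V\<in>\<A>. (\<forall>x\<in>L. norm (blinfun_apply V x) = norm x) \<and> blinfun_apply V ` L = M)"

lemma eqv_affiliated: "L \<simeq> M \<Longrightarrow> affiliated L" "L \<simeq> M \<Longrightarrow> affiliated M"
  by (auto simp: eqv_def)

text \<open>Lets a partial isometry be prescribed on a dense set of pairs: equality of norms and
  invariance under the commutant survive limits.\<close>

lemma iso_graphI_closure:
  assumes D: "subspace D" and norm_eq: "\<And>x y. (x, y) \<in> D \<Longrightarrow> norm x = norm y"
    and inv: "\<And>C x y. C \<in> real_commutant \<Longrightarrow> (x, y) \<in> D \<Longrightarrow> (blinfun_apply C x, blinfun_apply C y) \<in> D"
  shows "iso_graph (closure D)"
  unfolding iso_graph_def
proof (intro conjI ballI)
  show "subspace (closure D)"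
    using D by (rule subspace_closure)
  fix z assume z: "z \<in> closure D"
  have "closure D \<subseteq> {z. norm (fst z) = norm (snd z)}"
    by (rule closure_minimal) (use norm_eq in \<open>auto intro!: closed_Collect_eq continuous_intros\<close>)
  with z show "norm (fst z) = norm (snd z)" by blast
  fix C assume C: "C \<in> real_commutant"
  have "(\<lambda>z. (blinfun_apply C (fst z), blinfun_apply C (snd z))) ` closure D \<subseteq> closure D"
  proof (rule image_closure_subset)
    show "continuous_on (closure D) (\<lambda>z. (blinfun_apply C (fst z), blinfun_apply C (snd z)))"
      by (intro continuous_intros)
    show "(\<lambda>z. (blinfun_apply C (fst z), blinfun_apply C (snd z))) ` D \<subseteq> closure D"
      using inv[OF C] closure_subset[of D] by auto
  qed auto
  with z show "(C (fst z), C (snd z)) \<in> closure D" by blast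
qed simp

text \<open>For an isometric graph \<open>G\<close> with domain \<open>D\<close>, the projection of \<open>(x, 0)\<close> onto \<open>G\<close> is half of
  \<open>(P\<^sub>D x, V (P\<^sub>D x))\<close>. This gives \<open>V\<close> as an operator without extending it by continuity.\<close>

lemma iso_graph_operator:
  assumes G: "iso_graph G"
  obtains V where "V \<in> \<A>" "\<And>x y. (x, y) \<in> G \<Longrightarrow> blinfun_apply V x = y"
    "affiliated (fst ` G)"
proof -
  have cG: "closed G" "subspace G" and nG: "\<And>z. z \<in> G \<Longrightarrow> norm (fst z) = norm (snd z)"
    and iG: "\<And>C z. C \<in> real_commutant \<Longrightarrow> z \<in> G \<Longrightarrow> (blinfun_apply C (fst z), blinfun_apply C (snd z)) \<in> G"
    using G by (auto simp: iso_graph_def)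
  have ip: "inner (fst z) (fst w) = inner (snd z) (snd w)" if "z \<in> G" "w \<in> G" for z w
    using nG[OF that(1)] nG[OF that(2)] nG[OF subspace_add[OF cG(2) that]]
    by (intro inner_preserved_of_norm_preserved) auto
  define E where "E = Blinfun (\<lambda>x::'h. (x, 0::'h))"
  have E: "blinfun_apply E = (\<lambda>x. (x, 0))"
    unfolding E_def
    by (intro bounded_linear_Blinfun_apply bounded_linear_Pair bounded_linear_ident bounded_linear_zero)
  define P where "P = oproj G"
  have P: "P (x, 0) = ((1/2) *\<^sub>R x, (1/2) *\<^sub>R y)" if xy: "(x, y) \<in> G" for x y
    unfolding P_def
  proof (rule oproj_eqI[OF cG])
    show "((1/2) *\<^sub>R x, (1/2) *\<^sub>R y) \<in> G"
      using subspace_scale[OF cG(2) xy, of "1/2"] by simp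
    show "(x, 0) - ((1/2) *\<^sub>R x, (1/2) *\<^sub>R y) \<in> G\<^sup>\<bottom>"
    proof (rule orthogonal_compI)
      fix w assume "w \<in> G"
      have "x - (1/2) *\<^sub>R x = (1/2) *\<^sub>R x"
        using scaleR_left_diff_distrib[of 1 "1/2" x] by simp
      then show "inner ((x, 0) - ((1/2) *\<^sub>R x, (1/2) *\<^sub>R y)) w = 0"
        using ip[OF xy \<open>w \<in> G\<close>] by (cases w) simp
    qed
  qed
  \<comment> \<open>The graph is invariant under \<open>C\<close> and \<open>adj C\<close> acting on
    both coordinates, so the projection onto it commutes with this action; this is what puts
    \<open>V\<close> into the algebra.\<close>
  have PC: "P (blinfun_apply C x, 0) = (C (fst (P (x, 0))), C (snd (P (x, 0))))" if C: "C \<in> real_commutant" for C x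
    unfolding P_def
  proof (rule oproj_eqI[OF cG])
    let ?z = "oproj G (x, 0)"
    show "(C (fst ?z), C (snd ?z)) \<in> G"
      by (intro iG C oproj_in cG)
    show "(C x, 0) - (C (fst ?z), C (snd ?z)) \<in> G\<^sup>\<bottom>"
    proof (rule orthogonal_compI)
      fix w assume "w \<in> G"
      then have "inner ((x, 0) - ?z) (adj C (fst w), adj C (snd w)) = 0"
        by (intro orthogonal_compD[OF oproj_diff_in[OF cG]] iG adj_commutant C)
      then have "inner (x - fst ?z) (adj C (fst w)) - inner (snd ?z) (adj C (snd w)) = 0"
        by (cases ?z) simp
      then have "inner (C x - C (fst ?z)) (fst w) - inner (C (snd ?z)) (snd w) = 0"
        by (simp only: inner_adj[symmetric] blinfun.diff_right)
      then show "inner ((C x, 0) - (C (fst ?z), C (snd ?z))) w = 0"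
        by (cases w) simp
    qed
  qed
  define V where "V = 2 *\<^sub>R (snd_blinfun o\<^sub>L (P o\<^sub>L E))"
  have V: "V x = 2 *\<^sub>R snd (P (x, 0))" for x
    by (simp add: V_def blinfun.scaleR_left E)
  show ?thesis
  proof
    show "V \<in> \<A>"
      by (rule algebraI) (simp add: V PC blinfun.scaleR_right)
    show "V x = y" if "(x, y) \<in> G" for x y
      by (simp add: V P[OF that])
    \<comment> \<open>Describes the domain as the fixed point set of a continuous map, which shows
      that it is closed.\<close>
    have dom: "x \<in> fst ` G \<longleftrightarrow> 2 *\<^sub>R fst (P (x, 0)) = x" for x
    proof
      assume "x \<in> fst ` G"
      then obtain y where "(x, y) \<in> G" by force
      then show "2 *\<^sub>R fst (P (x, 0)) = x"
        by (simp add: P)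
    next
      assume x: "2 *\<^sub>R fst (P (x, 0)) = x"
      have "2 *\<^sub>R P (x, 0) \<in> G"
        unfolding P_def by (intro subspace_scale oproj_in cG)
      then show "x \<in> fst ` G"
        using x by (metis fst_scaleR image_eqI)
    qed
    have "fst ` G = {x. 2 *\<^sub>R fst (P (E x)) = x}"
      using dom E by auto
    then have "closed (fst ` G)"
      by (auto intro!: closed_Collect_eq continuous_intros)
    moreover have "subspace (fst ` G)"
      by (intro linear_subspace_image bounded_linear.linear bounded_linear_fst cG)
    moreover have "blinfun_apply C x \<in> fst ` G" if "C \<in> real_commutant" "x \<in> fst ` G" for C x
      using iG[OF that(1)] that(2) by force
    ultimately show "affiliated (fst ` G)"
      by (simp add: affiliated_def)
  qed
qed

lemma iso_graph_converse: "iso_graph G \<Longrightarrow> iso_graph (prod.swap ` G)"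
proof -
  assume G: "iso_graph G"
  have eq: "prod.swap ` G = {z. prod.swap z \<in> G}"
    by (auto simp: image_iff) (metis swap_swap swap_simp)
  have "closed (prod.swap -` G)"
    by (rule closed_vimage) (use G in \<open>auto simp: iso_graph_def prod.swap_def intro!: continuous_intros\<close>)
  moreover have "subspace (prod.swap -` G)"
    using G unfolding iso_graph_def subspace_def
    by (auto simp: zero_prod_def prod.swap_def) (metis add_Pair fst_conv snd_conv scaleR_Pair surjective_pairing)+
  ultimately show ?thesis
    using G unfolding iso_graph_def eq vimage_def by (auto simp: prod.swap_def) fastforce
qed

lemma iso_graph_eqv:
  assumes "iso_graph G"
  shows "fst ` G \<simeq> snd ` G"
proof -
  obtain V where V: "V \<in> \<A>" "\<And>x y. (x, y) \<in> G \<Longrightarrow> blinfun_apply V x = y" "affiliated (fst ` G)"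
    using iso_graph_operator[OF assms] by metis
  have "affiliated (fst ` prod.swap ` G)"
    using iso_graph_operator[OF iso_graph_converse[OF assms]] by metis
  then have "affiliated (snd ` G)"
    by (simp add: image_image)
  moreover have "norm (V x) = norm x" if "x \<in> fst ` G" for x
    using that V(2) assms unfolding iso_graph_def by force
  moreover have "blinfun_apply V ` fst ` G = snd ` G"
    using V(2) by (force simp: image_image)
  ultimately show ?thesis
    using V unfolding eqv_def by blast
qed

lemma isometry_graph:
  fixes V :: "'h \<Rightarrow>\<^sub>L 'h"
  assumes V: "V \<in> \<A>" and L: "affiliated L" and iso: "\<And>x. x \<in> L \<Longrightarrow> norm (blinfun_apply V x) = norm x"
  shows "iso_graph ((\<lambda>x. (x, V x)) ` L)"
proof -
  have eq: "(\<lambda>x. (x, V x)) ` L = {z. fst z \<in> L \<and> snd z = V (fst z)}"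
    by (auto simp: image_iff)
  have "closed {z::'h\<times>'h. fst z \<in> L}"
    using closed_vimage[OF affiliatedD(1)[OF L], of fst] by (simp add: vimage_def continuous_on_fst)
  then have "closed {z. fst z \<in> L \<and> snd z = V (fst z)}"
    by (intro closed_Collect_conj closed_Collect_eq continuous_intros)
  moreover have "subspace {z. fst z \<in> L \<and> snd z = V (fst z)}"
    using affiliatedD(2)[OF L]
    by (auto simp: subspace_def blinfun.zero_right blinfun.add_right blinfun.scaleR_right)
  ultimately show ?thesis
    unfolding iso_graph_def eq using iso affiliatedD(3)[OF L] by (auto simp: commutantD[OF _ V])
qed

lemma isometry_eqv:
  assumes "V \<in> \<A>" "affiliated L" "\<And>x. x \<in> L \<Longrightarrow> norm (blinfun_apply V x) = norm x"
  shows "L \<simeq> blinfun_apply V ` L"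
  using iso_graph_eqv[OF isometry_graph[OF assms]] by (simp add: image_image)

lemma eqv_graph:
  assumes "L \<simeq> M"
  obtains G where "iso_graph G" "fst ` G = L" "snd ` G = M"
proof -
  obtain V where "V \<in> \<A>" "\<forall>x\<in>L. norm (blinfun_apply V x) = norm x" "blinfun_apply V ` L = M"
    using assms by (auto simp: eqv_def)
  then show ?thesis
    using isometry_graph[of V L] eqv_affiliated[OF assms] that[of "(\<lambda>x. (x, V x)) ` L"]
    by (auto simp: image_image)
qed

lemma eqv_refl: "affiliated L \<Longrightarrow> L \<simeq> L"
  using isometry_eqv[OF id_in, of L] by simp

lemma eqv_sym: "L \<simeq> M \<Longrightarrow> M \<simeq> L"
  by (erule eqv_graph) (drule iso_graph_converse, drule iso_graph_eqv, simp add: image_image)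

lemma eqv_trans: "L \<simeq> M \<Longrightarrow> M \<simeq> N \<Longrightarrow> L \<simeq> N"
proof -
  assume LM: "L \<simeq> M" and MN: "M \<simeq> N"
  then obtain V W where V: "V \<in> \<A>" "\<forall>x\<in>L. norm (blinfun_apply V x) = norm x" "blinfun_apply V ` L = M"
    and W: "W \<in> \<A>" "\<forall>x\<in>M. norm (blinfun_apply W x) = norm x" "blinfun_apply W ` M = N"
    by (auto simp: eqv_def)
  have "norm ((W o\<^sub>L V) x) = norm x" if "x \<in> L" for x
    using V W that by auto
  moreover have "blinfun_apply (W o\<^sub>L V) ` L = N"
    using V(3) W(3) by (auto simp: image_image)
  ultimately show ?thesis
    using compose_in[OF W(1) V(1)] LM MN unfolding eqv_def by blast
qed

text \<open>Polar decomposition: with \<open>B = \<bar>S P\<^sub>L\<bar>\<close>, the pairs \<open>(B x, S P\<^sub>L x)\<close> are dense in the graph of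
  the partial isometry.\<close>

lemma eqv_if_quasi_affinity:
  fixes S :: "'h \<Rightarrow>\<^sub>L 'h"
  assumes S: "S \<in> \<A>" and L: "affiliated L" and M: "affiliated M"
    and inj: "\<And>x. x \<in> L \<Longrightarrow> S x = 0 \<Longrightarrow> x = 0"
    and sub: "\<And>x. x \<in> L \<Longrightarrow> S x \<in> M"
    and dense: "\<And>z. z \<in> M \<Longrightarrow> (\<And>x. x \<in> L \<Longrightarrow> inner z (S x) = 0) \<Longrightarrow> z = 0"
  shows "L \<simeq> M"
proof -
  define R where "R = S o\<^sub>L oproj L"
  have R: "R \<in> \<A>"
    unfolding R_def by (intro compose_in S oproj_in_algebra L)
  obtain B where B: "adj B = B" "\<And>x. norm (blinfun_apply B x) = norm (R x)"
    and Bc: "\<And>C. C o\<^sub>L (adj R o\<^sub>L R) = (adj R o\<^sub>L R) o\<^sub>L C \<Longrightarrow> C o\<^sub>L B = B o\<^sub>L C"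
    using abs_operator_exists[of R] by metis
  have BA: "B (blinfun_apply C x) = C (B x)" if "C \<in> real_commutant" for C x
  proof -
    have "C o\<^sub>L B = B o\<^sub>L C"
      by (rule Bc) (simp add: blinfun_compose_eq_iff commutantD[OF that] R adj_in)
    then show ?thesis
      by (simp add: blinfun_compose_eq_iff)
  qed
  have ker: "B x = 0 \<longleftrightarrow> oproj L x = 0" for x
  proof -
    have "B x = 0 \<longleftrightarrow> R x = 0"
      using B(2)[of x] by auto
    also have "\<dots> \<longleftrightarrow> oproj L x = 0"
      using inj[OF aff_oproj_in[OF L]] by (auto simp: R_def blinfun.zero_right)
    finally show ?thesis .
  qed
  have BL: "B x \<in> L" for x
  proof -
    have "B x \<in> L\<^sup>\<bottom>\<^sup>\<bottom>"
    proof (rule orthogonal_compI)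
      fix y assume "y \<in> L\<^sup>\<bottom>"
      then have "B y = 0"
        by (simp add: ker aff_oproj_zero[OF L])
      then show "inner (B x) y = 0"
        by (simp add: inner_adj B)
    qed
    then show ?thesis
      by (simp add: aff_comp_comp[OF L])
  qed
  define D where "D = range (\<lambda>x. (B x, R x))"
  have "iso_graph (closure D)"
  proof (rule iso_graphI_closure)
    have "bounded_linear (\<lambda>x. (B x, R x))"
      by (intro bounded_linear_Pair blinfun.bounded_linear_right)
    then show "subspace D"
      unfolding D_def by (intro linear_subspace_image subspace_UNIV bounded_linear.linear)
    show "norm x = norm y" if "(x, y) \<in> D" for x y
      using that B(2) by (auto simp: D_def)
    show "(blinfun_apply C x, blinfun_apply C y) \<in> D" if "C \<in> real_commutant" "(x, y) \<in> D" for C x y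
      using that BA commutantD[OF that(1) R] by (auto simp: D_def image_iff) metis
  qed
  then have eq: "fst ` closure D \<simeq> snd ` closure D"
    by (rule iso_graph_eqv)
  have Dsub: "closure D \<subseteq> L \<times> M"
    using L M sub BL aff_oproj_in[OF L]
    by (intro closure_minimal closed_Times) (auto simp: D_def R_def affiliatedD)
  have inD: "B x \<in> fst ` closure D" "R x \<in> snd ` closure D" for x
    using closure_subset[of D] by (force simp: D_def)+
  \<comment> \<open>\<open>B\<close> is self-adjoint and its kernel is the complement of
    \<open>L\<close>, so its range is dense in \<open>L\<close> and the isometry has full
    domain.\<close>
  have "fst ` closure D = L"
  proof (rule closed_subspace_eqI)
    show "x = 0" if x: "x \<in> L" "x \<in> (fst ` closure D)\<^sup>\<bottom>" for x
    proof -
      have "inner x (B (B x)) = 0"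
        using x(2) inD(1) by (rule orthogonal_compD)
      then have "inner (B x) (B x) = 0"
        by (simp add: inner_adj B)
      then have "oproj L x = 0"
        by (simp flip: ker)
      then show "x = 0"
        using x(1) by (simp add: aff_oproj_ident[OF L])
    qed
  qed (use eqv_affiliated[OF eq] affiliatedD L Dsub in auto)
  moreover have "snd ` closure D = M"
  proof (rule closed_subspace_eqI)
    show "z = 0" if z: "z \<in> M" "z \<in> (snd ` closure D)\<^sup>\<bottom>" for z
    proof (rule dense[OF z(1)])
      fix x assume "x \<in> L"
      then show "inner z (S x) = 0"
        using orthogonal_compD[OF z(2) inD(2)[of x]] by (simp add: R_def aff_oproj_ident[OF L])
    qed
  qed (use eqv_affiliated[OF eq] affiliatedD M Dsub in auto)
  ultimately show ?thesis
    using eq by simp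
qed

text \<open>Polar decomposition of \<open>S\<close> on \<open>L\<close>: off its kernel
  \<open>S\<close> is injective, and what it reaches from there is dense in the closure of the
  image.\<close>

lemma eqv_closure_image:
  fixes S :: "'h \<Rightarrow>\<^sub>L 'h"
  assumes S: "S \<in> \<A>" and L: "affiliated L"
  shows "L \<inter> (L \<inter> {x. S x = 0})\<^sup>\<bottom> \<simeq> closure (blinfun_apply S ` L)"
proof (rule eqv_if_quasi_affinity[OF S])
  let ?N = "L \<inter> {x. S x = 0}"
  have N: "affiliated ?N"
    by (intro affiliated_Int L affiliated_kernel S)
  show "affiliated (L \<inter> ?N\<^sup>\<bottom>)"
    by (intro affiliated_Int L affiliated_comp N)
  show "affiliated (closure (blinfun_apply S ` L))"
    by (intro affiliated_closure_image S L)
  show "x = 0" if "x \<in> L \<inter> ?N\<^sup>\<bottom>" "S x = 0" for x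
    using orthogonal_compD[of x ?N x] that by simp
  show "S x \<in> closure (blinfun_apply S ` L)" if "x \<in> L \<inter> ?N\<^sup>\<bottom>" for x
    using that by (intro subsetD[OF closure_subset]) auto
  show "z = 0" if z: "z \<in> closure (blinfun_apply S ` L)"
    and ort: "\<And>x. x \<in> L \<inter> ?N\<^sup>\<bottom> \<Longrightarrow> inner z (S x) = 0" for z
  proof -
    have "z \<in> (blinfun_apply S ` L)\<^sup>\<bottom>"
    proof (rule orthogonal_compI)
      fix y assume "y \<in> blinfun_apply S ` L"
      then obtain x where x: "x \<in> L" "y = S x" by blast
      have "S (oproj ?N x) = 0" "oproj ?N x \<in> L"
        using aff_oproj_in[OF N] by auto
      moreover have "x - oproj ?N x \<in> L \<inter> ?N\<^sup>\<bottom>"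
        using x aff_oproj_diff_in[OF N] \<open>oproj ?N x \<in> L\<close> affiliatedD(2)[OF L]
        by (auto intro: subspace_diff)
      ultimately show "inner z y = 0"
        using ort[of "x - oproj ?N x"] x by (simp add: blinfun.diff_right)
    qed
    then have "z \<in> (closure (blinfun_apply S ` L))\<^sup>\<bottom>"
      by (simp only: orthogonal_comp_closure)
    then have "inner z z = 0"
      using z by (rule orthogonal_compD)
    then show ?thesis by simp
  qed
qed

text \<open>For subspaces this is the closure of \<open>L + M\<close>; written as a complement, it
  is closed and affiliated without further argument.\<close>

definition join :: "'h set \<Rightarrow> 'h set \<Rightarrow> 'h set" where
  "join L M = (L\<^sup>\<bottom> \<inter> M\<^sup>\<bottom>)\<^sup>\<bottom>"

lemma affiliated_join: "affiliated L \<Longrightarrow> affiliated M \<Longrightarrow> affiliated (join L M)"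
  unfolding join_def by (intro affiliated_comp affiliated_Int)

lemma join_ge: "L \<subseteq> join L M" "M \<subseteq> join L M"
  unfolding join_def by (auto intro!: orthogonal_compI dest: orthogonal_compD')

lemma join_least: "affiliated N \<Longrightarrow> L \<subseteq> N \<Longrightarrow> M \<subseteq> N \<Longrightarrow> join L M \<subseteq> N"
proof -
  assume "affiliated N" "L \<subseteq> N" "M \<subseteq> N"
  then have "N\<^sup>\<bottom> \<subseteq> L\<^sup>\<bottom> \<inter> M\<^sup>\<bottom>"
    by (simp add: orthogonal_comp_anti_mono)
  then have "join L M \<subseteq> N\<^sup>\<bottom>\<^sup>\<bottom>"
    unfolding join_def by (rule orthogonal_comp_anti_mono)
  then show ?thesis
    using \<open>affiliated N\<close> by (simp add: aff_comp_comp)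
qed

text \<open>Kaplansky's parallelogram law. \<open>id_blinfun - oproj Q\<close> is injective on the
  left-hand space, since a vector it kills lies in \<open>P \<inter> Q\<close>, and it has dense
  range in the right-hand one.\<close>

lemma parallelogram_eqv:
  assumes P: "affiliated P" and Q: "affiliated Q"
  shows "P \<inter> (P \<inter> Q)\<^sup>\<bottom> \<simeq> join P Q \<inter> Q\<^sup>\<bottom>"
proof (rule eqv_if_quasi_affinity[of "id_blinfun - oproj Q"])
  let ?S = "id_blinfun - oproj Q"
  have S: "?S x = x - oproj Q x" for x
    by (simp add: blinfun.diff_left)
  have PQ: "affiliated (P \<inter> Q)"
    by (intro affiliated_Int P Q)
  show "?S \<in> \<A>"
    by (intro diff_in id_in oproj_in_algebra Q)
  show "affiliated (P \<inter> (P \<inter> Q)\<^sup>\<bottom>)" "affiliated (join P Q \<inter> Q\<^sup>\<bottom>)"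
    by (intro affiliated_Int affiliated_comp affiliated_join P Q)+
  show "x = 0" if x: "x \<in> P \<inter> (P \<inter> Q)\<^sup>\<bottom>" "?S x = 0" for x
  proof -
    have "x = oproj Q x"
      using x(2) by (simp add: S)
    then have "x \<in> Q"
      using aff_oproj_in[OF Q, of x] by simp
    then show ?thesis
      using x(1) orthogonal_compD[of x "P \<inter> Q" x] by simp
  qed
  show "?S x \<in> join P Q \<inter> Q\<^sup>\<bottom>" if x: "x \<in> P \<inter> (P \<inter> Q)\<^sup>\<bottom>" for x
  proof -
    have "x \<in> join P Q" "oproj Q x \<in> join P Q"
      using x join_ge[of P Q] join_ge[where L = P and M = Q] aff_oproj_in[OF Q] by auto
    then show ?thesis
      using affiliatedD(2)[OF affiliated_join[OF P Q]] aff_oproj_diff_in[OF Q]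
      by (auto simp: S intro: subspace_diff)
  qed
  show "z = 0" if z: "z \<in> join P Q \<inter> Q\<^sup>\<bottom>"
    and ort: "\<And>x. x \<in> P \<inter> (P \<inter> Q)\<^sup>\<bottom> \<Longrightarrow> inner z (?S x) = 0" for z
  proof -
    have zQ: "inner z (oproj Q x) = 0" for x
      using z aff_oproj_in[OF Q] by (auto dest: orthogonal_compD)
    have "z \<in> P\<^sup>\<bottom>"
    proof (rule orthogonal_compI)
      fix x assume x: "x \<in> P"
      define n where "n = oproj (P \<inter> Q) x"
      have n: "n \<in> P" "n \<in> Q"
        using aff_oproj_in[OF PQ, of x] by (auto simp: n_def)
      have "x - n \<in> P \<inter> (P \<inter> Q)\<^sup>\<bottom>"
        using aff_oproj_diff_in[OF PQ] n x affiliatedD(2)[OF P]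
        by (auto simp: n_def intro: subspace_diff)
      then have "inner z (x - n) = 0"
        using ort[of "x - n"] zQ by (simp add: S inner_diff_right)
      moreover have "inner z n = 0"
        using z n by (auto dest: orthogonal_compD)
      ultimately show "inner z x = 0"
        by (simp add: inner_diff_right)
    qed
    then have "z \<in> P\<^sup>\<bottom> \<inter> Q\<^sup>\<bottom>" using z by blast
    then have "inner z z = 0"
      using z unfolding join_def by (auto dest: orthogonal_compD)
    then show ?thesis by simp
  qed
qed

lemma decompose_in:
  assumes "affiliated M" "affiliated L" "M \<subseteq> L" "x \<in> L"
  shows "x - oproj M x \<in> L \<inter> M\<^sup>\<bottom>"
  using assms(3,4) aff_oproj_in[OF assms(1), of x] aff_oproj_diff_in[OF assms(1), of x]
    subspace_diff[OF affiliatedD(2)[OF assms(2)], of x "oproj M x"]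
  by blast

lemma relative_comp_comp:
  assumes "affiliated M" "affiliated L" "M \<subseteq> L"
  shows "L \<inter> (L \<inter> M\<^sup>\<bottom>)\<^sup>\<bottom> = M"
proof (rule sym, rule closed_subspace_eqI)
  show "M \<subseteq> L \<inter> (L \<inter> M\<^sup>\<bottom>)\<^sup>\<bottom>"
    using assms(3) by (auto intro!: orthogonal_compI dest: orthogonal_compD')
  show "x = 0" if "x \<in> L \<inter> (L \<inter> M\<^sup>\<bottom>)\<^sup>\<bottom>" "x \<in> M\<^sup>\<bottom>" for x
    using that orthogonal_compD[of x "L \<inter> M\<^sup>\<bottom>" x] by simp
qed (use assms in \<open>auto simp: affiliatedD affiliated_Int affiliated_comp\<close>)

text \<open>The isometries of the two orthogonal pieces are added; as their images are orthogonal,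
  the sum is isometric by Pythagoras. \<open>K\<close> is the orthogonal sum of \<open>K1\<close>
  and \<open>K2\<close>, described by inclusions.\<close>

lemma eqv_add_into:
  assumes L: "affiliated L" "L1 \<subseteq> L" and 1: "L1 \<simeq> K1" and 2: "L \<inter> L1\<^sup>\<bottom> \<simeq> K2"
    and ort: "K2 \<subseteq> K1\<^sup>\<bottom>" and Q: "affiliated Q" "K1 \<subseteq> Q" "K2 \<subseteq> Q"
  obtains K where "L \<simeq> K" "K \<subseteq> Q" "K1 \<subseteq> K" "K2 \<subseteq> K"
proof -
  obtain V W where V: "V \<in> \<A>" "\<forall>x\<in>L1. norm (blinfun_apply V x) = norm x" "blinfun_apply V ` L1 = K1"
    and W: "W \<in> \<A>" "\<forall>x\<in>L \<inter> L1\<^sup>\<bottom>. norm (blinfun_apply W x) = norm x" "blinfun_apply W ` (L \<inter> L1\<^sup>\<bottom>) = K2"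
    using 1 2 unfolding eqv_def by metis
  have L1: "affiliated L1"
    using 1 by (rule eqv_affiliated)
  define U where "U = (V o\<^sub>L oproj L1) + (W o\<^sub>L (id_blinfun - oproj L1))"
  have U: "U x = V (oproj L1 x) + W (x - oproj L1 x)" for x
    by (simp add: U_def blinfun.add_left blinfun.diff_left)
  have UA: "U \<in> \<A>"
    unfolding U_def by (intro add_in compose_in diff_in V W id_in oproj_in_algebra L1)
  have in1: "oproj L1 x \<in> L1" for x
    by (rule aff_oproj_in[OF L1])
  have in2: "x - oproj L1 x \<in> L \<inter> L1\<^sup>\<bottom>" if "x \<in> L" for x
    by (rule decompose_in[OF L1 L that])
  have "norm (U x) = norm x" if x: "x \<in> L" for x
  proof -
    have "W (x - oproj L1 x) \<in> K1\<^sup>\<bottom>" "V (oproj L1 x) \<in> K1"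
      using in1[of x] in2[OF x] V(3) W(3) ort by blast+
    then have "orthogonal (V (oproj L1 x)) (W (x - oproj L1 x))"
      by (simp add: orthogonal_def orthogonal_compD')
    then have "(norm (U x))\<^sup>2 = (norm (V (oproj L1 x)))\<^sup>2 + (norm (W (x - oproj L1 x)))\<^sup>2"
      unfolding U by (rule norm_add_Pythagorean)
    also have "\<dots> = (norm (oproj L1 x))\<^sup>2 + (norm (x - oproj L1 x))\<^sup>2"
      using in1[of x] in2[OF x] V(2) W(2) by simp
    also have "\<dots> = (norm (oproj L1 x + (x - oproj L1 x)))\<^sup>2"
      using in1[of x] in2[OF x]
      by (intro norm_add_Pythagorean[symmetric]) (auto simp: orthogonal_def dest: orthogonal_compD')
    finally show ?thesis by simp
  qed
  then have "L \<simeq> blinfun_apply U ` L"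
    by (intro isometry_eqv UA L)
  moreover have "blinfun_apply U ` L \<subseteq> Q"
  proof clarify
    fix x assume x: "x \<in> L"
    have "V (oproj L1 x) \<in> Q" "W (x - oproj L1 x) \<in> Q"
      using in1[of x] in2[OF x] V(3) W(3) Q by blast+
    then show "U x \<in> Q"
      using Q by (simp add: U subspace_add affiliatedD)
  qed
  moreover have "K1 \<subseteq> blinfun_apply U ` L"
  proof
    fix y assume "y \<in> K1"
    then obtain x where x: "x \<in> L1" "V x = y" using V(3) by blast
    then have "U x = y"
      by (simp add: U aff_oproj_ident[OF L1] blinfun.zero_right)
    then show "y \<in> blinfun_apply U ` L" using x L by blast
  qed
  moreover have "K2 \<subseteq> blinfun_apply U ` L"
  proof
    fix y assume "y \<in> K2"
    then obtain x where x: "x \<in> L \<inter> L1\<^sup>\<bottom>" "W x = y" using W(3) by blast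
    then have "U x = y"
      by (simp add: U aff_oproj_zero[OF L1] blinfun.zero_right)
    then show "y \<in> blinfun_apply U ` L" using x by blast
  qed
  ultimately show ?thesis
    by (rule that)
qed

section \<open>Subordination and finite subspaces\<close>

definition subeqv :: "'h set \<Rightarrow> 'h set \<Rightarrow> bool" (infix "\<preceq>" 50) where
  "L \<preceq> M \<longleftrightarrow> (\<exists>K. L \<simeq> K \<and> K \<subseteq> M)"

lemma subeqvI: "L \<simeq> K \<Longrightarrow> K \<subseteq> M \<Longrightarrow> L \<preceq> M"
  by (auto simp: subeqv_def)

definition fin :: "'h set \<Rightarrow> bool" where
  "fin L \<longleftrightarrow> affiliated L \<and> (\<forall>M. L \<simeq> M \<and> M \<subseteq> L \<longrightarrow> M = L)"

lemma fin_affiliated: "fin L \<Longrightarrow> affiliated L"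
  by (simp add: fin_def)

lemma isometric_image_restrict:
  assumes "L \<simeq> M"
  obtains V where "V \<in> \<A>" "\<And>x. x \<in> L \<Longrightarrow> norm (blinfun_apply V x) = norm x"
    "blinfun_apply V ` L = M" "inj_on (blinfun_apply V) L"
    "\<And>K. affiliated K \<Longrightarrow> K \<subseteq> L \<Longrightarrow> K \<simeq> blinfun_apply V ` K"
proof -
  obtain V where V: "V \<in> \<A>" "\<And>x. x \<in> L \<Longrightarrow> norm (blinfun_apply V x) = norm x"
    "blinfun_apply V ` L = M"
    using assms by (auto simp: eqv_def)
  have "inj_on (blinfun_apply V) L"
  proof (rule inj_onI)
    fix x y assume "x \<in> L" "y \<in> L" "V x = V y"
    then show "x = y"
      using V(2)[of "x - y"] affiliatedD(2)[OF eqv_affiliated(1)[OF assms]]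
      by (simp add: subspace_diff blinfun.diff_right)
  qed
  then show ?thesis
    using V by (intro that[of V] isometry_eqv) auto
qed

lemma subeqv_mono: "affiliated K \<Longrightarrow> K \<subseteq> L \<Longrightarrow> L \<preceq> M \<Longrightarrow> K \<preceq> M"
proof -
  assume K: "affiliated K" "K \<subseteq> L" and "L \<preceq> M"
  then obtain N where N: "L \<simeq> N" "N \<subseteq> M"
    by (auto simp: subeqv_def)
  obtain V where "blinfun_apply V ` L = N" "K \<simeq> blinfun_apply V ` K"
    using isometric_image_restrict[OF N(1)] K by metis
  then show "K \<preceq> M"
    using K N by (intro subeqvI[of K "blinfun_apply V ` K"]) auto
qed

text \<open>An injective isometry would carry a proper equivalent subspace of \<open>M\<close> to a
  proper equivalent subspace of \<open>L\<close>.\<close>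

lemma fin_eqv: "fin L \<Longrightarrow> L \<simeq> M \<Longrightarrow> fin M"
proof -
  assume L: "fin L" and LM: "L \<simeq> M"
  obtain W where W: "blinfun_apply W ` M = L" "inj_on (blinfun_apply W) M"
    "\<And>K. affiliated K \<Longrightarrow> K \<subseteq> M \<Longrightarrow> K \<simeq> blinfun_apply W ` K"
    using isometric_image_restrict[OF eqv_sym[OF LM]] by metis
  have "N = M" if N: "M \<simeq> N" "N \<subseteq> M" for N
  proof -
    have "N \<simeq> blinfun_apply W ` N"
      using N eqv_affiliated by (intro W(3)) auto
    then have "L \<simeq> blinfun_apply W ` N"
      using eqv_trans[OF eqv_trans[OF LM N(1)]] by blast
    moreover have "blinfun_apply W ` N \<subseteq> L"
      using W(1) N(2) by blast
    ultimately have "blinfun_apply W ` N = blinfun_apply W ` M"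
      using L W(1) by (simp add: fin_def)
    then show "N = M"
      using inj_on_image_eq_iff[OF W(2)] N(2) by blast
  qed
  then show ?thesis
    using LM eqv_affiliated by (simp add: fin_def)
qed

text \<open>An equivalence of \<open>M\<close> with a subspace \<open>N\<close> extends, by the
  identity on the complement of \<open>M\<close> in \<open>L\<close>, to one of \<open>L\<close>
  with a subspace of \<open>L\<close>. Finiteness makes that subspace all of \<open>L\<close>, so no
  nonzero vector of \<open>M\<close> is orthogonal to \<open>N\<close>.\<close>

lemma fin_subset: "fin L \<Longrightarrow> affiliated M \<Longrightarrow> M \<subseteq> L \<Longrightarrow> fin M"
proof -
  assume L: "fin L" and M: "affiliated M" "M \<subseteq> L"
  have affL: "affiliated L"
    using L by (rule fin_affiliated)
  have "N = M" if N: "M \<simeq> N" "N \<subseteq> M" for N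
  proof -
    have affN: "affiliated N"
      using N(1) by (rule eqv_affiliated)
    let ?R = "L \<inter> M\<^sup>\<bottom>"
    have R: "affiliated ?R"
      by (intro affiliated_Int affiliated_comp affL M)
    have "?R \<subseteq> N\<^sup>\<bottom>"
      using orthogonal_comp_anti_mono[OF N(2)] by blast
    then obtain K where K: "L \<simeq> K" "K \<subseteq> join N ?R"
      by (rule eqv_add_into[OF affL M(2) N(1) eqv_refl[OF R] _ affiliated_join[OF affN R] join_ge])
    have "K \<subseteq> L"
      using K(2) join_least[OF affL, of N ?R] N M by blast
    then have "K = L"
      using L K(1) by (simp add: fin_def)
    show "N = M"
    proof (rule closed_subspace_eqI)
      show "x = 0" if x: "x \<in> M" "x \<in> N\<^sup>\<bottom>" for x
      proof -
        have "x \<in> ?R\<^sup>\<bottom>"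
          using x(1) by (auto intro!: orthogonal_compI dest: orthogonal_compD')
        then have "x \<in> N\<^sup>\<bottom> \<inter> ?R\<^sup>\<bottom>"
          using x(2) by blast
        moreover have "x \<in> join N ?R"
          using x(1) M(2) K(2) \<open>K = L\<close> by blast
        ultimately have "inner x x = 0"
          unfolding join_def by (metis orthogonal_compD)
        then show ?thesis by simp
      qed
    qed (use affN M N affiliatedD in auto)
  qed
  then show ?thesis
    using M by (simp add: fin_def)
qed

lemma fin_subeqv: "fin M \<Longrightarrow> L \<preceq> M \<Longrightarrow> fin L"
proof -
  assume M: "fin M" and "L \<preceq> M"
  then obtain K where K: "L \<simeq> K" "K \<subseteq> M"
    by (auto simp: subeqv_def)
  then have "fin K"
    using fin_subset[OF M] eqv_affiliated by blast
  then show "fin L"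
    using fin_eqv eqv_sym[OF K(1)] by blast
qed

section \<open>Comparison of subspaces\<close>

text \<open>The range of a projection in the centre: invariance under the commutant puts the
  projection into \<open>\<A>\<close>, invariance under \<open>\<A>\<close> puts it into the
  commutant.\<close>

definition central :: "'h set \<Rightarrow> bool" where
  "central Z \<longleftrightarrow> affiliated Z \<and> (\<forall>S\<in>\<A>. \<forall>x\<in>Z. blinfun_apply S x \<in> Z)"

lemma central_affiliated: "central Z \<Longrightarrow> affiliated Z"
  by (simp add: central_def)

lemma central_comp: "central Z \<Longrightarrow> central (Z\<^sup>\<bottom>)"
proof -
  assume Z: "central Z"
  have "blinfun_apply S x \<in> Z\<^sup>\<bottom>" if "S \<in> \<A>" "x \<in> Z\<^sup>\<bottom>" for S x
  proof (rule orthogonal_compI)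
    fix y assume "y \<in> Z"
    then have "adj S y \<in> Z"
      using Z adj_in[OF that(1)] by (simp add: central_def)
    then show "inner (S x) y = 0"
      using orthogonal_compD[OF that(2)] by (simp add: inner_adj)
  qed
  then show ?thesis
    using Z by (simp add: central_def affiliated_comp)
qed

lemma central_oproj_commutant: "central Z \<Longrightarrow> oproj Z \<in> real_commutant"
proof -
  assume Z: "central Z"
  have "blinfun_apply S (oproj Z x) = oproj Z (S x)" if "S \<in> \<A>" for S x
    using Z that adj_in[OF that]
    by (intro oproj_commute[where D = "adj S"]) (auto simp: central_def affiliatedD inner_adj)
  then show ?thesis
    by (simp add: real_commutant_def blinfun_compose_eq_iff)
qed

lemma central_oproj_in: "central Z \<Longrightarrow> affiliated L \<Longrightarrow> x \<in> L \<Longrightarrow> oproj Z x \<in> Z \<inter> L"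
  using aff_oproj_in[OF central_affiliated] affiliatedD(3)[OF _ central_oproj_commutant] by blast

text \<open>A central projection commutes with all projections of the algebra, so cutting down by
  \<open>Z\<close> distributes over relative complements.\<close>

lemma central_Int_comp:
  assumes Z: "central Z" and M: "affiliated M"
  shows "(Z \<inter> L) \<inter> (Z \<inter> M)\<^sup>\<bottom> = Z \<inter> (L \<inter> M\<^sup>\<bottom>)"
proof
  show "Z \<inter> (L \<inter> M\<^sup>\<bottom>) \<subseteq> (Z \<inter> L) \<inter> (Z \<inter> M)\<^sup>\<bottom>"
    by (auto intro!: orthogonal_compI dest: orthogonal_compD)
  show "(Z \<inter> L) \<inter> (Z \<inter> M)\<^sup>\<bottom> \<subseteq> Z \<inter> (L \<inter> M\<^sup>\<bottom>)"
  proof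
    fix x assume x: "x \<in> (Z \<inter> L) \<inter> (Z \<inter> M)\<^sup>\<bottom>"
    have "x \<in> M\<^sup>\<bottom>"
    proof (rule orthogonal_compI)
      fix y assume "y \<in> M"
      have "inner x y = inner (oproj Z x) y"
        using x by (simp add: aff_oproj_ident[OF central_affiliated[OF Z]])
      also have "\<dots> = inner x (oproj Z y)"
        by (rule aff_oproj_selfadjoint[OF central_affiliated[OF Z]])
      also have "\<dots> = 0"
        using x central_oproj_in[OF Z M \<open>y \<in> M\<close>] by (auto dest: orthogonal_compD)
      finally show "inner x y = 0" .
    qed
    with x show "x \<in> Z \<inter> (L \<inter> M\<^sup>\<bottom>)" by blast
  qed
qed

text \<open>The isometry belongs to the algebra and thus preserves both \<open>Z\<close> and its
  complement. If its value lies in \<open>Z\<close>, the component of the argument outside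
  \<open>Z\<close> is mapped to zero.\<close>

lemma eqv_central_Int:
  assumes Z: "central Z" and LM: "L \<simeq> M"
  shows "Z \<inter> L \<simeq> Z \<inter> M"
proof -
  have affL: "affiliated L" and affZ: "affiliated Z"
    using LM Z eqv_affiliated central_affiliated by blast+
  obtain V where V: "V \<in> \<A>" "\<And>x. x \<in> L \<Longrightarrow> norm (blinfun_apply V x) = norm x"
    "blinfun_apply V ` L = M"
    using LM by (auto simp: eqv_def)
  have "Z \<inter> L \<simeq> blinfun_apply V ` (Z \<inter> L)"
    using V by (intro isometry_eqv affiliated_Int affL affZ) auto
  also have "blinfun_apply V ` (Z \<inter> L) = Z \<inter> M"
  proof
    show "blinfun_apply V ` (Z \<inter> L) \<subseteq> Z \<inter> M"
      using V Z by (auto simp: central_def)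
    show "Z \<inter> M \<subseteq> blinfun_apply V ` (Z \<inter> L)"
    proof
      fix y assume y: "y \<in> Z \<inter> M"
      then obtain x where x: "x \<in> L" "y = V x" using V(3) by blast
      let ?z = "oproj Z x"
      have z: "?z \<in> Z" "?z \<in> L"
        using central_oproj_in[OF Z affL x(1)] by auto
      have "V (x - ?z) \<in> Z"
        using y x z Z V(1) affiliatedD(2)[OF affZ]
        by (auto simp: blinfun.diff_right central_def intro!: subspace_diff)
      moreover have "V (x - ?z) \<in> Z\<^sup>\<bottom>"
        using central_comp[OF Z] V(1) aff_oproj_diff_in[OF affZ] by (auto simp: central_def)
      ultimately have "inner (V (x - ?z)) (V (x - ?z)) = 0"
        by (metis orthogonal_compD)
      then have "norm (x - ?z) = 0"
        using V(2)[of "x - ?z"] x z affiliatedD(2)[OF affL] by (simp add: subspace_diff)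
      then show "y \<in> blinfun_apply V ` (Z \<inter> L)"
        using x z by auto
    qed
  qed
  finally show ?thesis .
qed

lemma affiliated_closure_span:
  assumes "\<And>C x. C \<in> real_commutant \<Longrightarrow> x \<in> X \<Longrightarrow> blinfun_apply C x \<in> X"
  shows "affiliated (closure (span X))"
proof (rule affiliated_closure[OF subspace_span])
  fix C x assume C: "C \<in> real_commutant" and x: "x \<in> span X"
  show "C x \<in> span X"
    using x
  proof (rule span_induct)
    show "subspace {x. blinfun_apply C x \<in> span X}"
      by (auto simp: subspace_def blinfun.zero_right blinfun.add_right blinfun.scaleR_right
          span_zero intro: span_add span_scale)
    show "C x \<in> span X" if "x \<in> X" for x
      using assms[OF C that] by (rule span_base)
  qed
qed

lemma closure_span_minimal: "X \<subseteq> L \<Longrightarrow> closed L \<Longrightarrow> subspace L \<Longrightarrow> closure (span X) \<subseteq> L"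
  by (intro closure_minimal span_minimal)

text \<open>Encoding partial isometries as graphs turns extension into inclusion of sets, the order
  used in Zorn's lemma.\<close>

definition partial_matchings :: "'h set \<Rightarrow> 'h set \<Rightarrow> ('h \<times> 'h) set set" where
  "partial_matchings E F = {G. iso_graph G \<and> G \<subseteq> E \<times> F}"

lemma maximal_matching_exists:
  assumes E: "affiliated E" and F: "affiliated F"
  obtains G where "G \<in> partial_matchings E F"
    "\<And>G'. G' \<in> partial_matchings E F \<Longrightarrow> G \<subseteq> G' \<Longrightarrow> G' = G"
proof -
  have "\<exists>U\<in>partial_matchings E F. \<forall>X\<in>\<C>. X \<subseteq> U"
    if chain: "subset.chain (partial_matchings E F) \<C>" for \<C>
  proof -
    \<comment> \<open>The zero pair makes \<open>D\<close> a subspace even for the empty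
      chain.\<close>
    define D where "D = insert 0 (\<Union>\<C>)"
    have graph: "iso_graph G" "G \<subseteq> E \<times> F" if "G \<in> \<C>" for G
      using that chain by (auto simp: subset.chain_def partial_matchings_def)
    have nest: "G \<subseteq> H \<or> H \<subseteq> G" if "G \<in> \<C>" "H \<in> \<C>" for G H
      using that chain by (auto simp: subset.chain_def)
    have sub: "subspace G" if "G \<in> \<C>" for G
      using graph[OF that] by (simp add: iso_graph_def)
    have "subspace D"
      unfolding subspace_def
    proof (intro conjI ballI allI)
      show "x + y \<in> D" if xy: "x \<in> D" "y \<in> D" for x y
      proof (cases "x = 0 \<or> y = 0")
        case False
        then obtain G H where GH: "G \<in> \<C>" "x \<in> G" "H \<in> \<C>" "y \<in> H"
          using xy by (auto simp: D_def)
        then obtain K where "K \<in> \<C>" "x \<in> K" "y \<in> K"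
          using nest[of G H] by blast
        then have "x + y \<in> K"
          using sub by (auto intro: subspace_add)
        then show ?thesis
          using \<open>K \<in> \<C>\<close> by (auto simp: D_def)
      qed (use xy in auto)
      show "c *\<^sub>R x \<in> D" if "x \<in> D" for c x
        using that sub subspace_scale[of _ x c] by (auto simp: D_def)
    qed (simp add: D_def)
    then have "iso_graph (closure D)"
    proof (rule iso_graphI_closure)
      show "norm x = norm y" if xy: "(x, y) \<in> D" for x y
      proof (cases "(x, y) = 0")
        case False
        then obtain G where "G \<in> \<C>" "(x, y) \<in> G"
          using xy by (auto simp: D_def)
        then show ?thesis
          using graph(1)[of G] by (auto simp: iso_graph_def)
      qed (simp add: zero_prod_def)
      show "(blinfun_apply C x, blinfun_apply C y) \<in> D"
        if C: "C \<in> real_commutant" and xy: "(x, y) \<in> D" for C x y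
      proof (cases "(x, y) = 0")
        case False
        then obtain G where "G \<in> \<C>" "(x, y) \<in> G"
          using xy by (auto simp: D_def)
        then show ?thesis
          using graph(1)[of G] C by (force simp: iso_graph_def D_def)
      qed (simp add: zero_prod_def blinfun.zero_right D_def)
    qed
    moreover have "closure D \<subseteq> E \<times> F"
    proof (rule closure_minimal)
      show "D \<subseteq> E \<times> F"
        using graph affiliatedD(2)[OF E] affiliatedD(2)[OF F] by (auto simp: D_def subspace_0 zero_prod_def)
    qed (intro closed_Times affiliatedD E F)
    moreover have "X \<subseteq> closure D" if "X \<in> \<C>" for X
      using that closure_subset[of D] by (auto simp: D_def)
    ultimately show ?thesis
      by (auto simp: partial_matchings_def)
  qed
  from subset_Zorn[of "partial_matchings E F", OF this] show ?thesis
    using that by blast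
qed

text \<open>Otherwise \<open>S\<close>, the compression of \<open>a\<close> to the two remainders,
  would be nonzero, and the partial isometry of its polar decomposition could be added orthogonally
  to \<open>G\<close>, against maximality.\<close>

lemma maximal_matching_remainder:
  assumes E: "affiliated E" and F: "affiliated F" and G: "G \<in> partial_matchings E F"
    and max: "\<And>G'. G' \<in> partial_matchings E F \<Longrightarrow> G \<subseteq> G' \<Longrightarrow> G' = G"
    and a: "a \<in> \<A>" and x: "x \<in> E \<inter> (fst ` G)\<^sup>\<bottom>" and y: "y \<in> F \<inter> (snd ` G)\<^sup>\<bottom>"
  shows "inner (blinfun_apply a x) y = 0"
proof -
  let ?E0 = "E \<inter> (fst ` G)\<^sup>\<bottom>" and ?F0 = "F \<inter> (snd ` G)\<^sup>\<bottom>"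
  have iG: "iso_graph G" "G \<subseteq> E \<times> F"
    using G by (auto simp: partial_matchings_def)
  have aff: "affiliated ?E0" "affiliated ?F0"
    using eqv_affiliated[OF iso_graph_eqv[OF iG(1)]]
    by (auto intro!: affiliated_Int affiliated_comp E F)
  define S where "S = oproj ?F0 o\<^sub>L a"
  have S: "S \<in> \<A>"
    unfolding S_def by (intro compose_in oproj_in_algebra aff a)
  obtain H where H: "iso_graph H" "fst ` H = ?E0 \<inter> (?E0 \<inter> {x. blinfun_apply S x = 0})\<^sup>\<bottom>"
    "snd ` H = closure (blinfun_apply S ` ?E0)"
    using eqv_graph[OF eqv_closure_image[OF S aff(1)]] by metis
  have F2: "snd ` H \<subseteq> ?F0"
    unfolding H(3) by (rule closure_minimal) (auto simp: S_def aff_oproj_in[OF aff(2)] affiliatedD aff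
        intro: subsetD[OF _ aff_oproj_in[OF aff(2)]])
  define D where "D = {g + h | g h. g \<in> G \<and> h \<in> H}"
  have "iso_graph (closure D)"
  proof (rule iso_graphI_closure)
    have "subspace {g + h | g h. g \<in> G \<and> h \<in> H}"
      by (rule subspace_sums) (use iG H in \<open>auto simp: iso_graph_def\<close>)
    then show "subspace D" by (simp add: D_def)
    show "norm u = norm v" if uv: "(u, v) \<in> D" for u v
    proof -
      obtain g h where gh: "g \<in> G" "h \<in> H" "u = fst g + fst h" "v = snd g + snd h"
        using uv by (auto simp: D_def plus_prod_def)
      have "fst h \<in> (fst ` G)\<^sup>\<bottom>" "snd h \<in> (snd ` G)\<^sup>\<bottom>"
        using gh(2) H(2) F2 by blast+
      then have "orthogonal (fst g) (fst h)" "orthogonal (snd g) (snd h)"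
        using gh(1) by (auto simp: orthogonal_def dest: orthogonal_compD')
      then have "(norm u)\<^sup>2 = (norm (fst g))\<^sup>2 + (norm (fst h))\<^sup>2"
        "(norm v)\<^sup>2 = (norm (snd g))\<^sup>2 + (norm (snd h))\<^sup>2"
        unfolding gh by (auto intro: norm_add_Pythagorean)
      then have "(norm u)\<^sup>2 = (norm v)\<^sup>2"
        using gh(1,2) iG H by (simp add: iso_graph_def)
      then show ?thesis
        by simp
    qed
    show "(blinfun_apply C u, blinfun_apply C v) \<in> D" if C: "C \<in> real_commutant" and uv: "(u, v) \<in> D" for C u v
    proof -
      obtain g h where gh: "g \<in> G" "h \<in> H" "u = fst g + fst h" "v = snd g + snd h"
        using uv by (auto simp: D_def plus_prod_def)
      then have "(C u, C v) = (C (fst g), C (snd g)) + (C (fst h), C (snd h))"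
        by (simp add: blinfun.add_right)
      moreover have "(C (fst g), C (snd g)) \<in> G" "(C (fst h), C (snd h)) \<in> H"
        using gh C iG H by (auto simp: iso_graph_def)
      ultimately show ?thesis
        unfolding D_def by blast
    qed
  qed
  moreover have "closure D \<subseteq> E \<times> F"
  proof (rule closure_minimal)
    have "H \<subseteq> E \<times> F"
      using H(2) F2 by (auto simp: subset_iff image_iff) (metis IntE fst_conv imageI snd_conv)+
    then show "D \<subseteq> E \<times> F"
      using iG affiliatedD(2)[OF E] affiliatedD(2)[OF F] unfolding D_def
      by (auto simp: subset_iff intro!: subspace_add)
  qed (intro closed_Times affiliatedD E F)
  moreover have GD: "G \<subseteq> D" "H \<subseteq> D"
    using iG H subspace_0[of G] subspace_0[of H] unfolding D_def iso_graph_def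
    by (metis (mono_tags, lifting) add.right_neutral add.left_neutral mem_Collect_eq subsetI)+
  ultimately have "closure D = G"
    using max[of "closure D"] closure_subset[of D] by (auto simp: partial_matchings_def)
  \<comment> \<open>By maximality \<open>H\<close> already lies in \<open>G\<close>, so
    \<open>S x\<close> belongs to the second projection of \<open>G\<close> and is orthogonal to
    it.\<close>
  then have "snd ` H \<subseteq> snd ` G"
    using GD(2) closure_subset[of D] by blast
  moreover have "S x \<in> snd ` H"
    unfolding H(3) by (rule subsetD[OF closure_subset]) (use x in blast)
  ultimately have "S x \<in> snd ` G" "S x \<in> (snd ` G)\<^sup>\<bottom>"
    using F2 by blast+
  then have "inner (S x) (S x) = 0"
    by (metis orthogonal_compD)
  moreover have "inner (S x) y = inner (a x) y"
    using y by (simp add: S_def aff_oproj_selfadjoint[OF aff(2)] aff_oproj_ident[OF aff(2)])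
  ultimately show ?thesis
    by simp
qed

text \<open>The part of \<open>x\<close> outside \<open>M\<close> is orthogonal to \<open>Z\<close>,
  hence to \<open>x\<close>, and also to the projection of \<open>x\<close> onto \<open>M\<close>;
  so it is orthogonal to itself.\<close>

lemma Int_subset_if_remainder_orthogonal:
  assumes M: "affiliated M" and L: "affiliated L" "M \<subseteq> L" and ort: "L \<inter> M\<^sup>\<bottom> \<subseteq> Z\<^sup>\<bottom>"
  shows "Z \<inter> L \<subseteq> M"
proof
  fix x assume x: "x \<in> Z \<inter> L"
  have e: "x - oproj M x \<in> L \<inter> M\<^sup>\<bottom>"
    using decompose_in[OF M L] x by blast
  then have "inner (x - oproj M x) x = 0"
    using ort x by (auto dest: orthogonal_compD)
  moreover have "inner (x - oproj M x) (oproj M x) = 0"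
    using e aff_oproj_in[OF M] by (auto dest: orthogonal_compD)
  ultimately have "inner (x - oproj M x) (x - oproj M x) = 0"
    by (simp add: inner_diff_right)
  then have "x = oproj M x" by simp
  then show "x \<in> M"
    using aff_oproj_in[OF M, of x] by simp
qed

text \<open>\<open>Z\<close> is the central support of what a maximal matching leaves over in
  \<open>F\<close>: the closed span of its images under \<open>\<A>\<close>. What is left over in
  \<open>E\<close> is orthogonal to \<open>Z\<close>, so \<open>E\<close> is fully matched inside
  \<open>Z\<close> and \<open>F\<close> is fully matched outside.\<close>

lemma comparison:
  assumes E: "affiliated E" and F: "affiliated F"
  obtains Z where "central Z" "Z \<inter> E \<preceq> F" "Z\<^sup>\<bottom> \<inter> F \<preceq> E"
proof -
  obtain G where G: "G \<in> partial_matchings E F"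
    and max: "\<And>G'. G' \<in> partial_matchings E F \<Longrightarrow> G \<subseteq> G' \<Longrightarrow> G' = G"
    using maximal_matching_exists[OF E F] by metis
  let ?E1 = "fst ` G" and ?F1 = "snd ` G"
  let ?E0 = "E \<inter> ?E1\<^sup>\<bottom>" and ?F0 = "F \<inter> ?F1\<^sup>\<bottom>"
  have eqv: "?E1 \<simeq> ?F1" and sub: "?E1 \<subseteq> E" "?F1 \<subseteq> F"
    using G iso_graph_eqv by (auto simp: partial_matchings_def)
  then have aff1: "affiliated ?E1" "affiliated ?F1"
    using eqv_affiliated by blast+
  then have affF0: "affiliated ?F0"
    by (intro affiliated_Int affiliated_comp F)
  define X where "X = {blinfun_apply a y | a y. a \<in> \<A> \<and> y \<in> ?F0}"
  define Z where "Z = closure (span X)"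
  have XZ: "X \<subseteq> Z"
    unfolding Z_def using span_superset closure_subset by blast
  have affZ: "affiliated Z"
    unfolding Z_def
  proof (rule affiliated_closure_span)
    show "C x \<in> X" if C: "C \<in> real_commutant" and "x \<in> X" for C x
    proof -
      obtain a y where x: "x = blinfun_apply a y" "a \<in> \<A>" "y \<in> ?F0"
        using \<open>x \<in> X\<close> unfolding X_def by blast
      then have "C x = a (C y)" "C y \<in> ?F0"
        using commutantD[OF C] affiliatedD(3)[OF affF0 C] by auto
      then show ?thesis
        unfolding X_def using x by blast
    qed
  qed
  have "blinfun_apply S z \<in> Z" if S: "S \<in> \<A>" and z: "z \<in> Z" for S z
  proof -
    have "Z \<subseteq> {z. blinfun_apply S z \<in> Z}"
      unfolding Z_def
    proof (rule closure_span_minimal; fold Z_def)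
      show "X \<subseteq> {z. blinfun_apply S z \<in> Z}"
      proof
        fix x assume "x \<in> X"
        then obtain a y where x: "x = blinfun_apply a y" "a \<in> \<A>" "y \<in> ?F0"
          unfolding X_def by blast
        then have "S x = (S o\<^sub>L a) y" by simp
        then have "S x \<in> X"
          unfolding X_def using compose_in[OF S] x by blast
        then show "x \<in> {z. blinfun_apply S z \<in> Z}" using XZ by blast
      qed
    qed (intro closed_blinfun_preimage subspace_blinfun_preimage affiliatedD affZ)+
    with z show ?thesis by blast
  qed
  then have Z: "central Z"
    using affZ by (simp add: central_def)
  have F0: "?F0 \<subseteq> Z"
  proof
    fix y assume "y \<in> ?F0"
    then have "id_blinfun y \<in> X"
      unfolding X_def using id_in by blast
    then show "y \<in> Z" using XZ by auto
  qed
  have E0: "?E0 \<subseteq> Z\<^sup>\<bottom>"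
  proof
    fix x assume x: "x \<in> ?E0"
    have "x \<in> X\<^sup>\<bottom>"
    proof (rule orthogonal_compI)
      fix w assume "w \<in> X"
      then obtain a y where w: "w = blinfun_apply a y" "a \<in> \<A>" "y \<in> ?F0"
        unfolding X_def by blast
      show "inner x w = 0"
        using maximal_matching_remainder[OF E F G max adj_in[OF w(2)] x w(3)]
        by (simp add: w(1) inner_adj')
    qed
    then have "X \<subseteq> {x}\<^sup>\<bottom>"
      by (auto intro!: orthogonal_compI dest: orthogonal_compD')
    then have "Z \<subseteq> {x}\<^sup>\<bottom>"
      unfolding Z_def
      by (intro closure_span_minimal closed_orthogonal_comp subspace_orthogonal_comp)
    then show "x \<in> Z\<^sup>\<bottom>"
      by (auto intro!: orthogonal_compI dest!: subsetD orthogonal_compD')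
  qed
  have ZE: "Z \<inter> E \<subseteq> ?E1"
    by (rule Int_subset_if_remainder_orthogonal[OF aff1(1) E sub(1) E0])
  have "?F0 \<subseteq> Z\<^sup>\<bottom>\<^sup>\<bottom>"
    using F0 orthogonal_comp_subset by blast
  then have ZF: "Z\<^sup>\<bottom> \<inter> F \<subseteq> ?F1"
    by (rule Int_subset_if_remainder_orthogonal[OF aff1(2) F sub(2)])
  show ?thesis
  proof
    show "Z \<inter> E \<preceq> F"
      by (rule subeqv_mono[OF _ ZE subeqvI[OF eqv sub(2)]]) (intro affiliated_Int affZ E)
    show "Z\<^sup>\<bottom> \<inter> F \<preceq> E"
      by (rule subeqv_mono[OF _ ZF subeqvI[OF eqv_sym[OF eqv] sub(1)]])
        (intro affiliated_Int affiliated_comp affZ F)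
  qed (rule Z)
qed

end

section \<open>Sums of finite subspaces\<close>

context real_vna
begin

text \<open>\<open>Z \<inter> G\<close> is split along \<open>P\<close>. The part in
  \<open>P\<close> is placed by hypothesis orthogonally to both \<open>G\<close> and
  \<open>P\<close>; the rest goes, by the parallelogram law, into the join of \<open>G\<close> and
  \<open>P\<close>, off \<open>P\<close>. The two targets are orthogonal.\<close>

lemma subeqv_relative_comp:
  assumes E: "affiliated E" and P: "affiliated P" and G: "affiliated G" "G \<subseteq> E" and "P \<subseteq> E"
    and Z: "central Z" and le: "Z \<inter> (G \<inter> P) \<preceq> (E \<inter> G\<^sup>\<bottom>) \<inter> (E \<inter> P\<^sup>\<bottom>)"
  shows "Z \<inter> G \<preceq> E \<inter> P\<^sup>\<bottom>"
proof -
  have affZ: "affiliated Z"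
    using Z by (rule central_affiliated)
  obtain K1 where K1: "Z \<inter> (G \<inter> P) \<simeq> K1" "K1 \<subseteq> (E \<inter> G\<^sup>\<bottom>) \<inter> (E \<inter> P\<^sup>\<bottom>)"
    using le by (auto simp: subeqv_def)
  let ?K2 = "Z \<inter> (join G P \<inter> P\<^sup>\<bottom>)"
  have "Z \<inter> (G \<inter> (G \<inter> P)\<^sup>\<bottom>) \<simeq> ?K2"
    by (intro eqv_central_Int Z parallelogram_eqv G P)
  then have eqv2: "(Z \<inter> G) \<inter> (Z \<inter> (G \<inter> P))\<^sup>\<bottom> \<simeq> ?K2"
    by (simp only: central_Int_comp[OF Z affiliated_Int[OF G(1) P]])
  have "join G P \<subseteq> E"
    by (intro join_least E G assms)
  then have K2: "?K2 \<subseteq> E \<inter> P\<^sup>\<bottom>"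
    by blast
  have ort: "?K2 \<subseteq> K1\<^sup>\<bottom>"
  proof
    fix y assume y: "y \<in> ?K2"
    show "y \<in> K1\<^sup>\<bottom>"
    proof (rule orthogonal_compI)
      fix k assume "k \<in> K1"
      then have "k \<in> G\<^sup>\<bottom> \<inter> P\<^sup>\<bottom>"
        using K1(2) by blast
      moreover have "y \<in> (G\<^sup>\<bottom> \<inter> P\<^sup>\<bottom>)\<^sup>\<bottom>"
        using y by (simp add: join_def)
      ultimately show "inner y k = 0"
        by (rule orthogonal_compD[rotated])
    qed
  qed
  have sub: "Z \<inter> (G \<inter> P) \<subseteq> Z \<inter> G" "K1 \<subseteq> E \<inter> P\<^sup>\<bottom>"
    using K1(2) by blast+
  obtain K where "Z \<inter> G \<simeq> K" "K \<subseteq> E \<inter> P\<^sup>\<bottom>"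
    by (rule eqv_add_into[OF affiliated_Int[OF affZ G(1)] sub(1) K1(1) eqv2 ort
        affiliated_Int[OF E affiliated_comp[OF P]] sub(2) K2])
  then show ?thesis
    by (rule subeqvI)
qed

lemma fin_invariant_image:
  assumes L: "fin L" and V: "V \<in> \<A>" and iso: "\<And>x. x \<in> L \<Longrightarrow> norm (blinfun_apply V x) = norm x"
    and sub: "\<And>x. x \<in> L \<Longrightarrow> V x \<in> L"
  shows "blinfun_apply V ` L = L"
  using isometry_eqv[OF V fin_affiliated[OF L] iso] L sub by (auto simp: fin_def)

text \<open>An isometry \<open>V\<close> of \<open>E\<close> onto a proper subspace produces equivalent orthogonal subspaces
  \<open>G\<close> and \<open>V G\<close> of \<open>E\<close>, where \<open>V\<^sup>2\<close> maps \<open>G\<close> properly into itself. Comparison of \<open>G \<inter> P\<close> with the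
  part of \<open>E \<inter> P\<^sup>\<bottom>\<close> orthogonal to \<open>G\<close> then makes a central part of \<open>G\<close> subordinate to one of
  the two summands and the complementary part of \<open>V G\<close> to the other one.\<close>

lemma fin_sum:
  assumes E: "affiliated E" and PE: "P \<subseteq> E" and P: "fin P" and Q: "fin (E \<inter> P\<^sup>\<bottom>)"
  shows "fin E"
  unfolding fin_def
proof (intro conjI allI impI E)
  fix E0 assume asm: "E \<simeq> E0 \<and> E0 \<subseteq> E"
  have affP: "affiliated P" and affE0: "affiliated E0"
    using P fin_affiliated asm eqv_affiliated by blast+
  obtain V where V: "V \<in> \<A>" "\<And>x. x \<in> E \<Longrightarrow> norm (blinfun_apply V x) = norm x"
    "blinfun_apply V ` E = E0"
    using asm unfolding eqv_def by metis
  have VE0: "blinfun_apply V x \<in> E0" if "x \<in> E" for x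
    using V(3) that by blast
  have VE: "blinfun_apply V x \<in> E" if "x \<in> E" for x
    using VE0[OF that] asm by blast
  have Vip: "inner (blinfun_apply V x) (V y) = inner x y" if "x \<in> E" "y \<in> E" for x y
    using that V(2) subspace_add[OF affiliatedD(2)[OF E] that]
    by (intro inner_preserved_of_norm_preserved) (auto simp flip: blinfun.add_right)
  \<comment> \<open>The wandering subspace of \<open>V\<close> on \<open>E\<close>: its images under
    distinct powers of \<open>V\<close> are orthogonal (\<open>Uort\<close>), and the claim amounts
    to \<open>W\<close> being zero.\<close>
  define W where "W = E \<inter> E0\<^sup>\<bottom>"
  have affW: "affiliated W"
    unfolding W_def by (intro affiliated_Int affiliated_comp E affE0)
  define U where "U = (\<lambda>n. blinfun_apply V ^^ n)"
  have U0: "U 0 x = x" and US: "U (Suc n) x = V (U n x)" for n x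
    by (simp_all add: U_def)
  have UE: "U n x \<in> E" if "x \<in> E" for n x
    using that VE by (induction n) (simp_all add: U0 US)
  have Uort: "inner (U i w) (U j w') = 0" if "i \<noteq> j" "w \<in> W" "w' \<in> W" for i j w w'
  proof -
    have *: "inner (U i w) (U (i + Suc k) w') = 0" if "w \<in> W" "w' \<in> W" for i k w w'
    proof (induction i)
      case 0
      have "U (Suc k) w' \<in> E0"
        using that(2) UE VE0 by (simp add: US W_def)
      then show ?case
        using that(1) by (auto simp: U0 W_def dest: orthogonal_compD)
    next
      case (Suc i)
      have "w \<in> E" "w' \<in> E"
        using that by (simp_all add: W_def)
      then have "inner (V (U i w)) (V (U (i + Suc k) w')) = inner (U i w) (U (i + Suc k) w')"
        by (intro Vip UE)
      with Suc show ?case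
        by (simp add: US)
    qed
    show ?thesis
    proof (cases "i < j")
      case True
      then obtain k where "j = i + Suc k"
        using less_imp_Suc_add by auto
      then show ?thesis
        using * that by simp
    next
      case False
      with \<open>i \<noteq> j\<close> have "j < i"
        by simp
      then obtain k where "i = j + Suc k"
        using less_imp_Suc_add by auto
      then show ?thesis
        using *[of w' w j k] that by (simp add: inner_commute)
    qed
  qed
  \<comment> \<open>Even powers only: \<open>V\<close> sends these generators to odd powers, which
    are orthogonal to \<open>G\<close>, while applying \<open>V\<close> twice stays in
    \<open>G\<close>.\<close>
  define X where "X = {U (2 * k) w | k w. w \<in> W}"
  define G where "G = closure (span X)"
  have XG: "X \<subseteq> G"
    unfolding G_def using span_superset closure_subset by blast
  have affG: "affiliated G"
    unfolding G_def
  proof (rule affiliated_closure_span)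
    fix C x assume C: "C \<in> real_commutant" and "x \<in> X"
    then obtain k w where x: "x = U (2 * k) w" "w \<in> W"
      unfolding X_def by blast
    have "blinfun_apply C (U n w) = U n (C w)" for n
      by (induction n) (simp_all add: U0 US commutantD[OF C V(1)])
    then show "blinfun_apply C x \<in> X"
      unfolding X_def using x affiliatedD(3)[OF affW C] by auto
  qed
  have GE: "G \<subseteq> E"
    unfolding G_def
    by (rule closure_span_minimal) (use UE E in \<open>auto simp: X_def W_def affiliatedD\<close>)
  have WG: "W \<subseteq> G"
  proof
    fix w assume "w \<in> W"
    then have "U (2 * 0) w \<in> X"
      unfolding X_def by blast
    then show "w \<in> G" using XG by (auto simp: U0)
  qed
  note preimage = closed_blinfun_preimage subspace_blinfun_preimage
  have VVG: "V (V x) \<in> G" if "x \<in> G" for x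
  proof -
    have "G \<subseteq> {x. V x \<in> {x. V x \<in> G}}"
      unfolding G_def
    proof (rule closure_span_minimal; fold G_def)
      show "X \<subseteq> {x. V x \<in> {x. V x \<in> G}}"
      proof
        fix x assume "x \<in> X"
        then obtain k w where x: "x = U (2 * k) w" "w \<in> W"
          unfolding X_def by blast
        then have "V (V x) = U (2 * Suc k) w"
          by (simp add: US)
        then have "V (V x) \<in> X"
          unfolding X_def using x by blast
        then show "x \<in> {x. V x \<in> {x. V x \<in> G}}"
          using XG by auto
      qed
    qed (intro preimage affiliatedD affG)+
    then show ?thesis using that by blast
  qed
  have VG: "blinfun_apply V ` G \<subseteq> G\<^sup>\<bottom>"
  proof -
    have "X \<subseteq> {x. V x \<in> X\<^sup>\<bottom>}"
    proof
      fix x assume "x \<in> X"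
      then obtain k w where x: "x = U (2 * k) w" "w \<in> W"
        unfolding X_def by blast
      have "inner (U (Suc (2 * k)) w) (U (2 * j) w') = 0" if "w' \<in> W" for j w'
        by (rule Uort) (use x that in presburger)+
      then show "x \<in> {x. V x \<in> X\<^sup>\<bottom>}"
        unfolding X_def by (auto simp: orthogonal_comp_iff x US)
    qed
    then have 1: "G \<subseteq> {x. V x \<in> X\<^sup>\<bottom>}"
      unfolding G_def
      by (intro closure_span_minimal preimage closed_orthogonal_comp subspace_orthogonal_comp)
    have "G \<subseteq> (blinfun_apply V ` G)\<^sup>\<bottom>"
      unfolding G_def
    proof (rule closure_span_minimal; fold G_def)
      show "X \<subseteq> (blinfun_apply V ` G)\<^sup>\<bottom>"
      proof
        fix x assume "x \<in> X"
        then show "x \<in> (blinfun_apply V ` G)\<^sup>\<bottom>"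
          using 1 by (auto intro!: orthogonal_compI dest: orthogonal_compD')
      qed
    qed (intro closed_orthogonal_comp subspace_orthogonal_comp)+
    then show ?thesis
      by (rule orthogonal_comp_swap)
  qed
  define K where "K = E \<inter> G\<^sup>\<bottom>"
  let ?Q = "E \<inter> P\<^sup>\<bottom>"
  have affK: "affiliated K" and affQ: "affiliated ?Q"
    unfolding K_def by (intro affiliated_Int affiliated_comp E affG affP)+
  obtain Z where Z: "central Z" and ZP: "Z \<inter> (G \<inter> P) \<preceq> K \<inter> ?Q"
    and ZQ: "Z\<^sup>\<bottom> \<inter> (K \<inter> ?Q) \<preceq> G \<inter> P"
    using comparison[OF affiliated_Int[OF affG affP] affiliated_Int[OF affK affQ]] by metis
  have affZ: "affiliated Z" and Z': "central (Z\<^sup>\<bottom>)"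
    using Z by (simp_all add: central_affiliated central_comp)
  have "Z \<inter> G \<preceq> ?Q"
    by (rule subeqv_relative_comp[OF E affP affG GE PE Z]) (use ZP in \<open>simp add: K_def\<close>)
  then have fin1: "fin (Z \<inter> G)"
    using Q by (rule fin_subeqv[rotated])
  \<comment> \<open>Complements in \<open>E\<close> exchange \<open>P\<close> with \<open>?Q\<close>
    and \<open>G\<close> with \<open>K\<close>, so that \<open>subeqv_relative_comp\<close> applies
    a second time, over the complement of \<open>Z\<close>.\<close>
  have compQ: "E \<inter> ?Q\<^sup>\<bottom> = P" and compK: "E \<inter> K\<^sup>\<bottom> = G"
    using relative_comp_comp[OF affP E PE] relative_comp_comp[OF affG E GE] by (simp_all add: K_def)
  have "Z\<^sup>\<bottom> \<inter> K \<preceq> E \<inter> ?Q\<^sup>\<bottom>"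
    by (rule subeqv_relative_comp[OF E affQ affK _ _ Z']) (use ZQ in \<open>simp_all add: compQ compK\<close>, auto simp: K_def)
  then have "fin (Z\<^sup>\<bottom> \<inter> K)"
    unfolding compQ using P by (rule fin_subeqv[rotated])
  have eqvG: "G \<simeq> blinfun_apply V ` G"
    using V(2) GE by (intro isometry_eqv V(1) affG) blast
  have "fin (Z\<^sup>\<bottom> \<inter> blinfun_apply V ` G)"
  proof (rule fin_subset[OF \<open>fin (Z\<^sup>\<bottom> \<inter> K)\<close>])
    show "affiliated (Z\<^sup>\<bottom> \<inter> blinfun_apply V ` G)"
      by (intro affiliated_Int affiliated_comp affZ eqv_affiliated[OF eqvG])
    show "Z\<^sup>\<bottom> \<inter> blinfun_apply V ` G \<subseteq> Z\<^sup>\<bottom> \<inter> K"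
      using VG VE GE by (auto simp: K_def)
  qed
  then have fin2: "fin (Z\<^sup>\<bottom> \<inter> G)"
    by (rule fin_eqv[OF _ eqv_sym[OF eqv_central_Int[OF Z' eqvG]]])
  \<comment> \<open>On the finite part \<open>C \<inter> G\<close>, applying \<open>V\<close> twice
    is onto. So \<open>w\<close> lies in the image \<open>E0\<close> of \<open>V\<close>, to which
    it is orthogonal.\<close>
  have zero: "w = 0" if C: "central C" "fin (C \<inter> G)" and w: "w \<in> C \<inter> W" for C w
  proof -
    have "blinfun_apply (V o\<^sub>L V) ` (C \<inter> G) = C \<inter> G"
    proof (rule fin_invariant_image[OF C(2) compose_in[OF V(1) V(1)]])
      show "norm ((V o\<^sub>L V) x) = norm x" if "x \<in> C \<inter> G" for x
        using that GE VE V(2) by auto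
      show "(V o\<^sub>L V) x \<in> C \<inter> G" if "x \<in> C \<inter> G" for x
        using that VVG C(1) V(1) by (auto simp: central_def)
    qed
    moreover have "w \<in> C \<inter> G"
      using w WG by blast
    ultimately obtain g where "g \<in> G" "w = V (V g)"
      by (metis IntE blinfun_apply_blinfun_compose imageE)
    then have "w \<in> E0"
      using GE VE VE0 by auto
    then have "inner w w = 0"
      using w by (auto simp: W_def dest: orthogonal_compD)
    then show ?thesis by simp
  qed
  show "E0 = E"
  proof (rule closed_subspace_eqI)
    show "w = 0" if "w \<in> E" "w \<in> E0\<^sup>\<bottom>" for w
    proof -
      have w: "w \<in> W"
        using that by (simp add: W_def)
      have "oproj Z w \<in> Z \<inter> W"
        by (rule central_oproj_in[OF Z affW w])
      then have "oproj Z w = 0"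
        by (rule zero[OF Z fin1])
      moreover have "w - oproj Z w \<in> Z\<^sup>\<bottom> \<inter> W"
        using central_oproj_in[OF Z' affW w] by (simp add: aff_oproj_comp[OF affZ])
      then have "w - oproj Z w = 0"
        by (rule zero[OF Z' fin2])
      ultimately show "w = 0" by simp
    qed
  qed (use affE0 E asm in \<open>auto simp: affiliatedD\<close>)
qed

text \<open>The part of the join outside \<open>Q\<close> is equivalent to a subspace of
  \<open>P\<close>.\<close>

lemma fin_join: "fin P \<Longrightarrow> fin Q \<Longrightarrow> fin (join P Q)"
proof -
  assume P: "fin P" and Q: "fin Q"
  have aff: "affiliated P" "affiliated Q"
    using P Q by (auto intro: fin_affiliated)
  have "fin (P \<inter> (P \<inter> Q)\<^sup>\<bottom>)"
    by (rule fin_subset[OF P]) (auto intro: affiliated_Int affiliated_comp aff)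
  then have "fin (join P Q \<inter> Q\<^sup>\<bottom>)"
    by (rule fin_eqv[OF _ parallelogram_eqv[OF aff]])
  then show ?thesis
    by (rule fin_sum[OF affiliated_join[OF aff] join_ge(2) Q])
qed

text \<open>Compare \<open>Q\<close> with the complement of \<open>P\<close>. Where the comparison
  goes the wrong way, that complement is subordinate to the finite \<open>Q\<close>; together with
  the finite \<open>P\<close> it exhausts a finite central subspace, which must be zero.\<close>

lemma subeqv_comp_if_properly_infinite:
  assumes pi: "\<And>Z. central Z \<Longrightarrow> fin Z \<Longrightarrow> Z = {0}" and P: "fin P" and Q: "fin Q"
  shows "Q \<preceq> P\<^sup>\<bottom>"
proof -
  have aff: "affiliated P" "affiliated Q"
    using P Q by (auto intro: fin_affiliated)
  obtain Z where Z: "central Z" "Z \<inter> Q \<preceq> P\<^sup>\<bottom>" "Z\<^sup>\<bottom> \<inter> P\<^sup>\<bottom> \<preceq> Q"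
    using comparison[OF aff(2) affiliated_comp[OF aff(1)]] by metis
  have Z': "central (Z\<^sup>\<bottom>)" and affZ: "affiliated Z" "affiliated (Z\<^sup>\<bottom>)"
    using Z(1) by (auto intro: central_comp central_affiliated)
  have "fin (Z\<^sup>\<bottom> \<inter> P\<^sup>\<bottom>)"
    using Q Z(3) by (rule fin_subeqv)
  moreover have "Z\<^sup>\<bottom> \<inter> P\<^sup>\<bottom> = Z\<^sup>\<bottom> \<inter> (Z\<^sup>\<bottom> \<inter> P)\<^sup>\<bottom>"
    using central_Int_comp[OF Z' aff(1), of UNIV] by simp
  moreover have "fin (Z\<^sup>\<bottom> \<inter> P)"
    by (rule fin_subset[OF P]) (auto intro: affiliated_Int affZ aff)
  ultimately have "fin (Z\<^sup>\<bottom>)"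
    using fin_sum[of "Z\<^sup>\<bottom>" "Z\<^sup>\<bottom> \<inter> P"] affZ by simp
  then have "Z\<^sup>\<bottom> = {0}"
    by (rule pi[OF Z'])
  then have "Z = UNIV"
    using aff_comp_comp[OF affZ(1)] by simp
  then show ?thesis
    using Z(2) by simp
qed

end

section \<open>Index calculus for operators with closed range\<close>

context real_vna
begin

lemma join_commute: "join L M = join M L"
  by (simp add: join_def Int_commute)

lemma relative_comp_chain:
  assumes X: "affiliated X" and J: "affiliated J" and R: "affiliated R" and sub: "X \<subseteq> J" "J \<subseteq> R"
  shows "(R \<inter> X\<^sup>\<bottom>) \<inter> (J \<inter> X\<^sup>\<bottom>)\<^sup>\<bottom> = R \<inter> J\<^sup>\<bottom>"
proof
  show "R \<inter> J\<^sup>\<bottom> \<subseteq> (R \<inter> X\<^sup>\<bottom>) \<inter> (J \<inter> X\<^sup>\<bottom>)\<^sup>\<bottom>"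
    using sub orthogonal_comp_anti_mono[OF sub(1)] orthogonal_comp_anti_mono[of "J \<inter> X\<^sup>\<bottom>" J] by blast
  show "(R \<inter> X\<^sup>\<bottom>) \<inter> (J \<inter> X\<^sup>\<bottom>)\<^sup>\<bottom> \<subseteq> R \<inter> J\<^sup>\<bottom>"
  proof
    fix x assume x: "x \<in> (R \<inter> X\<^sup>\<bottom>) \<inter> (J \<inter> X\<^sup>\<bottom>)\<^sup>\<bottom>"
    have "x \<in> J\<^sup>\<bottom>"
    proof (rule orthogonal_compI)
      fix y assume y: "y \<in> J"
      have "inner x (y - oproj X y) = 0"
        using x decompose_in[OF X J sub(1) y] by (intro orthogonal_compD[of x "J \<inter> X\<^sup>\<bottom>"]) auto
      moreover have "inner x (oproj X y) = 0"
        using x aff_oproj_in[OF X] by (intro orthogonal_compD[of x X]) auto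
      ultimately show "inner x y = 0"
        by (simp add: inner_diff_right)
    qed
    with x show "x \<in> R \<inter> J\<^sup>\<bottom>" by blast
  qed
qed

lemma fin_chain:
  assumes X: "affiliated X" and J: "affiliated J" and R: "affiliated R" and sub: "X \<subseteq> J" "J \<subseteq> R"
  shows "fin (R \<inter> X\<^sup>\<bottom>) \<longleftrightarrow> fin (R \<inter> J\<^sup>\<bottom>) \<and> fin (J \<inter> X\<^sup>\<bottom>)"
proof
  have aff: "affiliated (R \<inter> X\<^sup>\<bottom>)" "affiliated (R \<inter> J\<^sup>\<bottom>)" "affiliated (J \<inter> X\<^sup>\<bottom>)"
    by (intro affiliated_Int affiliated_comp X J R)+
  have subs: "R \<inter> J\<^sup>\<bottom> \<subseteq> R \<inter> X\<^sup>\<bottom>" "J \<inter> X\<^sup>\<bottom> \<subseteq> R \<inter> X\<^sup>\<bottom>"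
    using sub orthogonal_comp_anti_mono[OF sub(1)] by blast+
  show "fin (R \<inter> J\<^sup>\<bottom>) \<and> fin (J \<inter> X\<^sup>\<bottom>)" if "fin (R \<inter> X\<^sup>\<bottom>)"
    using fin_subset[OF that] aff subs by blast
  show "fin (R \<inter> X\<^sup>\<bottom>)" if "fin (R \<inter> J\<^sup>\<bottom>) \<and> fin (J \<inter> X\<^sup>\<bottom>)"
    using fin_sum[OF aff(1) subs(2)] that relative_comp_chain[OF X J R sub] by simp
qed

lemma fin_0: "fin {0}"
proof -
  have "M = {0}" if "{0} \<simeq> M" "M \<subseteq> {0}" for M
    using that subspace_0[OF affiliatedD(2)[OF eqv_affiliated(2)[OF that(1)]]] by blast
  then show ?thesis
    by (simp add: fin_def affiliated_0)
qed

lemma relative_comp_self: "affiliated L \<Longrightarrow> L \<inter> L\<^sup>\<bottom> = {0}"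
proof
  assume L: "affiliated L"
  show "L \<inter> L\<^sup>\<bottom> \<subseteq> {0}"
  proof
    fix x assume "x \<in> L \<inter> L\<^sup>\<bottom>"
    then have "inner x x = 0"
      by (intro orthogonal_compD[of x L]) auto
    then show "x \<in> {0}" by simp
  qed
  show "{0} \<subseteq> L \<inter> L\<^sup>\<bottom>"
    using subspace_0[OF affiliatedD(2)[OF L]] subspace_0[OF subspace_orthogonal_comp] by blast
qed

text \<open>\<open>T\<close> is injective modulo \<open>R \<inter> ker T\<close> and bounded below there, since its range is closed; so the
  preimage of the closure of \<open>T X\<close> is the closure of \<open>X + (R \<inter> ker T)\<close>.\<close>

lemma eqv_quotient_image:
  fixes T :: "'h \<Rightarrow>\<^sub>L 'h"
  assumes T: "T \<in> \<A>" and R: "affiliated R" and X: "affiliated X" "X \<subseteq> R"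
    and cl: "closed (blinfun_apply T ` R)"
  defines "N \<equiv> R \<inter> {x. T x = 0}"
  shows "R \<inter> (join N X)\<^sup>\<bottom> \<simeq> blinfun_apply T ` R \<inter> (blinfun_apply T ` X)\<^sup>\<bottom>"
proof -
  define C where "C = closure (blinfun_apply T ` X)"
  let ?J = "join N X"
  have affN: "affiliated N"
    unfolding N_def by (intro affiliated_Int R affiliated_kernel T)
  have affJ: "affiliated ?J"
    by (intro affiliated_join affN X)
  have affC: "affiliated C"
    unfolding C_def by (intro affiliated_closure_image T X)
  have affTR: "affiliated (blinfun_apply T ` R)"
    by (intro affiliated_image T R cl)
  have NR: "N \<subseteq> R"
    by (auto simp: N_def)
  have JR: "?J \<subseteq> R"
    by (intro join_least R NR X)
  have CT: "C \<subseteq> blinfun_apply T ` R"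
    unfolding C_def by (rule closure_minimal) (use X cl in auto)
  have Ccomp: "C\<^sup>\<bottom> = (blinfun_apply T ` X)\<^sup>\<bottom>"
    unfolding C_def by (rule orthogonal_comp_closure)
  define D where "D = R \<inter> N\<^sup>\<bottom>"
  have affD: "affiliated D"
    unfolding D_def by (intro affiliated_Int affiliated_comp R affN)
  have split: "x - oproj N x \<in> D" "T (x - oproj N x) = T x" if "x \<in> R" for x
    using decompose_in[OF affN R NR that] aff_oproj_in[OF affN, of x]
    by (auto simp: D_def N_def blinfun.diff_right)
  have TD: "blinfun_apply T ` D = blinfun_apply T ` R"
  proof
    show "blinfun_apply T ` R \<subseteq> blinfun_apply T ` D"
    proof clarify
      fix x assume "x \<in> R"
      then show "T x \<in> blinfun_apply T ` D"
        using split[of x] by (intro image_eqI[of _ _ "x - oproj N x"]) auto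
    qed
  qed (auto simp: D_def)
  have injD: "x = 0" if "x \<in> D" "T x = 0" for x
    using that orthogonal_compD[of x N x] by (auto simp: D_def N_def)
  obtain M where M: "\<And>x. x \<in> D \<Longrightarrow> norm x \<le> M * norm (T x)" "M \<ge> 0"
    by (rule bounded_below_if_closed_range[OF affiliatedD(1,2)[OF affD] injD])
      (use cl TD affD in auto)
  have NJ: "N \<subseteq> ?J" and XJ: "X \<subseteq> ?J"
    by (rule join_ge)+
  \<comment> \<open>Vectors \<open>w n\<close> of \<open>X\<close> with \<open>T (w n)\<close>
    tending to \<open>T x\<close> need not converge, but their components orthogonal to
    \<open>N\<close> do, since \<open>T\<close> is bounded below on \<open>D\<close>.\<close>
  have preimage: "x \<in> ?J" if x: "x \<in> R" "T x \<in> C" for x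
  proof -
    obtain g where g: "\<And>n. g n \<in> blinfun_apply T ` X" "g \<longlonglongrightarrow> T x"
      using x(2) unfolding C_def closure_sequential by metis
    then obtain w where w: "\<And>n. w n \<in> X" "\<And>n. g n = T (w n)"
      unfolding image_iff by metis
    let ?y = "x - oproj N x" and ?w = "\<lambda>n. w n - oproj N (w n)"
    have wR: "w n \<in> R" for n
      using w(1) X(2) by blast
    have bound: "norm (?w n - ?y) \<le> M * norm (g n - T x)" for n
    proof -
      have "?w n - ?y \<in> D"
        using split(1)[OF wR[of n]] split(1)[OF x(1)] affiliatedD(2)[OF affD] by (simp add: subspace_diff)
      then have "norm (?w n - ?y) \<le> M * norm (T (?w n - ?y))"
        by (rule M)
      also have "T (?w n - ?y) = g n - T x"
        using split(2)[OF wR[of n]] split(2)[OF x(1)] w(2)[of n]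
        by (simp only: blinfun.diff_right[of T "?w n" ?y])
      finally show ?thesis .
    qed
    have lim: "(\<lambda>n. M * norm (g n - T x)) \<longlonglongrightarrow> 0"
      using g(2) by (intro tendsto_mult_right_zero tendsto_norm_zero) (simp add: LIM_zero)
    have "(\<lambda>n. ?w n - ?y) \<longlonglongrightarrow> 0"
      by (rule Lim_null_comparison[OF always_eventually[OF allI[OF bound]] lim])
    then have wlim: "?w \<longlonglongrightarrow> ?y"
      by (rule LIM_zero_cancel)
    have wJ: "?w n \<in> ?J" for n
      using subspace_diff[OF affiliatedD(2)[OF affJ]] XJ NJ w(1)[of n] aff_oproj_in[OF affN, of "w n"] by blast
    have "?y \<in> ?J"
      by (rule closed_sequentially[OF affiliatedD(1)[OF affJ] wJ wlim])
    then have "?y + oproj N x \<in> ?J"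
      using subspace_add[OF affiliatedD(2)[OF affJ]] NJ aff_oproj_in[OF affN, of x] by blast
    then show ?thesis by simp
  qed
  have TJ: "T x \<in> C" if "x \<in> ?J" for x
  proof -
    have "affiliated {x. T x \<in> C}"
      unfolding affiliated_def
    proof (intro conjI ballI)
      show "closed {x. T x \<in> C}" "subspace {x. T x \<in> C}"
        by (intro closed_blinfun_preimage subspace_blinfun_preimage affiliatedD affC)+
      show "B x \<in> {x. T x \<in> C}" if "B \<in> real_commutant" "x \<in> {x. T x \<in> C}" for B x
        using affiliatedD(3)[OF affC that(1), of "T x"] that(2) commutantD[OF that(1) T, of x] by simp
    qed
    moreover have "N \<subseteq> {x. T x \<in> C}"
      using subspace_0[OF affiliatedD(2)[OF affC]] by (auto simp: N_def)
    moreover have "X \<subseteq> {x. T x \<in> C}"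
      using closure_subset[of "blinfun_apply T ` X"] by (auto simp: C_def)
    ultimately have "?J \<subseteq> {x. T x \<in> C}"
      by (rule join_least)
    with that show ?thesis by blast
  qed
  \<comment> \<open>Within \<open>R\<close>, following \<open>T\<close> by the projection off
    \<open>C\<close> kills exactly \<open>?J\<close>, so \<open>S\<close> is injective on the
    complement of \<open>?J\<close>.\<close>
  define S where "S = (id_blinfun - oproj C) o\<^sub>L T"
  have S: "S x = T x - oproj C (T x)" for x
    by (simp add: S_def blinfun.diff_left)
  have "R \<inter> ?J\<^sup>\<bottom> \<simeq> blinfun_apply T ` R \<inter> C\<^sup>\<bottom>"
  proof (rule eqv_if_quasi_affinity[of S])
    show "S \<in> \<A>"
      unfolding S_def by (intro compose_in diff_in id_in oproj_in_algebra affC T)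
    show "affiliated (R \<inter> ?J\<^sup>\<bottom>)" "affiliated (blinfun_apply T ` R \<inter> C\<^sup>\<bottom>)"
      by (intro affiliated_Int affiliated_comp R affJ affTR affC)+
    show "x = 0" if x: "x \<in> R \<inter> ?J\<^sup>\<bottom>" "S x = 0" for x
    proof -
      have "T x = oproj C (T x)"
        using x(2) by (simp add: S)
      then have "T x \<in> C"
        using aff_oproj_in[OF affC, of "T x"] by simp
      then have "x \<in> ?J"
        using x(1) preimage by blast
      then show ?thesis
        using x(1) relative_comp_self[OF affJ] by blast
    qed
    show "S x \<in> blinfun_apply T ` R \<inter> C\<^sup>\<bottom>" if "x \<in> R \<inter> ?J\<^sup>\<bottom>" for x
      unfolding S using that decompose_in[OF affC affTR CT, of "T x"] by blast
    show "z = 0" if z: "z \<in> blinfun_apply T ` R \<inter> C\<^sup>\<bottom>"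
      and ort: "\<And>x. x \<in> R \<inter> ?J\<^sup>\<bottom> \<Longrightarrow> inner z (S x) = 0" for z
    proof -
      obtain r where r: "r \<in> R" "z = T r"
        using z by blast
      have zC: "inner z c = 0" if "c \<in> C" for c
        using z that by (auto dest: orthogonal_compD)
      have "inner z (S (r - oproj ?J r)) = 0"
        using decompose_in[OF affJ R JR r(1)] by (rule ort)
      then have "inner z (T (r - oproj ?J r)) = 0"
        by (simp add: S inner_diff_right zC aff_oproj_in[OF affC])
      then have "inner z z = inner z (T (oproj ?J r))"
        by (simp add: blinfun.diff_right inner_diff_right r(2))
      also have "\<dots> = 0"
        by (intro zC TJ aff_oproj_in[OF affJ])
      finally show ?thesis by simp
    qed
  qed
  then show ?thesis
    by (simp only: Ccomp)
qed

text \<open>The subspace form of membership in \<open>fredholm_ops\<close> for invariant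
  \<open>R\<close> with closed image; the two directions are
  \<open>fredholm_ops_imp_fredholm_on\<close> and
  \<open>fredholm_on_imp_fredholm_ops\<close>.\<close>

definition fredholm_on :: "('h \<Rightarrow>\<^sub>L 'h) \<Rightarrow> 'h set \<Rightarrow> bool" where
  "fredholm_on T R \<longleftrightarrow> T \<in> \<A> \<and> affiliated R \<and> blinfun_apply T ` R \<subseteq> R \<and>
     closed (blinfun_apply T ` R) \<and> fin (R \<inter> {x. blinfun_apply T x = 0}) \<and>
     fin (R \<inter> (blinfun_apply T ` R)\<^sup>\<bottom>)"

lemma fredholm_onD:
  assumes "fredholm_on T R"
  shows "T \<in> \<A>" "affiliated R" "blinfun_apply T ` R \<subseteq> R" "closed (blinfun_apply T ` R)"
    "fin (R \<inter> {x. blinfun_apply T x = 0})" "fin (R \<inter> (blinfun_apply T ` R)\<^sup>\<bottom>)"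
    "affiliated (blinfun_apply T ` R)"
  using assms affiliated_image by (auto simp: fredholm_on_def)

end

text \<open>Isolates what the index calculus uses of the classes in the index group. The values of
  \<open>dim\<close> are meaningful on finite subspaces only.\<close>

locale real_vna_dimension = real_vna \<A> + comm_group G
  for \<A> :: "('h::{real_inner,banach} \<Rightarrow>\<^sub>L 'h) set" and G (structure) +
  fixes dim :: "'h set \<Rightarrow> 'b"
  assumes dim_closed: "fin L \<Longrightarrow> dim L \<in> carrier G"
    and dim_eqv: "fin L \<Longrightarrow> L \<simeq> M \<Longrightarrow> dim L = dim M"
    and dim_add: "fin L \<Longrightarrow> affiliated M \<Longrightarrow> M \<subseteq> L \<Longrightarrow> dim L = dim M \<otimes> dim (L \<inter> M\<^sup>\<bottom>)"
begin

lemma dim_chain: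
  assumes X: "affiliated X" and J: "affiliated J" and R: "affiliated R" and sub: "X \<subseteq> J" "J \<subseteq> R"
    and fin: "fin (R \<inter> X\<^sup>\<bottom>)"
  shows "dim (R \<inter> X\<^sup>\<bottom>) = dim (J \<inter> X\<^sup>\<bottom>) \<otimes> dim (R \<inter> J\<^sup>\<bottom>)"
  using dim_add[OF fin, of "J \<inter> X\<^sup>\<bottom>"] sub affiliated_Int[OF J affiliated_comp[OF X]]
  unfolding relative_comp_chain[OF X J R sub] by blast

definition ind_on :: "('h \<Rightarrow>\<^sub>L 'h) \<Rightarrow> 'h set \<Rightarrow> 'b" where
  "ind_on T R = dim (R \<inter> {x. blinfun_apply T x = 0}) \<otimes> inv (dim (R \<inter> (blinfun_apply T ` R)\<^sup>\<bottom>))"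

text \<open>In the index formula below the letters stand for the dimensions of
  \<open>N \<inter> X\<close>, of \<open>?J\<close> over \<open>X\<close>, of \<open>R\<close> over
  \<open>?J\<close>, of \<open>U\<close> over \<open>R\<close> and of \<open>R\<close> over
  \<open>?TR\<close>; \<open>c\<close> and \<open>d\<close> cancel.\<close>

lemma group_cancel_aux:
  assumes "a \<in> carrier G" "b \<in> carrier G" "c \<in> carrier G" "d \<in> carrier G" "e \<in> carrier G"
  shows "(a \<otimes> b) \<otimes> inv e = a \<otimes> ((b \<otimes> c) \<otimes> d) \<otimes> inv ((c \<otimes> e) \<otimes> d)"
proof -
  have "a \<otimes> ((b \<otimes> c) \<otimes> d) \<otimes> inv ((c \<otimes> e) \<otimes> d)
      = (a \<otimes> b) \<otimes> inv e \<otimes> (c \<otimes> inv c) \<otimes> (d \<otimes> inv d)"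
    by (simp only: inv_mult m_ac m_closed inv_closed assms)
  also have "\<dots> = (a \<otimes> b) \<otimes> inv e"
    using assms by simp
  finally show ?thesis by simp
qed

text \<open>The right-hand side of the index formula depends on \<open>X\<close>, \<open>U\<close> and the restriction of \<open>T\<close> to
  \<open>X\<close> only, not on \<open>R\<close>. This makes it comparable for two operators that agree on \<open>X\<close>.\<close>

lemma
  assumes T: "fredholm_on T R" and X: "affiliated X" "X \<subseteq> R" and U: "affiliated U" "R \<subseteq> U"
    and fin: "fin (R \<inter> X\<^sup>\<bottom>)" "fin (U \<inter> R\<^sup>\<bottom>)"
  shows fin_restrict: "fin (U \<inter> (blinfun_apply T ` X)\<^sup>\<bottom>)"
    and ind_on_restrict: "ind_on T R = dim (X \<inter> {x. blinfun_apply T x = 0}) \<otimes> dim (U \<inter> X\<^sup>\<bottom>)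
        \<otimes> inv (dim (U \<inter> (blinfun_apply T ` X)\<^sup>\<bottom>))"
proof -
  define N where "N = R \<inter> {x. blinfun_apply T x = 0}"
  define C where "C = closure (blinfun_apply T ` X)"
  let ?J = "join N X" and ?TR = "blinfun_apply T ` R"
  have TA: "T \<in> \<A>" and R: "affiliated R" and TR: "?TR \<subseteq> R" "closed ?TR" "affiliated ?TR"
    and finN: "fin N" and finQ: "fin (R \<inter> ?TR\<^sup>\<bottom>)"
    using fredholm_onD[OF T] by (auto simp: N_def)
  have affN: "affiliated N" and NR: "N \<subseteq> R"
    using finN by (auto simp: N_def fin_affiliated)
  have affC: "affiliated C"
    unfolding C_def by (intro affiliated_closure_image TA X)
  have CT: "C \<subseteq> ?TR"
    unfolding C_def by (rule closure_minimal) (use X TR in auto)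
  have Ccomp: "(blinfun_apply T ` X)\<^sup>\<bottom> = C\<^sup>\<bottom>"
    unfolding C_def by (rule orthogonal_comp_closure[symmetric])
  have affJ: "affiliated ?J" and JR: "?J \<subseteq> R" and XJ: "X \<subseteq> ?J"
    by (rule affiliated_join[OF affN X(1)], rule join_least[OF R NR X(2)], rule join_ge)
  have NX: "N \<inter> X = X \<inter> {x. blinfun_apply T x = 0}"
    using X by (auto simp: N_def)
  have affNX: "affiliated (N \<inter> X)"
    by (intro affiliated_Int affN X)
  have finRJ: "fin (R \<inter> ?J\<^sup>\<bottom>)" and finJX: "fin (?J \<inter> X\<^sup>\<bottom>)"
    using fin(1) fin_chain[OF X(1) affJ R XJ JR] by auto
  have eqvTR: "R \<inter> ?J\<^sup>\<bottom> \<simeq> ?TR \<inter> C\<^sup>\<bottom>"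
    using eqv_quotient_image[OF TA R X TR(2)] by (simp add: N_def Ccomp)
  have finTC: "fin (?TR \<inter> C\<^sup>\<bottom>)"
    by (rule fin_eqv[OF finRJ eqvTR])
  have finRC: "fin (R \<inter> C\<^sup>\<bottom>)"
    using fin_chain[OF affC TR(3) R CT TR(1)] finTC finQ by simp
  have CR: "C \<subseteq> R" using CT TR by blast
  have finUC: "fin (U \<inter> C\<^sup>\<bottom>)"
    using fin_chain[OF affC R U(1) CR U(2)] finRC fin(2) by simp
  then show "fin (U \<inter> (blinfun_apply T ` X)\<^sup>\<bottom>)"
    by (simp add: Ccomp)
  have finUX: "fin (U \<inter> X\<^sup>\<bottom>)"
    using fin_chain[OF X(1) R U(1) X(2) U(2)] fin by simp
  \<comment> \<open>By the parallelogram law, the part of the kernel outside \<open>X\<close>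
    reappears as the part of \<open>?J\<close> outside \<open>X\<close>.\<close>
  have eqN: "dim (N \<inter> (N \<inter> X)\<^sup>\<bottom>) = dim (?J \<inter> X\<^sup>\<bottom>)"
    by (rule dim_eqv[OF fin_subset[OF finN affiliated_Int[OF affN affiliated_comp[OF affNX]] Int_lower1]
        parallelogram_eqv[OF affN X(1)]])
  have "dim N = dim (N \<inter> X) \<otimes> dim (?J \<inter> X\<^sup>\<bottom>)"
    using dim_add[OF finN affNX Int_lower1] by (simp add: eqN)
  moreover have "dim (U \<inter> X\<^sup>\<bottom>) = (dim (?J \<inter> X\<^sup>\<bottom>) \<otimes> dim (R \<inter> ?J\<^sup>\<bottom>)) \<otimes> dim (U \<inter> R\<^sup>\<bottom>)"
    by (simp only: dim_chain[OF X(1) R U(1) X(2) U(2) finUX] dim_chain[OF X(1) affJ R XJ JR fin(1)])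
  moreover have "dim (U \<inter> C\<^sup>\<bottom>) = (dim (R \<inter> ?J\<^sup>\<bottom>) \<otimes> dim (R \<inter> ?TR\<^sup>\<bottom>)) \<otimes> dim (U \<inter> R\<^sup>\<bottom>)"
    by (simp only: dim_chain[OF affC R U(1) CR U(2) finUC] dim_chain[OF affC TR(3) R CT TR(1) finRC]
        dim_eqv[OF finRJ eqvTR])
  ultimately show "ind_on T R = dim (X \<inter> {x. blinfun_apply T x = 0}) \<otimes> dim (U \<inter> X\<^sup>\<bottom>)
        \<otimes> inv (dim (U \<inter> (blinfun_apply T ` X)\<^sup>\<bottom>))"
    unfolding ind_on_def N_def[symmetric] NX[symmetric] Ccomp
    using group_cancel_aux[OF dim_closed dim_closed dim_closed dim_closed dim_closed,
        OF fin_subset[OF finN affNX Int_lower1] finJX finRJ fin(2) finQ]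
    by simp
qed

text \<open>Both indices come from the index formula with the same \<open>X\<close> and
  \<open>U\<close>. The kernel of \<open>T'\<close> meets \<open>X\<close> inside the kernel of
  \<open>T\<close>, and the rest of it is equivalent to a subspace of \<open>R'\<close> orthogonal
  to \<open>X\<close>; the cokernel of \<open>T'\<close> lies in the part of \<open>U\<close>
  orthogonal to the image of \<open>X\<close>.\<close>

lemma fredholm_perturbation:
  assumes T: "fredholm_on T R"
    and T': "T' \<in> \<A>" "affiliated R'" "blinfun_apply T' ` R' \<subseteq> R'" "closed (blinfun_apply T' ` R')"
    and X: "affiliated X" "X \<subseteq> R" "X \<subseteq> R'" and U: "affiliated U" "R \<subseteq> U" "R' \<subseteq> U"
    and fin: "fin (R \<inter> X\<^sup>\<bottom>)" "fin (R' \<inter> X\<^sup>\<bottom>)" "fin (U \<inter> R\<^sup>\<bottom>)" "fin (U \<inter> R'\<^sup>\<bottom>)"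
    and eq: "\<And>x. x \<in> X \<Longrightarrow> blinfun_apply T' x = T x"
  shows "fredholm_on T' R' \<and> ind_on T' R' = ind_on T R"
proof -
  let ?N' = "R' \<inter> {x. blinfun_apply T' x = 0}"
  have affN': "affiliated ?N'"
    by (intro affiliated_Int affiliated_kernel T')
  have kerX: "X \<inter> {x. blinfun_apply T' x = 0} = X \<inter> {x. blinfun_apply T x = 0}"
    and imX: "blinfun_apply T' ` X = blinfun_apply T ` X"
    using eq by auto
  have NX: "?N' \<inter> X = X \<inter> {x. blinfun_apply T x = 0}"
    using X kerX by auto
  have affNX: "affiliated (?N' \<inter> X)"
    by (intro affiliated_Int affN' X)
  have "fin (?N' \<inter> X)"
    by (rule fin_subset[OF fredholm_onD(5)[OF T] affNX]) (use NX X in blast)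
  moreover have "fin (?N' \<inter> (?N' \<inter> X)\<^sup>\<bottom>)"
  proof -
    have "join ?N' X \<subseteq> R'"
      by (intro join_least T' X) auto
    then have "fin (join ?N' X \<inter> X\<^sup>\<bottom>)"
      by (intro fin_subset[OF fin(2)] affiliated_Int affiliated_join affiliated_comp affN' X) auto
    then show ?thesis
      by (rule fin_eqv[OF _ eqv_sym[OF parallelogram_eqv[OF affN' X(1)]]])
  qed
  ultimately have finN': "fin ?N'"
    by (rule fin_sum[OF affN' Int_lower1])
  have "fin (R' \<inter> (blinfun_apply T' ` R')\<^sup>\<bottom>)"
  proof (rule fin_subset[OF fin_restrict[OF T X(1,2) U(1,2) fin(1,3)]])
    show "affiliated (R' \<inter> (blinfun_apply T' ` R')\<^sup>\<bottom>)"
      by (intro affiliated_Int affiliated_comp affiliated_image T')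
    have "blinfun_apply T ` X \<subseteq> blinfun_apply T' ` R'"
      using imX X(3) by blast
    then show "R' \<inter> (blinfun_apply T' ` R')\<^sup>\<bottom> \<subseteq> U \<inter> (blinfun_apply T ` X)\<^sup>\<bottom>"
      using orthogonal_comp_anti_mono U(3) by blast
  qed
  with finN' T' have fred: "fredholm_on T' R'"
    by (simp add: fredholm_on_def)
  then show ?thesis
    using ind_on_restrict[OF T X(1,2) U(1,2) fin(1,3)]
      ind_on_restrict[OF fred X(1,3) U(1,3) fin(2,4)] by (simp add: kerX imX)
qed

lemma fredholm_on_image:
  assumes T: "fredholm_on T R" and cl: "closed (blinfun_apply T ` blinfun_apply T ` R)"
  shows "fredholm_on T (blinfun_apply T ` R) \<and> ind_on T (blinfun_apply T ` R) = ind_on T R"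
  by (rule fredholm_perturbation[where X = "blinfun_apply T ` R" and U = R, OF T])
    (simp_all add: fredholm_onD[OF T] cl relative_comp_self fin_0 image_mono)

text \<open>\<open>E\<close> measures how far apart the two subspaces are: each lies in the join of
  the other with \<open>E\<close>. For ranges of powers, \<open>finite_power_difference\<close>
  supplies it.\<close>

lemma fredholm_finite_perturbation:
  assumes T: "fredholm_on T R" and F: "F \<in> \<A>" "fin (closure (range (blinfun_apply F)))"
    and T': "affiliated R'" "blinfun_apply (T + F) ` R' \<subseteq> R'" "closed (blinfun_apply (T + F) ` R')"
    and E: "fin E" "R' \<subseteq> join R E" "R \<subseteq> join R' E"
  shows "fredholm_on (T + F) R' \<and> ind_on (T + F) R' = ind_on T R"
proof -
  have R: "affiliated R" and affE: "affiliated E"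
    using fredholm_onD[OF T] E fin_affiliated by auto
  let ?U = "join R R'" and ?Y = "R \<inter> R'"
  define X where "X = ?Y \<inter> {x. blinfun_apply F x = 0}"
  have affY: "affiliated ?Y" and affU: "affiliated ?U"
    by (intro affiliated_Int affiliated_join R T')+
  have affX: "affiliated X"
    unfolding X_def by (intro affiliated_Int affY affiliated_kernel F)
  \<comment> \<open>The join of \<open>K\<close> and \<open>K'\<close> exceeds \<open>K\<close> by
    no more than the join with \<open>E\<close> does, and the latter excess is equivalent to a
    subspace of \<open>E\<close>.\<close>
  have finU: "fin (join K K' \<inter> K\<^sup>\<bottom>)"
    if K: "affiliated K" "affiliated K'" "K' \<subseteq> join K E" for K K'
  proof -
    have "join K K' \<subseteq> join E K"
      using K join_ge[of E K] by (intro join_least affiliated_join affE K) (auto simp: join_commute join_ge)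
    moreover have "fin (join E K \<inter> K\<^sup>\<bottom>)"
      by (rule fin_eqv[OF _ parallelogram_eqv[OF affE K(1)]], rule fin_subset[OF E(1)])
        (auto intro!: affiliated_Int affiliated_comp affE K)
    ultimately show ?thesis
      by (elim fin_subset) (auto intro!: affiliated_Int affiliated_comp affiliated_join K)
  qed
  have finUR: "fin (?U \<inter> R\<^sup>\<bottom>)" and finUR': "fin (?U \<inter> R'\<^sup>\<bottom>)"
    using finU[OF R T'(1) E(2)] finU[OF T'(1) R E(3)] by (simp_all add: join_commute)
  \<comment> \<open>What \<open>?Y\<close> contains outside the kernel of \<open>F\<close> is
    equivalent to the closure of its image under \<open>F\<close>, a subspace of the finite closed
    range.\<close>
  have "fin (?Y \<inter> (?Y \<inter> {x. blinfun_apply F x = 0})\<^sup>\<bottom>)"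
  proof (rule fin_eqv[OF _ eqv_sym[OF eqv_closure_image[OF F(1) affY]]], rule fin_subset[OF F(2)])
    show "affiliated (closure (blinfun_apply F ` ?Y))"
      by (intro affiliated_closure_image F affY)
  qed (intro closure_mono, auto)
  then have finYX: "fin (?Y \<inter> X\<^sup>\<bottom>)"
    by (simp add: X_def)
  have "fin (R \<inter> ?Y\<^sup>\<bottom>)"
    by (rule fin_eqv[OF finUR' eqv_sym[OF parallelogram_eqv[OF R T'(1)]]])
  then have finRX: "fin (R \<inter> X\<^sup>\<bottom>)"
    using fin_chain[OF affX affY R _ Int_lower1] finYX by (auto simp: X_def)
  have "fin (R' \<inter> (R' \<inter> R)\<^sup>\<bottom>)"
    by (rule fin_eqv[OF _ eqv_sym[OF parallelogram_eqv[OF T'(1) R]]]) (use finUR in \<open>simp add: join_commute\<close>)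
  then have finRX': "fin (R' \<inter> X\<^sup>\<bottom>)"
    using fin_chain[OF affX affY T'(1) _ Int_lower2] finYX by (auto simp: X_def Int_commute)
  show ?thesis
    by (rule fredholm_perturbation[OF T add_in[OF fredholm_onD(1)[OF T] F(1)] T' affX _ _ affU _ _
          finRX finRX' finUR finUR'])
      (auto simp: X_def blinfun.add_left join_ge[THEN subsetD])
qed

end

section \<open>Complex von Neumann algebras\<close>

instance complex_hilbert_space \<subseteq> banach ..

lemma norm_scaleC: "norm (scaleC c x) = cmod c * norm x"
  for x :: "'h::complex_hilbert_space"
proof -
  have "cinner (scaleC c x) (scaleC c x) = c * cnj (cinner (scaleC c x) x)"
    by (metis cinner_commute cinner_scaleC_left)
  also have "\<dots> = (c * cnj c) * cnj (cinner x x)"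
    by (simp add: cinner_scaleC_left)
  also have "\<dots> = complex_of_real ((cmod c)\<^sup>2) * cnj (cinner x x)"
    by (simp only: complex_norm_square)
  finally have "inner (scaleC c x) (scaleC c x) = (cmod c)\<^sup>2 * inner x x"
    by (simp add: inner_eq_Re_cinner)
  then show ?thesis
    by (simp add: norm_eq_sqrt_inner real_sqrt_mult)
qed

lemma bounded_linear_scaleC: "bounded_linear (scaleC c :: 'h::complex_hilbert_space \<Rightarrow> 'h)"
  by (rule bounded_linear_intro[where K = "cmod c"])
    (simp_all add: scaleC_add_right scaleR_eq_scaleC scaleC_scaleC mult.commute norm_scaleC)

lemma adj_eq_if_is_adjoint: "is_adjoint A B \<Longrightarrow> adj A = B"
  by (rule adj_eqI) (simp add: is_adjoint_def inner_eq_Re_cinner)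

locale complex_vna =
  fixes \<A> :: "('h::complex_hilbert_space \<Rightarrow>\<^sub>L 'h) set"
  assumes vna: "von_neumann_algebra \<A>"
begin

lemma bicommutant_eq: "commutant (commutant \<A>) = \<A>"
  using vna by (simp add: von_neumann_algebra_def)

lemma algebra_bounded_ops: "S \<in> \<A> \<Longrightarrow> S \<in> bounded_ops"
proof -
  assume "S \<in> \<A>"
  then have "S \<in> commutant (commutant \<A>)"
    by (simp only: bicommutant_eq)
  then show "S \<in> bounded_ops"
    unfolding commutant_def[of "commutant \<A>"] by simp
qed

sublocale real_vna \<A>
proof
  show "adj S \<in> \<A>" if "S \<in> \<A>" for S
    using that vna adj_eq_if_is_adjoint unfolding von_neumann_algebra_def by blast
  fix S assume comm: "\<And>C. (\<And>R. R \<in> \<A> \<Longrightarrow> C o\<^sub>L R = R o\<^sub>L C) \<Longrightarrow> S o\<^sub>L C = C o\<^sub>L S"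
  have "S (scaleC c x) = scaleC c (S x)" for c x
  proof -
    \<comment> \<open>Multiplication by \<open>c\<close> commutes with the complex linear operators
      in \<open>\<A>\<close>, so it is admissible as a test operator in \<open>comm\<close>.\<close>
    define J where "J = Blinfun (scaleC c :: 'h \<Rightarrow> 'h)"
    have J: "blinfun_apply J = scaleC c"
      by (simp add: J_def bounded_linear_Blinfun_apply bounded_linear_scaleC)
    have "S o\<^sub>L J = J o\<^sub>L S"
      by (rule comm) (use algebra_bounded_ops in \<open>auto simp: blinfun_compose_eq_iff J bounded_ops_def\<close>)
    then show ?thesis
      by (simp add: blinfun_compose_eq_iff J)
  qed
  moreover have "S o\<^sub>L C = C o\<^sub>L S" if "C \<in> commutant \<A>" for C
    using that by (intro comm) (auto simp: commutant_def)
  ultimately have "S \<in> commutant (commutant \<A>)"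
    unfolding commutant_def[of "commutant \<A>"] by (simp add: bounded_ops_def)
  then show "S \<in> \<A>"
    by (simp only: bicommutant_eq)
qed

lemma is_adjoint_adj:
  assumes "S \<in> \<A>"
  shows "is_adjoint S (adj S)"
proof -
  obtain B where B: "is_adjoint S B"
    using vna assms unfolding von_neumann_algebra_def by blast
  show ?thesis
    using B adj_eq_if_is_adjoint[OF B] by simp
qed

section \<open>Dictionary between projections and their ranges\<close>

lemma projection_oproj: "affiliated L \<Longrightarrow> projection (oproj L)"
  using is_adjoint_adj[OF oproj_in_algebra, of L] adj_oproj[OF affiliatedD(1,2), of L]
  by (simp add: projection_def blinfun_eqI aff_oproj_ident aff_oproj_in)

lemma range_aff_oproj: "affiliated L \<Longrightarrow> range (blinfun_apply (oproj L)) = L"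
  by (simp add: range_oproj affiliatedD)

lemma proj_onto_eq_oproj: "affiliated L \<Longrightarrow> proj_onto L = oproj L"
  using proj_onto_range[OF projection_oproj, of L] by (simp add: range_aff_oproj)

lemma
  assumes "P \<in> \<A>" "projection P"
  shows affiliated_range: "affiliated (range (blinfun_apply P))"
    and oproj_range_projection: "oproj (range (blinfun_apply P)) = P"
proof -
  have "P (P x) = P x" for x
    using assms(2) unfolding projection_def by (metis blinfun_apply_blinfun_compose)
  then have "range (blinfun_apply P) = {x. (id_blinfun - P) x = 0}"
    by (auto simp: blinfun.diff_left)
  then show aff: "affiliated (range (blinfun_apply P))"
    by (simp only:) (intro affiliated_kernel diff_in id_in assms)
  show "oproj (range (blinfun_apply P)) = P"
    using proj_onto_eq_oproj[OF aff] proj_onto_range[OF assms(2)] by simp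
qed

lemma mvn_equiv_oproj_iff:
  assumes L: "affiliated L" and M: "affiliated M"
  shows "mvn_equiv \<A> (oproj L) (oproj M) \<longleftrightarrow> L \<simeq> M"
proof
  assume "mvn_equiv \<A> (oproj L) (oproj M)"
  then obtain V W where V: "V \<in> \<A>" "is_adjoint V W" "W o\<^sub>L V = oproj L" "V o\<^sub>L W = oproj M"
    by (auto simp: mvn_equiv_def)
  have WV: "W (blinfun_apply V x) = oproj L x" and VW: "V (blinfun_apply W x) = oproj M x" for x
    by (metis V(3) blinfun_apply_blinfun_compose) (metis V(4) blinfun_apply_blinfun_compose)
  have ip: "inner (blinfun_apply V x) y = inner x (W y)" for x y
    using inner_adj[of V] adj_eq_if_is_adjoint[OF V(2)] by simp
  have iso: "norm (blinfun_apply V x) = norm x" if "x \<in> L" for x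
    using that by (simp add: norm_eq_sqrt_inner ip WV aff_oproj_ident[OF L])
  have "blinfun_apply V ` L = M"
  proof
    show "blinfun_apply V ` L \<subseteq> M"
    proof clarify
      fix x assume "x \<in> L"
      then have "V x = oproj M (V x)"
        using VW[of "V x"] WV[of x] by (simp add: aff_oproj_ident[OF L])
      then show "V x \<in> M"
        using aff_oproj_in[OF M] by metis
    qed
    show "M \<subseteq> blinfun_apply V ` L"
    proof
      fix y assume "y \<in> M"
      then have y: "y = V (W y)"
        using VW[of y] by (simp add: aff_oproj_ident[OF M])
      then have "W y = oproj L (W y)"
        using WV[of "W y"] by simp
      then have "W y \<in> L"
        using aff_oproj_in[OF L] by metis
      then show "y \<in> blinfun_apply V ` L"
        using y by blast
    qed
  qed
  then show "L \<simeq> M"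
    using V(1) L M iso unfolding eqv_def by blast
next
  assume "L \<simeq> M"
  then obtain V where V: "V \<in> \<A>" "\<And>x. x \<in> L \<Longrightarrow> norm (blinfun_apply V x) = norm x"
    "blinfun_apply V ` L = M"
    by (auto simp: eqv_def)
  \<comment> \<open>\<open>V\<close> is arbitrary off \<open>L\<close>; cutting it off there makes
    \<open>W\<close> a partial isometry.\<close>
  define W where "W = V o\<^sub>L oproj L"
  have W: "W \<in> \<A>"
    unfolding W_def by (intro compose_in V oproj_in_algebra L)
  have ip: "inner (W x) (W y) = inner (oproj L x) (oproj L y)" for x y
  proof (rule inner_preserved_of_norm_preserved)
    have iso: "norm (W z) = norm (oproj L z)" for z
      by (simp add: W_def V(2) aff_oproj_in[OF L])
    then show "norm (W x) = norm (oproj L x)" "norm (W y) = norm (oproj L y)"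
      "norm (W x + W y) = norm (oproj L x + oproj L y)"
      using iso[of "x + y"] by (simp_all add: blinfun.add_right)
  qed
  have 1: "adj W o\<^sub>L W = oproj L"
  proof (rule blinfun_eqI)
    fix x
    have "inner y (adj W (W x)) = inner y (oproj L x)" for y
      using ip[of y x] aff_oproj_selfadjoint[OF L, of y "oproj L x"]
      by (simp add: inner_adj aff_oproj_ident[OF L] aff_oproj_in[OF L])
    then show "(adj W o\<^sub>L W) x = oproj L x"
      using inner_eq_all_iff by auto
  qed
  have "W (adj W y) = oproj M y" for y
  proof (rule sym, rule oproj_eqI)
    have WM: "W x \<in> M" for x
      using V(3) aff_oproj_in[OF L] by (auto simp: W_def)
    then show "W (adj W y) \<in> M" .
    show "y - W (adj W y) \<in> M\<^sup>\<bottom>"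
    proof (rule orthogonal_compI)
      fix m assume "m \<in> M"
      then obtain x where x: "x \<in> L" "m = W x"
        using V(3) by (auto simp: W_def aff_oproj_ident[OF L])
      have "inner m (W (adj W y)) = inner x (adj W (W (adj W y)))"
        by (simp add: x inner_adj)
      also have "\<dots> = inner x (oproj L (adj W y))"
        by (metis 1 blinfun_apply_blinfun_compose)
      also have "\<dots> = inner (oproj L x) (adj W y)"
        by (simp add: aff_oproj_selfadjoint[OF L])
      also have "\<dots> = inner m y"
        by (simp add: x aff_oproj_ident[OF L] inner_adj)
      finally show "inner (y - W (adj W y)) m = 0"
        by (simp add: inner_diff_left inner_commute[of m])
    qed
  qed (use M in \<open>auto simp: affiliatedD\<close>)
  then have "W o\<^sub>L adj W = oproj M"
    by (intro blinfun_eqI) simp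
  then show "mvn_equiv \<A> (oproj L) (oproj M)"
    unfolding mvn_equiv_def using W 1 adj_in is_adjoint_adj by blast
qed

lemma oproj_absorb_iff:
  assumes "affiliated L" "affiliated M"
  shows "oproj L o\<^sub>L oproj M = oproj M \<longleftrightarrow> M \<subseteq> L"
proof
  assume "oproj L o\<^sub>L oproj M = oproj M"
  then have "oproj L (oproj M x) = oproj M x" for x
    by (metis blinfun_apply_blinfun_compose)
  then show "M \<subseteq> L"
    using aff_oproj_in[OF assms(1)] aff_oproj_ident[OF assms(2)] by (metis subsetI)
next
  assume "M \<subseteq> L"
  then have "oproj M x \<in> L" for x
    using aff_oproj_in[OF assms(2)] by blast
  then show "oproj L o\<^sub>L oproj M = oproj M"
    by (intro blinfun_eqI) (simp add: aff_oproj_ident[OF assms(1)])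
qed

lemma oproj_compose_zero_iff:
  assumes "affiliated L" "affiliated M"
  shows "oproj L o\<^sub>L oproj M = 0 \<longleftrightarrow> M \<subseteq> L\<^sup>\<bottom>"
proof
  assume eq: "oproj L o\<^sub>L oproj M = 0"
  show "M \<subseteq> L\<^sup>\<bottom>"
  proof
    fix x assume "x \<in> M"
    then have "oproj L x = (oproj L o\<^sub>L oproj M) x"
      by (simp add: aff_oproj_ident[OF assms(2)])
    then show "x \<in> L\<^sup>\<bottom>"
      using aff_oproj_diff_in[OF assms(1), of x] by (simp add: eq blinfun.zero_left)
  qed
next
  assume "M \<subseteq> L\<^sup>\<bottom>"
  then have "oproj M x \<in> L\<^sup>\<bottom>" for x
    using aff_oproj_in[OF assms(2)] by blast
  then show "oproj L o\<^sub>L oproj M = 0"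
    by (intro blinfun_eqI) (simp add: aff_oproj_zero[OF assms(1)] blinfun.zero_left)
qed

lemma oproj_inject: "affiliated L \<Longrightarrow> affiliated M \<Longrightarrow> oproj L = oproj M \<longleftrightarrow> L = M"
proof -
  assume aff: "affiliated L" "affiliated M"
  have "L = M" if "oproj L = oproj M"
    using arg_cong[OF that, of "\<lambda>P. range (blinfun_apply P)"] by (simp add: range_aff_oproj aff)
  then show ?thesis by blast
qed

lemma finite_projection_oproj_iff:
  assumes L: "affiliated L"
  shows "finite_projection \<A> (oproj L) \<longleftrightarrow> fin L"
proof
  assume fp: "finite_projection \<A> (oproj L)"
  have "M = L" if M: "L \<simeq> M" "M \<subseteq> L" for M
  proof -
    have "affiliated M"
      using M(1) by (rule eqv_affiliated)
    then have "oproj M = oproj L"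
      using fp M L unfolding finite_projection_def
      by (simp add: oproj_in_algebra projection_oproj oproj_absorb_iff mvn_equiv_oproj_iff)
    then show ?thesis
      using \<open>affiliated M\<close> L by (simp add: oproj_inject)
  qed
  then show "fin L"
    using L by (simp add: fin_def)
next
  assume fin: "fin L"
  have "Q = oproj L" if Q: "Q \<in> \<A>" "projection Q" "oproj L o\<^sub>L Q = Q" "mvn_equiv \<A> (oproj L) Q" for Q
  proof -
    let ?M = "range (blinfun_apply Q)"
    have M: "affiliated ?M" "oproj ?M = Q"
      by (rule affiliated_range[OF Q(1,2)], rule oproj_range_projection[OF Q(1,2)])
    then have "?M \<subseteq> L" "L \<simeq> ?M"
      using Q(3,4) oproj_absorb_iff[OF L M(1)] mvn_equiv_oproj_iff[OF L M(1)] by simp_all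
    then have "?M = L"
      using fin by (simp add: fin_def)
    then show ?thesis
      using M(2) by simp
  qed
  then show "finite_projection \<A> (oproj L)"
    using L by (simp add: finite_projection_def oproj_in_algebra projection_oproj)
qed

lemma finite_projection_range:
  assumes "finite_projection \<A> P"
  shows "fin (range (blinfun_apply P))" "oproj (range (blinfun_apply P)) = P"
proof -
  have P: "P \<in> \<A>" "projection P"
    using assms by (auto simp: finite_projection_def)
  show "oproj (range (blinfun_apply P)) = P"
    by (rule oproj_range_projection[OF P])
  then show "fin (range (blinfun_apply P))"
    using finite_projection_oproj_iff[OF affiliated_range[OF P]] assms by simp
qed

section \<open>Orthogonal sums and the classes of finite subspaces\<close>

lemma join_comp_eq:
  assumes "affiliated L" "affiliated M" "M \<subseteq> L\<^sup>\<bottom>"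
  shows "join L M \<inter> L\<^sup>\<bottom> = M"
proof -
  have "L\<^sup>\<bottom> \<inter> (L\<^sup>\<bottom> \<inter> M\<^sup>\<bottom>)\<^sup>\<bottom> = M"
    by (rule relative_comp_comp[OF assms(2) affiliated_comp[OF assms(1)] assms(3)])
  then show ?thesis
    unfolding join_def by blast
qed

lemma join_relative_comp:
  assumes "affiliated M" "affiliated L" "M \<subseteq> L"
  shows "join M (L \<inter> M\<^sup>\<bottom>) = L"
proof
  have aff: "affiliated (L \<inter> M\<^sup>\<bottom>)"
    by (intro affiliated_Int affiliated_comp assms)
  show "join M (L \<inter> M\<^sup>\<bottom>) \<subseteq> L"
    by (intro join_least assms) auto
  show "L \<subseteq> join M (L \<inter> M\<^sup>\<bottom>)"
  proof
    fix x assume "x \<in> L"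
    then have "x - oproj M x \<in> join M (L \<inter> M\<^sup>\<bottom>)" "oproj M x \<in> join M (L \<inter> M\<^sup>\<bottom>)"
      using decompose_in[OF assms] join_ge[where L = M and M = "L \<inter> M\<^sup>\<bottom>"] aff_oproj_in[OF assms(1)]
      by blast+
    from subspace_add[OF affiliatedD(2)[OF affiliated_join[OF assms(1) aff]] this]
    show "x \<in> join M (L \<inter> M\<^sup>\<bottom>)" by simp
  qed
qed

text \<open>Makes the class of an orthogonal sum independent of the representatives: the two
  isometries combine into one from join to join.\<close>

lemma join_eqv:
  assumes eqv: "L \<simeq> L'" "M \<simeq> M'" and ort: "M \<subseteq> L\<^sup>\<bottom>" "M' \<subseteq> L'\<^sup>\<bottom>"
  shows "join L M \<simeq> join L' M'"
proof -
  have aff: "affiliated L" "affiliated M" "affiliated L'" "affiliated M'"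
    using eqv by (auto dest: eqv_affiliated)
  have "join L M \<inter> L\<^sup>\<bottom> \<simeq> M'"
    using eqv(2) by (simp add: join_comp_eq aff ort)
  then obtain K where K: "join L M \<simeq> K" "K \<subseteq> join L' M'" "L' \<subseteq> K" "M' \<subseteq> K"
    by (rule eqv_add_into[OF affiliated_join[OF aff(1,2)] join_ge(1) eqv(1) _ ort(2)
          affiliated_join[OF aff(3,4)] join_ge])
  then have "K = join L' M'"
    using join_least[OF eqv_affiliated(2)[OF K(1)] K(3,4)] by blast
  with K(1) show ?thesis by simp
qed

lemma oproj_join:
  assumes aff: "affiliated L" "affiliated M" and ort: "M \<subseteq> L\<^sup>\<bottom>"
  shows "oproj L + oproj M = oproj (join L M)"
proof (rule blinfun_eqI, rule sym)
  fix x
  have "oproj (join L M) x = oproj L x + oproj M x"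
  proof (rule oproj_eqI)
    have affJ: "affiliated (join L M)"
      by (intro affiliated_join aff)
    then show "closed (join L M)" "subspace (join L M)"
      by (simp_all add: affiliatedD)
    have in1: "oproj L x \<in> L" "oproj M x \<in> M"
      by (intro aff_oproj_in aff)+
    then show "oproj L x + oproj M x \<in> join L M"
      using join_ge[where L = L and M = M] by (intro subspace_add affiliatedD(2)[OF affJ]) auto
    have "x - (oproj L x + oproj M x) = (x - oproj L x) - oproj M x"
      by simp
    also have "\<dots> \<in> L\<^sup>\<bottom>"
      using in1 ort by (intro subspace_diff subspace_orthogonal_comp aff_oproj_diff_in aff) auto
    finally have 1: "x - (oproj L x + oproj M x) \<in> L\<^sup>\<bottom>" .
    have "x - (oproj L x + oproj M x) = (x - oproj M x) - oproj L x"
      by simp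
    also have "\<dots> \<in> M\<^sup>\<bottom>"
      using in1 orthogonal_comp_swap[OF ort]
      by (intro subspace_diff subspace_orthogonal_comp aff_oproj_diff_in aff) auto
    finally have "x - (oproj L x + oproj M x) \<in> L\<^sup>\<bottom> \<inter> M\<^sup>\<bottom>"
      using 1 by blast
    also have "L\<^sup>\<bottom> \<inter> M\<^sup>\<bottom> = (join L M)\<^sup>\<bottom>"
      unfolding join_def by (intro aff_comp_comp[symmetric] affiliated_Int affiliated_comp aff)
    finally show "x - (oproj L x + oproj M x) \<in> (join L M)\<^sup>\<bottom>" .
  qed
  then show "oproj (join L M) x = (oproj L + oproj M) x"
    by (simp add: blinfun.add_left)
qed

definition eqv_class :: "'h set \<Rightarrow> ('h \<Rightarrow>\<^sub>L 'h) set" where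
  "eqv_class L = mvn_class \<A> (oproj L)"

lemma mem_eqv_class_iff:
  assumes "affiliated L"
  shows "Q \<in> eqv_class L \<longleftrightarrow> (\<exists>M. fin M \<and> L \<simeq> M \<and> Q = oproj M)"
proof
  assume "Q \<in> eqv_class L"
  then have Q: "finite_projection \<A> Q" "mvn_equiv \<A> (oproj L) Q"
    by (auto simp: eqv_class_def mvn_class_def)
  show "\<exists>M. fin M \<and> L \<simeq> M \<and> Q = oproj M"
    using finite_projection_range[OF Q(1)] Q(2) mvn_equiv_oproj_iff[OF assms fin_affiliated] by metis
next
  assume "\<exists>M. fin M \<and> L \<simeq> M \<and> Q = oproj M"
  then show "Q \<in> eqv_class L"
    using assms by (auto simp: eqv_class_def mvn_class_def finite_projection_oproj_iff
        mvn_equiv_oproj_iff fin_affiliated)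
qed

lemma eqv_class_eq: "L \<simeq> M \<Longrightarrow> eqv_class L = eqv_class M"
proof -
  assume LM: "L \<simeq> M"
  have "L \<simeq> K \<longleftrightarrow> M \<simeq> K" for K
    using LM eqv_sym eqv_trans by blast
  then show ?thesis
    using eqv_affiliated[OF LM] by (simp add: set_eq_iff mem_eqv_class_iff)
qed

lemma oproj_0: "oproj {0} = (0 :: 'h \<Rightarrow>\<^sub>L 'h)"
proof (rule blinfun_eqI)
  fix x :: 'h
  show "oproj {0} x = blinfun_apply 0 x"
    using aff_oproj_in[OF affiliated_0, of x] by (simp add: blinfun.zero_left)
qed

lemma class_monoid_carrier_iff: "X \<in> carrier (class_monoid \<A>) \<longleftrightarrow> (\<exists>L. fin L \<and> X = eqv_class L)"
proof
  assume "X \<in> carrier (class_monoid \<A>)"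
  then obtain P where "finite_projection \<A> P" "X = mvn_class \<A> P"
    by (auto simp: class_monoid_def)
  then show "\<exists>L. fin L \<and> X = eqv_class L"
    unfolding eqv_class_def using finite_projection_range by metis
next
  assume "\<exists>L. fin L \<and> X = eqv_class L"
  then show "X \<in> carrier (class_monoid \<A>)"
    by (auto simp: class_monoid_def eqv_class_def finite_projection_oproj_iff fin_affiliated)
qed

lemma class_monoid_one: "\<one>\<^bsub>class_monoid \<A>\<^esub> = eqv_class {0}"
  by (simp add: class_monoid_def eqv_class_def oproj_0)

text \<open>The product is a union over all orthogonal pairs of representatives; all pairs give the
  same class, and \<open>L\<close> and \<open>M\<close> themselves form such a pair.\<close>

lemma class_monoid_mult:
  assumes L: "fin L" and M: "fin M" and ort: "M \<subseteq> L\<^sup>\<bottom>"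
  shows "eqv_class L \<otimes>\<^bsub>class_monoid \<A>\<^esub> eqv_class M = eqv_class (join L M)"
proof -
  have aff: "affiliated L" "affiliated M"
    using L M by (auto intro: fin_affiliated)
  let ?S = "{mvn_class \<A> (P + Q) | P Q. P \<in> eqv_class L \<and> Q \<in> eqv_class M \<and> P o\<^sub>L Q = 0}"
  have "?S = {eqv_class (join L M)}"
  proof
    show "?S \<subseteq> {eqv_class (join L M)}"
    proof clarify
      fix P Q assume PQ: "P \<in> eqv_class L" "Q \<in> eqv_class M" "P o\<^sub>L Q = 0"
      obtain L' M' where L': "fin L'" "L \<simeq> L'" "P = oproj L'" and M': "fin M'" "M \<simeq> M'" "Q = oproj M'"
        using PQ(1,2) mem_eqv_class_iff[OF aff(1)] mem_eqv_class_iff[OF aff(2)] by metis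
      have aff': "affiliated L'" "affiliated M'"
        using L' M' by (auto intro: fin_affiliated)
      have ort': "M' \<subseteq> L'\<^sup>\<bottom>"
        using PQ(3) L'(3) M'(3) oproj_compose_zero_iff[OF aff'] by simp
      have "mvn_class \<A> (P + Q) = eqv_class (join L' M')"
        by (simp add: eqv_class_def L'(3) M'(3) oproj_join[OF aff' ort'])
      also have "\<dots> = eqv_class (join L M)"
        by (rule eqv_class_eq[OF eqv_sym[OF join_eqv[OF L'(2) M'(2) ort ort']]])
      finally show "mvn_class \<A> (P + Q) = eqv_class (join L M)" .
    qed
    have "oproj L \<in> eqv_class L" "oproj M \<in> eqv_class M"
      using L M aff eqv_refl by (auto simp: mem_eqv_class_iff)
    moreover have "oproj L o\<^sub>L oproj M = 0"
      using ort oproj_compose_zero_iff[OF aff] by simp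
    moreover have "eqv_class (join L M) = mvn_class \<A> (oproj L + oproj M)"
      by (simp add: eqv_class_def oproj_join[OF aff ort])
    ultimately show "{eqv_class (join L M)} \<subseteq> ?S"
      by blast
  qed
  then show ?thesis
    by (simp add: class_monoid_def)
qed

end

locale properly_infinite_vna = complex_vna +
  assumes properly_infinite: "properly_infinite \<A>"
begin

lemma finite_central_zero:
  assumes "central Z" "fin Z"
  shows "Z = {0}"
proof -
  have affZ: "affiliated Z"
    using assms(2) by (rule fin_affiliated)
  have "oproj Z \<in> commutant \<A>"
    using central_oproj_commutant[OF assms(1)] algebra_bounded_ops[OF oproj_in_algebra[OF affZ]]
    by (simp add: commutant_def real_commutant_def)
  then have "oproj Z = 0"
    using properly_infinite oproj_in_algebra[OF affZ] assms(2) finite_projection_oproj_iff[OF affZ]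
    unfolding properly_infinite_def by blast
  then have "oproj Z = oproj {0}"
    by (simp add: oproj_0)
  then show ?thesis
    using oproj_inject[OF affZ affiliated_0] by simp
qed

text \<open>Proper infiniteness provides room next to \<open>L\<close>. It ensures that the union
  defining the product of two classes is not taken over the empty set.\<close>

lemma orthogonal_copy:
  assumes "fin L" "fin M"
  obtains M' where "fin M'" "M \<simeq> M'" "M' \<subseteq> L\<^sup>\<bottom>"
proof -
  have "M \<preceq> L\<^sup>\<bottom>"
  proof (rule subeqv_comp_if_properly_infinite[OF _ assms])
    fix Z assume "central Z" "fin Z"
    then show "Z = {0}"
      by (rule finite_central_zero)
  qed
  then obtain M' where M': "M \<simeq> M'" "M' \<subseteq> L\<^sup>\<bottom>"
    unfolding subeqv_def by blast
  show ?thesis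
    by (rule that[OF fin_eqv[OF assms(2) M'(1)] M'])
qed

text \<open>Representatives are chosen orthogonal, \<open>K'\<close> even to the whole join of
  \<open>L\<close> and \<open>M'\<close>; associativity and commutativity are then those of
  \<open>join\<close>.\<close>

sublocale classes: comm_monoid "class_monoid \<A>"
proof (rule comm_monoidI)
  let ?M = "class_monoid \<A>"
  fix X assume X: "X \<in> carrier ?M"
  then obtain L where L: "fin L" "X = eqv_class L"
    by (auto simp: class_monoid_carrier_iff)
  have affL: "affiliated L"
    using L(1) by (rule fin_affiliated)
  have "L \<subseteq> {0}\<^sup>\<bottom>"
    by simp
  moreover have "join {0} L = L"
    by (simp add: join_def aff_comp_comp[OF affL])
  ultimately show "\<one>\<^bsub>?M\<^esub> \<otimes>\<^bsub>?M\<^esub> X = X"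
    using class_monoid_mult[OF fin_0 L(1)] by (simp add: class_monoid_one L(2))
  fix Y assume Y: "Y \<in> carrier ?M"
  then obtain M where M0: "fin M" "Y = eqv_class M"
    by (auto simp: class_monoid_carrier_iff)
  obtain M' where M': "fin M'" "M \<simeq> M'" "M' \<subseteq> L\<^sup>\<bottom>"
    by (rule orthogonal_copy[OF L(1) M0(1)])
  have M: "fin M'" "Y = eqv_class M'" "M' \<subseteq> L\<^sup>\<bottom>"
    using M' M0 eqv_class_eq[OF M'(2)] by simp_all
  note XY = class_monoid_mult[OF L(1) M(1,3)]
  show "X \<otimes>\<^bsub>?M\<^esub> Y \<in> carrier ?M"
    unfolding L(2) M(2) XY using fin_join[OF L(1) M(1)] by (auto simp: class_monoid_carrier_iff)
  show "X \<otimes>\<^bsub>?M\<^esub> Y = Y \<otimes>\<^bsub>?M\<^esub> X"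
    unfolding L(2) M(2) XY class_monoid_mult[OF M(1) L(1) orthogonal_comp_swap[OF M(3)]]
    by (simp add: join_commute)
  fix Z assume Z: "Z \<in> carrier ?M"
  then obtain K where K0: "fin K" "Z = eqv_class K"
    by (auto simp: class_monoid_carrier_iff)
  obtain K' where K': "fin K'" "K \<simeq> K'" "K' \<subseteq> (join L M')\<^sup>\<bottom>"
    by (rule orthogonal_copy[OF fin_join[OF L(1) M(1)] K0(1)])
  have K: "fin K'" "Z = eqv_class K'" "K' \<subseteq> (join L M')\<^sup>\<bottom>"
    using K' K0 eqv_class_eq[OF K'(2)] by simp_all
  have aff: "affiliated M'" "affiliated K'"
    using M K fin_affiliated by auto
  have comp: "(join A B)\<^sup>\<bottom> = A\<^sup>\<bottom> \<inter> B\<^sup>\<bottom>" if "affiliated A" "affiliated B" for A B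
    unfolding join_def by (intro aff_comp_comp affiliated_Int affiliated_comp that)
  have ort: "K' \<subseteq> L\<^sup>\<bottom>" "K' \<subseteq> M'\<^sup>\<bottom>"
    using K(3) by (auto simp: comp[OF affL aff(1)])
  have "join M' K' \<subseteq> L\<^sup>\<bottom>"
    by (intro join_least affiliated_comp affL M ort)
  note YZ = class_monoid_mult[OF M(1) K(1) ort(2)]
    class_monoid_mult[OF L(1) fin_join[OF M(1) K(1)] this]
  have "join (join L M') K' = join L (join M' K')"
    unfolding join_def[of "join L M'"] join_def[of L "join M' K'"] comp[OF affL aff(1)] comp[OF aff]
    by (simp add: Int_assoc)
  then show "X \<otimes>\<^bsub>?M\<^esub> Y \<otimes>\<^bsub>?M\<^esub> Z = X \<otimes>\<^bsub>?M\<^esub> (Y \<otimes>\<^bsub>?M\<^esub> Z)"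
    unfolding L(2) M(2) K(2) XY YZ class_monoid_mult[OF fin_join[OF L(1) M(1)] K(1,3)] by simp
next
  show "\<one>\<^bsub>class_monoid \<A>\<^esub> \<in> carrier (class_monoid \<A>)"
    using fin_0 by (auto simp: class_monoid_carrier_iff class_monoid_one)
qed

lemma index_class_oproj: "index_class \<A> (oproj L) = groth_of (class_monoid \<A>) (eqv_class L)"
  by (simp add: index_class_def eqv_class_def)

lemma groth_of_mult:
  assumes "X \<in> carrier (class_monoid \<A>)" "Y \<in> carrier (class_monoid \<A>)"
  shows "groth_of (class_monoid \<A>) (X \<otimes>\<^bsub>class_monoid \<A>\<^esub> Y) =
    groth_of (class_monoid \<A>) X \<otimes>\<^bsub>index_group \<A>\<^esub> groth_of (class_monoid \<A>) Y"
  unfolding groth_of_def index_group_def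
  using classes.groth_mult[OF assms(1) classes.one_closed assms(2) classes.one_closed] by simp

text \<open>Additivity holds already in the monoid, because \<open>M\<close> and its complement in
  \<open>L\<close> form an orthogonal pair with join \<open>L\<close>.\<close>

sublocale dimension: real_vna_dimension \<A> "index_group \<A>" "\<lambda>L. index_class \<A> (oproj L)"
proof (intro real_vna_dimension.intro real_vna_axioms real_vna_dimension_axioms.intro)
  show "comm_group (index_group \<A>)"
    unfolding index_group_def by (rule classes.comm_group_groth_group)
  show "index_class \<A> (oproj L) \<in> carrier (index_group \<A>)" if "fin L" for L
  proof -
    have "eqv_class L \<in> carrier (class_monoid \<A>)"
      unfolding class_monoid_carrier_iff using that by blast
    then have "(eqv_class L, \<one>\<^bsub>class_monoid \<A>\<^esub>) \<in> carrier (class_monoid \<A>) \<times> carrier (class_monoid \<A>)"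
      using classes.one_closed by blast
    then show ?thesis
      unfolding index_class_oproj groth_of_def index_group_def groth_group_def partial_object.simps
      by (rule quotientI)
  qed
  show "index_class \<A> (oproj L) = index_class \<A> (oproj M)" if "L \<simeq> M" for L M
    using eqv_class_eq[OF that] by (simp add: index_class_oproj)
  show "index_class \<A> (oproj L) =
      index_class \<A> (oproj M) \<otimes>\<^bsub>index_group \<A>\<^esub> index_class \<A> (oproj (L \<inter> M\<^sup>\<bottom>))"
    if L: "fin L" and M: "affiliated M" "M \<subseteq> L" for L M
  proof -
    have affL: "affiliated L"
      using L by (rule fin_affiliated)
    have finM: "fin M" "fin (L \<inter> M\<^sup>\<bottom>)"
      using fin_subset[OF L] M affiliated_Int[OF affL affiliated_comp[OF M(1)]] by auto
    have "eqv_class L = eqv_class M \<otimes>\<^bsub>class_monoid \<A>\<^esub> eqv_class (L \<inter> M\<^sup>\<bottom>)"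
      using class_monoid_mult[OF finM] join_relative_comp[OF M(1) affL M(2)] by simp
    moreover have "eqv_class K \<in> carrier (class_monoid \<A>)" if "fin K" for K
      unfolding class_monoid_carrier_iff using that by blast
    ultimately show ?thesis
      unfolding index_class_oproj using finM by (simp only: groth_of_mult)
  qed
qed

end

section \<open>Fredholm operators in corners\<close>

context real_vna
begin

lemma subeqv_if_injective:
  assumes S: "S \<in> \<A>" and L: "affiliated L" and M: "affiliated M"
    and inj: "\<And>x. x \<in> L \<Longrightarrow> blinfun_apply S x = 0 \<Longrightarrow> x = 0" and sub: "blinfun_apply S ` L \<subseteq> M"
  shows "L \<preceq> M"
proof (rule subeqvI)
  have "L \<inter> {x. blinfun_apply S x = 0} = {0}"
    using inj subspace_0[OF affiliatedD(2)[OF L]] by (auto simp: blinfun.zero_right)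
  then show "L \<simeq> closure (blinfun_apply S ` L)"
    using eqv_closure_image[OF S L] by simp
  show "closure (blinfun_apply S ` L) \<subseteq> M"
    by (rule closure_minimal[OF sub affiliatedD(1)[OF M]])
qed

text \<open>\<open>b\<close> inverts \<open>T\<close> on \<open>D\<close> and vanishes off the
  image. It is bounded since \<open>T\<close> is bounded below on \<open>D\<close>, and it commutes
  with the commutant because preimages in \<open>D\<close> are unique.\<close>

lemma partial_inverse_exists:
  assumes T: "T \<in> \<A>" and D: "affiliated D" and cl: "closed (blinfun_apply T ` D)"
    and inj: "\<And>x. x \<in> D \<Longrightarrow> blinfun_apply T x = 0 \<Longrightarrow> x = 0"
  obtains b where "b \<in> \<A>" "\<And>y. blinfun_apply b y \<in> D"
    "\<And>y. blinfun_apply T (b y) = oproj (blinfun_apply T ` D) y"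
    "\<And>x. x \<in> D \<Longrightarrow> blinfun_apply b (T x) = x"
proof -
  let ?M = "blinfun_apply T ` D"
  have affM: "affiliated ?M"
    by (rule affiliated_image[OF T D cl])
  obtain K where K: "\<And>x. x \<in> D \<Longrightarrow> norm x \<le> K * norm (blinfun_apply T x)" "K \<ge> 0"
    by (rule bounded_below_if_closed_range[OF affiliatedD(1,2)[OF D] inj cl]) auto
  have eqI: "x = y" if "x \<in> D" "y \<in> D" "blinfun_apply T x = T y" for x y
    using inj[of "x - y"] that affiliatedD(2)[OF D] by (simp add: subspace_diff blinfun.diff_right)
  have "\<exists>d. d \<in> D \<and> T d = oproj ?M y" for y
    using aff_oproj_in[OF affM, of y] by (metis imageE)
  then obtain g where g: "\<And>y. g y \<in> D" "\<And>y. blinfun_apply T (g y) = oproj ?M y"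
    by metis
  have "bounded_linear g"
  proof (rule bounded_linear_intro[where K = K])
    show "g (x + y) = g x + g y" for x y
      by (rule eqI) (simp_all add: g blinfun.add_right subspace_add affiliatedD(2)[OF D])
    show "g (r *\<^sub>R x) = r *\<^sub>R g x" for r x
      by (rule eqI) (simp_all add: g blinfun.scaleR_right subspace_scale affiliatedD(2)[OF D])
    show "norm (g y) \<le> norm y * K" for y
    proof -
      have "norm (g y) \<le> K * norm (oproj ?M y)"
        using K(1)[OF g(1)[of y]] by (simp add: g(2))
      also have "\<dots> \<le> K * norm y"
        by (intro mult_left_mono K(2) norm_oproj_le affiliatedD affM)
      finally show ?thesis by (simp add: mult.commute)
    qed
  qed
  then obtain b where b: "blinfun_apply b = g"
    using bounded_linear_Blinfun_apply by blast
  show ?thesis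
  proof (rule that)
    show "b \<in> \<A>"
    proof (rule algebraI)
      fix C x assume C: "C \<in> real_commutant"
      have "g (blinfun_apply C x) = C (g x)"
      proof (rule eqI)
        show "C (g x) \<in> D"
          by (rule affiliatedD(3)[OF D C g(1)])
        show "T (g (C x)) = T (C (g x))"
          using commutantD[OF C T, of "g x"] commutantD[OF C oproj_in_algebra[OF affM], of x]
          by (simp add: g(2))
      qed (rule g)
      then show "b (blinfun_apply C x) = C (b x)"
        by (simp add: b)
    qed
    show "b y \<in> D" "T (b y) = oproj ?M y" for y
      by (simp_all add: b g)
    show "b (T x) = x" if "x \<in> D" for x
      by (rule eqI) (simp_all add: b g that aff_oproj_ident[OF affM])
  qed
qed

end

lemma (in real_vna) oproj_nested:
  assumes "affiliated L" "affiliated R" "L \<subseteq> R"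
  shows "oproj L (oproj R x) = oproj L x"
proof -
  have "x - oproj R x \<in> L\<^sup>\<bottom>"
    using aff_oproj_diff_in[OF assms(2)] orthogonal_comp_anti_mono[OF assms(3)] by blast
  then have "oproj L (x - oproj R x) = 0"
    by (rule aff_oproj_zero[OF assms(1)])
  then show ?thesis
    by (simp add: blinfun.diff_right)
qed

context complex_vna
begin

lemma corner_oproj_iff:
  assumes R: "affiliated R"
  shows "S \<in> corner \<A> (oproj R) \<longleftrightarrow> S \<in> \<A> \<and> oproj R o\<^sub>L S o\<^sub>L oproj R = S"
proof
  assume "S \<in> corner \<A> (oproj R)"
  then obtain A where A: "A \<in> \<A>" "S = oproj R o\<^sub>L A o\<^sub>L oproj R"
    by (auto simp: corner_def)
  then have "oproj R o\<^sub>L S o\<^sub>L oproj R = S"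
    by (intro blinfun_eqI) (simp add: aff_oproj_ident[OF R] aff_oproj_in[OF R])
  then show "S \<in> \<A> \<and> oproj R o\<^sub>L S o\<^sub>L oproj R = S"
    using A compose_in oproj_in_algebra[OF R] by simp
next
  assume "S \<in> \<A> \<and> oproj R o\<^sub>L S o\<^sub>L oproj R = S"
  then show "S \<in> corner \<A> (oproj R)"
    unfolding corner_def by (metis imageI)
qed

lemma oproj_in_corner:
  assumes L: "affiliated L" and R: "affiliated R" and sub: "L \<subseteq> R"
  shows "oproj L \<in> corner \<A> (oproj R)"
proof -
  have "oproj R (oproj L x) = oproj L x" for x
    by (rule aff_oproj_ident[OF R]) (use aff_oproj_in[OF L] sub in blast)
  then have "oproj R o\<^sub>L oproj L o\<^sub>L oproj R = oproj L"
    by (intro blinfun_eqI) (simp add: oproj_nested[OF L R sub])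
  then show ?thesis
    by (simp add: corner_oproj_iff[OF R] oproj_in_algebra[OF L])
qed

lemma oproj_relative_comp:
  assumes "affiliated M" "affiliated L" "M \<subseteq> L"
  shows "oproj (L \<inter> M\<^sup>\<bottom>) = oproj L - oproj M"
proof (rule blinfun_eqI)
  fix x
  have aff: "affiliated (L \<inter> M\<^sup>\<bottom>)"
    by (intro affiliated_Int affiliated_comp assms)
  have "oproj M + oproj (L \<inter> M\<^sup>\<bottom>) = oproj L"
    using oproj_join[OF assms(1) aff] join_relative_comp[OF assms] by simp
  then have "oproj (L \<inter> M\<^sup>\<bottom>) = oproj L - oproj M"
    by (metis add_diff_cancel_left')
  then show "oproj (L \<inter> M\<^sup>\<bottom>) x = (oproj L - oproj M) x"
    by simp
qed

context
  fixes T :: "'h \<Rightarrow>\<^sub>L 'h" and R :: "'h set"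
  assumes T: "T \<in> \<A>" and R: "affiliated R" and TR: "blinfun_apply T ` R \<subseteq> R"
    and cl: "closed (blinfun_apply T ` R)"
begin

private lemma affTR: "affiliated (blinfun_apply T ` R)"
  by (rule affiliated_image[OF T R cl])

private lemma affN: "affiliated (R \<inter> {x. blinfun_apply T x = 0})"
  by (intro affiliated_Int R affiliated_kernel T)

private lemma corner_in: "T o\<^sub>L oproj R \<in> corner \<A> (oproj R)"
proof -
  have "oproj R (T (oproj R x)) = T (oproj R x)" for x
    by (rule aff_oproj_ident[OF R]) (use TR aff_oproj_in[OF R] in blast)
  then have "oproj R o\<^sub>L (T o\<^sub>L oproj R) o\<^sub>L oproj R = T o\<^sub>L oproj R"
    by (intro blinfun_eqI) (simp add: aff_oproj_ident[OF R] aff_oproj_in[OF R])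
  then show ?thesis
    unfolding corner_oproj_iff[OF R] using T oproj_in_algebra[OF R] by (simp add: compose_in)
qed

text \<open>The projection \<open>p\<close> is injective on the kernel and \<open>q\<close> on the
  cokernel: a vector they kill is fixed by \<open>oproj R - p\<close> or \<open>oproj R - q\<close>,
  and the two inverse equations force it to be zero. So both spaces are subordinate to finite
  ones.\<close>

lemma fredholm_ops_imp_fredholm_on:
  assumes "T o\<^sub>L oproj R \<in> fredholm_ops \<A> (oproj R)"
  shows "fredholm_on T R"
proof -
  obtain p q b where p: "finite_projection \<A> p" and q: "finite_projection \<A> q"
    and E1: "(oproj R - q) o\<^sub>L (T o\<^sub>L oproj R) o\<^sub>L (oproj R - p) o\<^sub>L b = oproj R - q"
    and E2: "b o\<^sub>L (oproj R - q) o\<^sub>L (T o\<^sub>L oproj R) o\<^sub>L (oproj R - p) = oproj R - p"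
    using assms unfolding fredholm_ops_def invertible_up_to_def by blast
  define Lp where "Lp = range (blinfun_apply p)"
  define Lq where "Lq = range (blinfun_apply q)"
  have Lp: "fin Lp" "p = oproj Lp" and Lq: "fin Lq" "q = oproj Lq"
    unfolding Lp_def Lq_def using finite_projection_range[OF p] finite_projection_range[OF q] by simp_all
  have aff: "affiliated Lp" "affiliated Lq"
    using Lp Lq by (auto intro: fin_affiliated)
  have E1': "(oproj R - q) (T (oproj R ((oproj R - p) (b x)))) = (oproj R - q) x" for x
    using arg_cong[OF E1, of "\<lambda>A. blinfun_apply A x"] by simp
  have E2': "b ((oproj R - q) (T (oproj R ((oproj R - p) x)))) = (oproj R - p) x" for x
    using arg_cong[OF E2, of "\<lambda>A. blinfun_apply A x"] by simp
  have "R \<inter> {x. blinfun_apply T x = 0} \<preceq> Lp"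
  proof (rule subeqv_if_injective[OF _ affN aff(1)])
    show "oproj Lp \<in> \<A>"
      by (rule oproj_in_algebra[OF aff(1)])
    show "blinfun_apply (oproj Lp) ` (R \<inter> {x. blinfun_apply T x = 0}) \<subseteq> Lp"
      using aff_oproj_in[OF aff(1)] by blast
    show "x = 0" if x: "x \<in> R \<inter> {x. blinfun_apply T x = 0}" "oproj Lp x = 0" for x
    proof -
      have Rx: "oproj R x = x"
        using x(1) by (simp add: aff_oproj_ident[OF R])
      then have "(oproj R - p) x = x"
        by (simp add: Lp(2) x(2) blinfun.diff_left)
      then show ?thesis
        using E2'[of x] x(1) by (simp add: Rx blinfun.zero_right)
    qed
  qed
  then have 1: "fin (R \<inter> {x. blinfun_apply T x = 0})"
    by (rule fin_subeqv[OF Lp(1)])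
  have affK: "affiliated (R \<inter> (blinfun_apply T ` R)\<^sup>\<bottom>)"
    by (intro affiliated_Int affiliated_comp R affTR)
  have "R \<inter> (blinfun_apply T ` R)\<^sup>\<bottom> \<preceq> Lq"
  proof (rule subeqv_if_injective[OF _ affK aff(2)])
    show "oproj Lq \<in> \<A>"
      by (rule oproj_in_algebra[OF aff(2)])
    show "blinfun_apply (oproj Lq) ` (R \<inter> (blinfun_apply T ` R)\<^sup>\<bottom>) \<subseteq> Lq"
      using aff_oproj_in[OF aff(2)] by blast
    show "y = 0" if y: "y \<in> R \<inter> (blinfun_apply T ` R)\<^sup>\<bottom>" "oproj Lq y = 0" for y
    proof -
      have yq: "(oproj R - q) y = y"
        using y by (simp add: Lq(2) blinfun.diff_left aff_oproj_ident[OF R])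
      define u where "u = oproj R ((oproj R - p) (b y))"
      have sa: "inner v ((oproj R - q) w) = inner ((oproj R - q) v) w" for v w
        by (simp add: Lq(2) blinfun.diff_left inner_diff_left inner_diff_right
            aff_oproj_selfadjoint[OF R] aff_oproj_selfadjoint[OF aff(2)])
      have "inner y y = inner y ((oproj R - q) (T u))"
        using E1'[of y] by (simp only: u_def yq)
      also have "\<dots> = inner y (T u)"
        by (simp only: sa yq)
      also have "\<dots> = 0"
        using y(1) aff_oproj_in[OF R] by (intro orthogonal_compD[of y "blinfun_apply T ` R"]) (auto simp: u_def)
      finally show ?thesis by simp
    qed
  qed
  then have "fin (R \<inter> (blinfun_apply T ` R)\<^sup>\<bottom>)"
    by (rule fin_subeqv[OF Lq(1)])
  with 1 show ?thesis
    using T R TR cl by (simp add: fredholm_on_def)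
qed

text \<open>Take for \<open>p\<close> and \<open>q\<close> the projections onto the kernel and the
  cokernel, and for \<open>b\<close> the inverse of \<open>T\<close> between their complements in
  \<open>R\<close>.\<close>

lemma fredholm_on_imp_fredholm_ops:
  assumes "fredholm_on T R"
  shows "T o\<^sub>L oproj R \<in> fredholm_ops \<A> (oproj R)"
proof -
  let ?N = "R \<inter> {x. blinfun_apply T x = 0}" and ?TR = "blinfun_apply T ` R"
  define D where "D = R \<inter> ?N\<^sup>\<bottom>"
  define p where "p = oproj ?N"
  define q where "q = oproj (R \<inter> ?TR\<^sup>\<bottom>)"
  have affD: "affiliated D"
    unfolding D_def by (intro affiliated_Int affiliated_comp R affN)
  have affQ: "affiliated (R \<inter> ?TR\<^sup>\<bottom>)"
    by (intro affiliated_Int affiliated_comp R affTR)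
  have fin: "finite_projection \<A> p" "finite_projection \<A> q"
    using fredholm_onD(5,6)[OF assms] by (simp_all add: p_def q_def finite_projection_oproj_iff affN affQ)
  have Rp: "oproj R - p = oproj D"
    unfolding p_def D_def by (rule oproj_relative_comp[OF affN R Int_lower1, symmetric])
  have Rq: "oproj R - q = oproj ?TR"
    unfolding q_def oproj_relative_comp[OF affTR R TR] by simp
  have inj: "x = 0" if "x \<in> D" "T x = 0" for x
    using that relative_comp_self[OF affN] by (auto simp: D_def)
  have TD: "T (oproj D x) = T x" if "x \<in> R" for x
  proof -
    have "oproj D x = x - oproj ?N x"
      using that Rp[symmetric] by (simp add: p_def blinfun.diff_left aff_oproj_ident[OF R])
    then show ?thesis
      using aff_oproj_in[OF affN, of x] by (simp add: blinfun.diff_right)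
  qed
  have TDR: "blinfun_apply T ` D = ?TR"
  proof
    show "?TR \<subseteq> blinfun_apply T ` D"
    proof clarify
      fix x assume "x \<in> R"
      then show "T x \<in> blinfun_apply T ` D"
        using TD[of x] aff_oproj_in[OF affD, of x] by (metis imageI)
    qed
  qed (auto simp: D_def)
  have clD: "closed (blinfun_apply T ` D)"
    using cl TDR by simp
  obtain b where b: "b \<in> \<A>" "\<And>y. blinfun_apply b y \<in> D" "\<And>y. blinfun_apply T (b y) = oproj ?TR y"
    "\<And>x. x \<in> D \<Longrightarrow> blinfun_apply b (T x) = x"
    using partial_inverse_exists[OF T affD clD inj] unfolding TDR by metis
  have DR: "x \<in> R" if "x \<in> D" for x
    using that by (simp add: D_def)
  have bTR: "blinfun_apply b (oproj ?TR y) = b y" for y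
  proof -
    have "b (T (b y)) = b y"
      by (rule b(4)[OF b(2)])
    then show ?thesis by (simp only: b(3))
  qed
  have bR: "blinfun_apply b (oproj R y) = b y" for y
    using bTR[of "oproj R y"] bTR[of y] by (simp only: oproj_nested[OF affTR R TR])
  have "oproj R o\<^sub>L b o\<^sub>L oproj R = b"
    by (rule blinfun_eqI) (simp add: bR aff_oproj_ident[OF R] DR b(2))
  then have "b \<in> corner \<A> (oproj R)"
    by (simp add: corner_oproj_iff[OF R] b(1))
  moreover have "b = (oproj R - p) o\<^sub>L b o\<^sub>L (oproj R - q)"
    by (rule blinfun_eqI) (simp add: Rp Rq bTR aff_oproj_ident[OF affD] b(2))
  moreover have "(oproj R - q) o\<^sub>L (T o\<^sub>L oproj R) o\<^sub>L (oproj R - p) o\<^sub>L b = oproj R - q"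
    by (rule blinfun_eqI)
      (simp add: Rp Rq aff_oproj_ident[OF affD] aff_oproj_ident[OF R] b(2,3) DR
        aff_oproj_ident[OF affTR] aff_oproj_in[OF affTR])
  moreover have "b o\<^sub>L (oproj R - q) o\<^sub>L (T o\<^sub>L oproj R) o\<^sub>L (oproj R - p) = oproj R - p"
    by (rule blinfun_eqI)
      (simp add: Rp Rq bTR b(4) aff_oproj_ident[OF R] DR aff_oproj_in[OF affD])
  ultimately have "invertible_up_to \<A> (oproj R) p q (T o\<^sub>L oproj R)"
    unfolding invertible_up_to_def by blast
  moreover have "p \<in> corner \<A> (oproj R)" "q \<in> corner \<A> (oproj R)"
    unfolding p_def q_def by (rule oproj_in_corner[OF affN R Int_lower1] oproj_in_corner[OF affQ R Int_lower1])+
  ultimately show ?thesis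
    unfolding fredholm_ops_def using corner_in fin by blast
qed

end

end

section \<open>Ranges of powers\<close>

lemma im_pow_Suc: "im_pow T (Suc n) = blinfun_apply T ` im_pow T n"
  by (auto simp: im_pow_def image_image)

lemma im_pow_decreasing: "blinfun_apply T ` im_pow T n \<subseteq> im_pow T n"
proof (induction n)
  case (Suc n)
  then show ?case
    unfolding im_pow_Suc by (rule image_mono)
qed (simp add: im_pow_def)

context real_vna
begin

text \<open>Induction on \<open>(T + F)^(k+1) - T^(k+1) = T ((T + F)^k - T^k) + F (T + F)^k\<close>.
  The closure of the image of a finite subspace is finite, being equivalent to a part of that
  subspace.\<close>

lemma finite_power_difference:
  assumes T: "T \<in> \<A>" and F: "F \<in> \<A>" "fin (closure (range (blinfun_apply F)))"
  shows "\<exists>E. fin E \<and> (\<forall>x. (blinfun_apply (T + F) ^^ k) x - (blinfun_apply T ^^ k) x \<in> E)"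
proof (induction k)
  case 0
  show ?case
    using fin_0 by auto
next
  case (Suc k)
  then obtain E where E: "fin E" "\<And>x. (blinfun_apply (T + F) ^^ k) x - (blinfun_apply T ^^ k) x \<in> E"
    by blast
  have affE: "affiliated E"
    using E(1) by (rule fin_affiliated)
  let ?TE = "closure (blinfun_apply T ` E)" and ?F = "closure (range (blinfun_apply F))"
  have "fin (E \<inter> (E \<inter> {x. blinfun_apply T x = 0})\<^sup>\<bottom>)"
    by (intro fin_subset[OF E(1)] affiliated_Int affiliated_comp affiliated_kernel affE T) auto
  then have finTE: "fin ?TE"
    by (rule fin_eqv[OF _ eqv_closure_image[OF T affE]])
  have "(blinfun_apply (T + F) ^^ Suc k) x - (blinfun_apply T ^^ Suc k) x \<in> join ?TE ?F" for x
  proof -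
    let ?u = "(blinfun_apply (T + F) ^^ k) x" and ?v = "(blinfun_apply T ^^ k) x"
    have "T (?u - ?v) \<in> join ?TE ?F"
      by (rule subsetD[OF join_ge(1)], rule subsetD[OF closure_subset]) (use E(2) in blast)
    moreover have "F ?u \<in> join ?TE ?F"
      by (rule subsetD[OF join_ge(2)], rule subsetD[OF closure_subset]) blast
    ultimately have "T (?u - ?v) + F ?u \<in> join ?TE ?F"
      by (intro subspace_add affiliatedD(2)[OF fin_affiliated[OF fin_join[OF finTE F(2)]]])
    then show ?thesis
      by (simp add: blinfun.add_left blinfun.diff_right algebra_simps)
  qed
  then show ?case
    using fin_join[OF finTE F(2)] by blast
qed

end

context complex_vna
begin

lemma affiliated_im_pow:
  assumes T: "T \<in> \<A>" and "closed (im_pow T n)"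
  shows "affiliated (im_pow T n)"
proof -
  have "subspace (im_pow T n)"
    by (induction n) (simp_all add: im_pow_def[of T 0] im_pow_Suc subspace_blinfun_image)
  moreover have "blinfun_apply C x \<in> im_pow T n" if C: "C \<in> real_commutant" and "x \<in> im_pow T n" for C x
    using that(2)
  proof (induction n arbitrary: x)
    case (Suc n)
    then obtain y where "x = T y" "y \<in> im_pow T n"
      by (auto simp: im_pow_Suc)
    then show ?case
      using Suc.IH[of y] commutantD[OF C T, of y] by (auto simp: im_pow_Suc)
  qed (simp add: im_pow_def)
  ultimately have "affiliated (closure (im_pow T n))"
    by (rule affiliated_closure)
  then show ?thesis
    using assms(2) by simp
qed

lemma im_pow_subset_join:
  assumes "\<And>x. (blinfun_apply T ^^ n) x - (blinfun_apply T' ^^ n) x \<in> E"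
    and aff: "affiliated (im_pow T' n)" "affiliated E"
  shows "im_pow T n \<subseteq> join (im_pow T' n) E"
proof
  fix y assume "y \<in> im_pow T n"
  then obtain x where x: "y = (blinfun_apply T ^^ n) x"
    by (auto simp: im_pow_def)
  have "(blinfun_apply T' ^^ n) x \<in> join (im_pow T' n) E"
    by (rule subsetD[OF join_ge(1)]) (simp add: im_pow_def)
  moreover have "(blinfun_apply T ^^ n) x - (blinfun_apply T' ^^ n) x \<in> join (im_pow T' n) E"
    by (rule subsetD[OF join_ge(2)]) (rule assms(1))
  ultimately have "(blinfun_apply T' ^^ n) x + ((blinfun_apply T ^^ n) x - (blinfun_apply T' ^^ n) x)
      \<in> join (im_pow T' n) E"
    by (intro subspace_add affiliatedD(2)[OF affiliated_join[OF aff]])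
  then show "y \<in> join (im_pow T' n) E"
    by (simp add: x)
qed

lemma fredholm_ops_im_pow_iff:
  assumes "T \<in> \<A>" "\<And>k. k \<ge> n \<Longrightarrow> closed (im_pow T k)"
  shows "T o\<^sub>L proj_onto (im_pow T n) \<in> fredholm_ops \<A> (proj_onto (im_pow T n))
    \<longleftrightarrow> fredholm_on T (im_pow T n)"
proof -
  have aff: "affiliated (im_pow T n)"
    using assms by (intro affiliated_im_pow) auto
  \<comment> \<open>The image of the range of the power \<open>n\<close> is the range of the next
    power, whence the closedness.\<close>
  have cl: "closed (blinfun_apply T ` im_pow T n)"
    using assms(2)[of "Suc n"] by (simp add: im_pow_Suc)
  show ?thesis
    unfolding proj_onto_eq_oproj[OF aff]
    using fredholm_ops_imp_fredholm_on[OF assms(1) aff im_pow_decreasing cl]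
      fredholm_on_imp_fredholm_ops[OF assms(1) aff im_pow_decreasing cl] by blast
qed

end

context properly_infinite_vna
begin

text \<open>Passing to the next power replaces the subspace by its image, and
  \<open>fredholm_on_image\<close> applies because the image after that is closed too.\<close>

lemma fredholm_on_im_pow_stable:
  assumes "fredholm_on T (im_pow T n)" and cl: "\<And>k. k \<ge> n \<Longrightarrow> closed (im_pow T k)" and "n \<le> m"
  shows "fredholm_on T (im_pow T m) \<and> dimension.ind_on T (im_pow T m) = dimension.ind_on T (im_pow T n)"
  using assms(3)
proof (induction m rule: dec_induct)
  case (step m)
  have "closed (blinfun_apply T ` blinfun_apply T ` im_pow T m)"
    using cl[of "Suc (Suc m)"] step.hyps by (simp add: im_pow_Suc)
  with step.IH show ?case
    using dimension.fredholm_on_image[of T "im_pow T m"] by (simp add: im_pow_Suc)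
qed (simp add: assms(1))

lemma fredholm_index_eq_ind_on:
  assumes "fredholm_on T R"
  shows "fredholm_index \<A> (oproj R) (T o\<^sub>L oproj R) = dimension.ind_on T R"
proof -
  have R: "affiliated R" and TR: "affiliated (blinfun_apply T ` R)" "blinfun_apply T ` R \<subseteq> R"
    and cl: "closed (blinfun_apply T ` R)" and N: "fin (R \<inter> {x. blinfun_apply T x = 0})"
    using fredholm_onD[OF assms] by blast+
  have ran: "range (blinfun_apply (oproj R)) = R"
    by (rule range_aff_oproj[OF R])
  have ker: "{x. blinfun_apply (T o\<^sub>L oproj R) x = 0} \<inter> R = R \<inter> {x. blinfun_apply T x = 0}"
    by (auto simp: aff_oproj_ident[OF R])
  have "range (blinfun_apply (T o\<^sub>L oproj R)) = blinfun_apply T ` range (blinfun_apply (oproj R))"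
    by auto
  then have "closure (range (blinfun_apply (T o\<^sub>L oproj R))) = blinfun_apply T ` R"
    using cl by (simp add: ran)
  then show ?thesis
    unfolding fredholm_index_def dimension.ind_on_def ran ker
    by (simp add: proj_onto_eq_oproj[OF TR(1)] proj_onto_eq_oproj[OF fin_affiliated[OF N]]
        oproj_relative_comp[OF TR(1) R TR(2)])
qed

text \<open>The exponent \<open>n\<close> in the definition of the index is the least one with the
  properties that \<open>m\<close> has here, so \<open>n\<close> may be smaller than
  \<open>m\<close>; stability carries the index from \<open>n\<close> to \<open>m\<close>.\<close>

lemma b_fredholm_index_eq_ind_on:
  assumes T: "T \<in> \<A>" and cl: "\<And>k. k \<ge> m \<Longrightarrow> closed (im_pow T k)"
    and fred: "fredholm_on T (im_pow T m)"
  shows "b_fredholm_index \<A> T = dimension.ind_on T (im_pow T m)"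
proof -
  define P where "P = (\<lambda>n. (\<forall>k\<ge>n. closed (im_pow T k)) \<and>
    T o\<^sub>L proj_onto (im_pow T n) \<in> fredholm_ops \<A> (proj_onto (im_pow T n)))"
  define n where "n = (LEAST n. P n)"
  have "P m"
    using cl fred fredholm_ops_im_pow_iff[OF T cl] by (simp add: P_def)
  then have "P n" "n \<le> m"
    unfolding n_def by (rule LeastI, rule Least_le)
  then have cln: "closed (im_pow T k)" if "k \<ge> n" for k
    using that by (simp add: P_def)
  then have fredn: "fredholm_on T (im_pow T n)"
    using \<open>P n\<close> fredholm_ops_im_pow_iff[OF T, of n] by (simp add: P_def)
  have "proj_onto (im_pow T n) = oproj (im_pow T n)"
    by (rule proj_onto_eq_oproj[OF fredholm_onD(2)[OF fredn]])
  then have "b_fredholm_index \<A> T = dimension.ind_on T (im_pow T n)"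
    using fredholm_index_eq_ind_on[OF fredn]
    by (simp add: b_fredholm_index_def n_def P_def Let_def)
  then show ?thesis
    using fredholm_on_im_pow_stable[OF fredn cln \<open>n \<le> m\<close>] by simp
qed

end

theorem theorem5p8:
  fixes \<A> :: "('h::complex_hilbert_space \<Rightarrow>\<^sub>L 'h) set"
    and T F :: "'h \<Rightarrow>\<^sub>L 'h"
    and m :: nat
  assumes "von_neumann_algebra \<A>"
    and "properly_infinite \<A>"
    and "b_fredholm \<A> T"
    and "m = (LEAST n. b_fredholm_at \<A> T n)"
    and "F \<in> \<A>"
    and "finite_operator \<A> F"
    and "\<And>n. n \<ge> m \<Longrightarrow> closed (im_pow (T + F) n)"
  shows "b_fredholm \<A> (T + F) \<and> b_fredholm_index \<A> (T + F) = b_fredholm_index \<A> T"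
proof -
  interpret properly_infinite_vna \<A>
    by unfold_locales (rule assms)+
  have T: "T \<in> \<A>" and at: "b_fredholm_at \<A> T m"
    using assms(3,4) LeastI_ex[of "b_fredholm_at \<A> T"] by (auto simp: b_fredholm_def)
  have TF: "T + F \<in> \<A>"
    by (rule add_in[OF T assms(5)])
  let ?R = "im_pow T m" and ?R' = "im_pow (T + F) m"
  have cl: "closed (im_pow T k)" if "k \<ge> m" for k
    using at that by (simp add: b_fredholm_at_def)
  have fred: "fredholm_on T ?R"
    using at fredholm_ops_im_pow_iff[OF T cl] by (simp add: b_fredholm_at_def)
  have R: "affiliated ?R" and R': "affiliated ?R'"
    using cl assms(7) by (simp_all add: affiliated_im_pow T TF)
  have affF: "affiliated (closure (range (blinfun_apply F)))"
    by (rule affiliated_closure_image[OF assms(5) affiliated_UNIV])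
  have finF: "fin (closure (range (blinfun_apply F)))"
    using assms(6) by (simp add: finite_operator_def proj_onto_eq_oproj[OF affF]
        finite_projection_oproj_iff[OF affF])
  obtain E where E: "fin E" "\<And>x. (blinfun_apply (T + F) ^^ m) x - (blinfun_apply T ^^ m) x \<in> E"
    using finite_power_difference[OF T assms(5) finF, of m] by blast
  have affE: "affiliated E"
    using E(1) by (rule fin_affiliated)
  \<comment> \<open>A subspace contains the differences taken in either order, and each order gives
    one of the inclusions in \<open>sub\<close>.\<close>
  have E': "(blinfun_apply T ^^ m) x - (blinfun_apply (T + F) ^^ m) x \<in> E" for x
    using subspace_neg[OF affiliatedD(2)[OF affE] E(2)[of x]] by simp
  have sub: "?R' \<subseteq> join ?R E" "?R \<subseteq> join ?R' E"
    by (rule im_pow_subset_join[OF E(2) R affE], rule im_pow_subset_join[OF E' R' affE])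
  have cl': "closed (blinfun_apply (T + F) ` ?R')"
    using assms(7)[of "Suc m"] by (simp add: im_pow_Suc)
  have pert: "fredholm_on (T + F) ?R'" "dimension.ind_on (T + F) ?R' = dimension.ind_on T ?R"
    using dimension.fredholm_finite_perturbation[OF fred assms(5) finF R' im_pow_decreasing cl' E(1) sub]
    by auto
  \<comment> \<open>The range of the power of \<open>T\<close> lies in the join of
    \<open>?R'\<close> with the finite \<open>E\<close>, so it would be finite as well.\<close>
  have "\<not> fin ?R'"
  proof
    assume "fin ?R'"
    then have "fin ?R"
      using fin_subset[OF fin_join[OF _ E(1)] R sub(2)] by blast
    then show False
      using at by (simp add: b_fredholm_at_def proj_onto_eq_oproj[OF R] finite_projection_oproj_iff[OF R])
  qed
  moreover have "(T + F) o\<^sub>L proj_onto ?R' \<in> fredholm_ops \<A> (proj_onto ?R')"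
    using pert(1) fredholm_ops_im_pow_iff[OF TF, of m] assms(7) by blast
  ultimately have "b_fredholm_at \<A> (T + F) m"
    unfolding b_fredholm_at_def
    using assms(7) by (simp add: proj_onto_eq_oproj[OF R'] finite_projection_oproj_iff[OF R'])
  then have "b_fredholm \<A> (T + F)"
    using TF by (auto simp: b_fredholm_def)
  moreover have "b_fredholm_index \<A> (T + F) = b_fredholm_index \<A> T"
    using b_fredholm_index_eq_ind_on[OF TF assms(7) pert(1)] b_fredholm_index_eq_ind_on[OF T cl fred] pert(2)
    by simp
  ultimately show ?thesis ..
qed

end
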